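(* Let $\Gamma$ be a countable group admitting a proper non-elementary action on a hyperbolic graph of bounded valency. Then the bounded cohomology $\mathrm{H}_{\mathrm b}^2(\Gamma,\ell^p(\Gamma))$ is non-trivial for all $1\le p<\infty$. In particular $\Gamma$ is in the class $\mathcal{C}_{\mathrm{reg}}$.
   Context: Graphs are connected, in Serre's sense, and carry the path metric with unit edge length; bounded valency means a uniform bound on the number of edges issuing from a vertex; hyperbolic means Gromov-hyperbolic. Actions on graphs are by automorphisms; the action is proper if the kernel of $\Gamma\to\mathrm{Isom}(\mathcal{G})$ is finite and its image is discrete (equivalently vertex stabilisers are finite). For a hyperbolic proper geodesic metric space $X$ with Gromov boundary $\partial X$, a subgroup $H<\mathrm{Isom}(X)$ is elementary if it preserves a (non-empty) compact set in $X$, or a point of $\partial X$, or a pair of points of $\partial X$; an action is non-elementary if the image of the group in $\mathrm{Isom}(X)$ is not elementary. $\mathrm{H}_{\mathrm b}^n(\Gamma,V)$ is the bounded cohomology of the discrete group $\Gamma$ with coefficients in an isometric Banach $\Gamma$-module $V$: the cohomology of the complex of $\Gamma$-equivariant bounded functions $\Gamma^{n+1}\to V$ with the homogeneous coboundary. $\ell^p(\Gamma)$ carries the left regular representation. $\mathcal{C}_{\mathrm{reg}}$ is the class of countable groups $\Gamma$ for which $\mathrm{H}_{\mathrm b}^2(\Gamma,\ell^2(\Gamma))$ is non-trivial. *)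

theory Defs
  imports
    "HOL-Analysis.Analysis"
    "HOL-Algebra.Group_Action"
    "HOL-Library.Function_Algebras"
    "Graph_Theory.Bidirected_Digraph"
    "Graph_Theory.Digraph_Component"
begin

section \<open>Hyperbolic metric spaces and their isometries\<close>

context Metric_space
begin

definition gromov_product :: "'a \<Rightarrow> 'a \<Rightarrow> 'a \<Rightarrow> real" where
  "gromov_product w x y = (d x w + d y w - d x y) / 2"

definition hyperbolic :: bool where
  "hyperbolic \<longleftrightarrow> (\<exists>\<delta>\<ge>0. \<forall>w\<in>M. \<forall>x\<in>M. \<forall>y\<in>M. \<forall>z\<in>M.
     gromov_product w x z \<ge> min (gromov_product w x y) (gromov_product w y z) - \<delta>)"

text \<open>The Gromov boundary consists of classes of sequences converging at infinity. Each class
  contains all sequences in the space that represent the boundary point.\<close>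

definition gromov_sequences :: "(nat \<Rightarrow> 'a) set" where
  "gromov_sequences = {s. range s \<subseteq> M \<and>
     (\<forall>w\<in>M. filterlim (\<lambda>(i, j). gromov_product w (s i) (s j)) at_top (sequentially \<times>\<^sub>F sequentially))}"

definition gromov_equiv :: "((nat \<Rightarrow> 'a) \<times> (nat \<Rightarrow> 'a)) set" where
  "gromov_equiv = {(s, t). s \<in> gromov_sequences \<and> t \<in> gromov_sequences \<and>
     (\<forall>w\<in>M. filterlim (\<lambda>(i, j). gromov_product w (s i) (t j)) at_top (sequentially \<times>\<^sub>F sequentially))}"

definition gromov_boundary :: "(nat \<Rightarrow> 'a) set set" where
  "gromov_boundary = gromov_sequences // gromov_equiv"

definition boundary_map :: "('a \<Rightarrow> 'a) \<Rightarrow> (nat \<Rightarrow> 'a) set \<Rightarrow> (nat \<Rightarrow> 'a) set" where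
  "boundary_map f \<xi> = (\<lambda>s. f \<circ> s) ` \<xi>"

definition isometry_group :: "('a \<Rightarrow> 'a) monoid" where
  "isometry_group = BijGroup M
     \<lparr>carrier := {f \<in> Bij M. \<forall>x\<in>M. \<forall>y\<in>M. d (f x) (f y) = d x y}\<rparr>"

lemma isometry_group_carrier:
  "f \<in> carrier isometry_group \<longleftrightarrow> f \<in> Bij M \<and> (\<forall>x\<in>M. \<forall>y\<in>M. d (f x) (f y) = d x y)"
  by (simp add: isometry_group_def)

lemma group_isometry_group: "group isometry_group"
proof -
  interpret B: group "BijGroup M" by (rule group_BijGroup)
  define I where "I = {f \<in> Bij M. \<forall>x\<in>M. \<forall>y\<in>M. d (f x) (f y) = d x y}"
  have II: "f \<in> I" if "f \<in> Bij M" "\<And>x y. x \<in> M \<Longrightarrow> y \<in> M \<Longrightarrow> d (f x) (f y) = d x y" for f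
    using that unfolding I_def by blast
  have IB: "f \<in> Bij M" if "f \<in> I" for f
    using that unfolding I_def by blast
  have Id: "d (f x) (f y) = d x y" if "f \<in> I" "x \<in> M" "y \<in> M" for f x y
    using that unfolding I_def by blast
  have IM: "f ` M = M" if "f \<in> I" for f
    using IB[OF that] unfolding Bij_def bij_betw_def by blast
  have "subgroup I (BijGroup M)"
  proof (rule B.subgroupI)
    show "I \<subseteq> carrier (BijGroup M)"
      unfolding BijGroup_def partial_object.simps using IB by blast
    have "(\<lambda>x\<in>M. x) \<in> I" by (rule II) (simp_all add: id_Bij)
    then show "I \<noteq> {}" by blast
  next
    fix f assume f: "f \<in> I"
    have inv: "inv\<^bsub>BijGroup M\<^esub> f = (\<lambda>x\<in>M. inv_into M f x)"
      by (rule inv_BijGroup[OF IB[OF f]])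
    show "inv\<^bsub>BijGroup M\<^esub> f \<in> I"
      unfolding inv
    proof (rule II[OF restrict_inv_into_Bij[OF IB[OF f]]])
      fix x y assume xy: "x \<in> M" "y \<in> M"
      then have "x \<in> f ` M" "y \<in> f ` M" using IM[OF f] by blast+
      then have "d (inv_into M f x) (inv_into M f y) = d x y"
        using Id[OF f inv_into_into[of x f M] inv_into_into[of y f M]] by (simp only: f_inv_into_f)
      then show "d (restrict (inv_into M f) M x) (restrict (inv_into M f) M y) = d x y"
        using xy by (simp only: restrict_apply' if_True)
    qed
  next
    fix f g assume f: "f \<in> I" and g: "g \<in> I"
    have fg: "f \<otimes>\<^bsub>BijGroup M\<^esub> g = compose M f g"
      unfolding BijGroup_def using IB[OF f] IB[OF g] by simp
    show "f \<otimes>\<^bsub>BijGroup M\<^esub> g \<in> I"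
      unfolding fg
    proof (rule II[OF compose_Bij[OF IB[OF f] IB[OF g]]])
      fix x y assume xy: "x \<in> M" "y \<in> M"
      then have "g x \<in> M" "g y \<in> M" using IM[OF g] by blast+
      then show "d (compose M f g x) (compose M f g y) = d x y"
        using Id[OF f] Id[OF g] xy by (simp only: compose_eq)
    qed
  qed
  then show ?thesis unfolding isometry_group_def I_def[symmetric] by (rule B.subgroup_imp_group)
qed

text \<open>The compact-open topology on the isometry group.\<close>

definition isometry_topology :: "('a \<Rightarrow> 'a) topology" where
  "isometry_topology = topology_generated_by
     {{f \<in> carrier isometry_group. f ` K \<subseteq> U} | K U. compactin mtopology K \<and> openin mtopology U}"

definition elementary :: "('a \<Rightarrow> 'a) set \<Rightarrow> bool" where
  "elementary H \<longleftrightarrow>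
     (\<exists>K. K \<noteq> {} \<and> compactin mtopology K \<and> (\<forall>h\<in>H. h ` K = K)) \<or>
     (\<exists>\<xi>\<in>gromov_boundary. \<forall>h\<in>H. boundary_map h \<xi> = \<xi>) \<or>
     (\<exists>P\<subseteq>gromov_boundary. card P = 2 \<and> (\<forall>h\<in>H. boundary_map h ` P = P))"

text \<open>In the next two definitions \<open>\<alpha>\<close> is meant to be a homomorphism from \<open>\<Gamma>\<close> to the
  isometry group.\<close>

definition proper_action :: "('g, 'm) monoid_scheme \<Rightarrow> ('g \<Rightarrow> 'a \<Rightarrow> 'a) \<Rightarrow> bool" where
  "proper_action \<Gamma> \<alpha> \<longleftrightarrow>
     finite (kernel \<Gamma> isometry_group \<alpha>) \<and>
     subtopology isometry_topology (\<alpha> ` carrier \<Gamma>) = discrete_topology (\<alpha> ` carrier \<Gamma>)"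

definition nonelementary_action :: "('g, 'm) monoid_scheme \<Rightarrow> ('g \<Rightarrow> 'a \<Rightarrow> 'a) \<Rightarrow> bool" where
  "nonelementary_action \<Gamma> \<alpha> \<longleftrightarrow> \<not> elementary (\<alpha> ` carrier \<Gamma>)"

end


section \<open>Graphs in the sense of Serre\<close>

text \<open>A graph in Serre's sense is a bidirected digraph: \<open>arev\<close> is a fixed-point-free involution on
  the arcs exchanging tail and head (and the identity off the arcs). Loops and multiple edges are
  allowed. In \<open>out_arcs\<close>, a loop counts twice, once for each of its two orientations.\<close>

definition bounded_valency :: "('a, 'b) pre_digraph \<Rightarrow> bool" where
  "bounded_valency G \<longleftrightarrow>
     (\<exists>N. \<forall>v\<in>verts G. finite (out_arcs G v) \<and> card (out_arcs G v) \<le> N)"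

text \<open>Points of the geometric realization: \<open>Inl v\<close> is a vertex, and the point at distance
  \<open>t \<in> {0<..<1}\<close> from the tail of the arc \<open>e\<close> is the class of \<open>(e, t)\<close> under the identification
  of \<open>(e, t)\<close> with \<open>(arev e, 1 - t)\<close>.\<close>

type_synonym ('a, 'b) graph_point = "'a + ('b \<times> real) set"

definition edge_point ::
  "('a, 'b) pre_digraph \<Rightarrow> ('b \<Rightarrow> 'b) \<Rightarrow> 'b \<Rightarrow> real \<Rightarrow> ('a, 'b) graph_point" where
  "edge_point G arev e t =
     (if t = 0 then Inl (tail G e) else if t = 1 then Inl (head G e)
      else Inr {(e, t), (arev e, 1 - t)})"

definition realization :: "('a, 'b) pre_digraph \<Rightarrow> ('b \<Rightarrow> 'b) \<Rightarrow> ('a, 'b) graph_point set" where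
  "realization G arev = Inl ` verts G \<union> (\<Union>e\<in>arcs G. edge_point G arev e ` {0..1})"

text \<open>A piecewise linear path is a list of segments \<open>(e, s, t)\<close>; each runs along the arc \<open>e\<close> from
  parameter \<open>s\<close> to parameter \<open>t\<close>.\<close>

fun pl_path :: "('a, 'b) pre_digraph \<Rightarrow> ('b \<Rightarrow> 'b) \<Rightarrow> ('a, 'b) graph_point \<Rightarrow>
    ('b \<times> real \<times> real) list \<Rightarrow> ('a, 'b) graph_point \<Rightarrow> bool" where
  "pl_path G arev x [] y \<longleftrightarrow> x = y"
| "pl_path G arev x ((e, s, t) # ps) y \<longleftrightarrow>
     e \<in> arcs G \<and> s \<in> {0..1} \<and> t \<in> {0..1} \<and> x = edge_point G arev e s \<and>
     pl_path G arev (edge_point G arev e t) ps y"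

definition pl_length :: "('b \<times> real \<times> real) list \<Rightarrow> real" where
  "pl_length ps = (\<Sum>(e, s, t)\<leftarrow>ps. \<bar>s - t\<bar>)"

text \<open>The value 0 outside the realization is only there because \<open>Metric_space\<close> asks for a
  symmetric nonnegative function on the whole type.\<close>

definition path_metric ::
  "('a, 'b) pre_digraph \<Rightarrow> ('b \<Rightarrow> 'b) \<Rightarrow> ('a, 'b) graph_point \<Rightarrow> ('a, 'b) graph_point \<Rightarrow> real" where
  "path_metric G arev x y =
     (if x \<in> realization G arev \<and> y \<in> realization G arev
      then Inf {pl_length ps | ps. pl_path G arev x ps y} else 0)"

text \<open>Actions by automorphisms; inversions of edges are permitted. Compatibility with \<open>head\<close>
  follows from that with \<open>tail\<close> and \<open>arev\<close>.\<close>

locale graph_action =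
  bidirected_digraph G arev +
  vert: group_action \<Gamma> "verts G" \<phi> +
  edge: group_action \<Gamma> "arcs G" \<psi>
  for \<Gamma> :: "('g, 'm) monoid_scheme" and G :: "('a, 'b) pre_digraph" and arev \<phi> \<psi> +
  assumes tail_act: "g \<in> carrier \<Gamma> \<Longrightarrow> e \<in> arcs G \<Longrightarrow> tail G (\<psi> g e) = \<phi> g (tail G e)"
    and arev_act: "g \<in> carrier \<Gamma> \<Longrightarrow> e \<in> arcs G \<Longrightarrow> \<psi> g (arev e) = arev (\<psi> g e)"

definition realization_action ::
  "('a, 'b) pre_digraph \<Rightarrow> ('b \<Rightarrow> 'b) \<Rightarrow> ('g \<Rightarrow> 'a \<Rightarrow> 'a) \<Rightarrow> ('g \<Rightarrow> 'b \<Rightarrow> 'b) \<Rightarrow>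
    'g \<Rightarrow> ('a, 'b) graph_point \<Rightarrow> ('a, 'b) graph_point" where
  "realization_action G arev \<phi> \<psi> g =
     (\<lambda>x\<in>realization G arev. map_sum (\<phi> g) (\<lambda>c. map_prod (\<psi> g) id ` c) x)"


text \<open>The notions of the locale \<open>Metric_space\<close> apply to the realization, since the path metric of a
  connected graph is a metric and every action by automorphisms induces an action by isometries.\<close>

lemma pl_path_append:
  "pl_path G arev x ps y \<Longrightarrow> pl_path G arev y qs z \<Longrightarrow> pl_path G arev x (ps @ qs) z"
  by (induction G arev x ps y rule: pl_path.induct) auto

lemma pl_path_rev:
  "pl_path G arev x ps y \<Longrightarrow> pl_path G arev y (rev (map (\<lambda>(e, s, t). (e, t, s)) ps)) x"
  by (induction G arev x ps y rule: pl_path.induct) (auto intro!: pl_path_append)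

lemma pl_length_append: "pl_length (ps @ qs) = pl_length ps + pl_length qs"
  by (simp add: pl_length_def)

lemma pl_length_rev: "pl_length (rev (map (\<lambda>(e, s, t). (e, t, s)) ps)) = pl_length ps"
proof (induction ps)
  case (Cons a ps)
  obtain e s t where "a = (e,s,t)" by (cases a)
  then show ?case using Cons by (simp add: pl_length_def)
qed (simp add: pl_length_def)

lemma pl_length_nonneg: "0 \<le> pl_length ps"
  unfolding pl_length_def by (intro sum_list_nonneg) auto

lemma lipschitz_path:
  assumes "pl_path G arev x ps y"
    and "\<And>e s t. e \<in> arcs G \<Longrightarrow> s \<in> {0..1} \<Longrightarrow> t \<in> {0..1} \<Longrightarrow>
       F (edge_point G arev e t) - F (edge_point G arev e s) \<le> \<bar>s - t\<bar>"
  shows "F y - F x \<le> pl_length ps"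
  using assms(1)
proof (induction ps arbitrary: x)
  case Nil
  then show ?case by (simp add: pl_length_def)
next
  case (Cons a ps)
  obtain e s t where a: "a = (e,s,t)" by (cases a)
  have "F y - F (edge_point G arev e t) \<le> pl_length ps"
    using Cons a by auto
  moreover have "F (edge_point G arev e t) - F x \<le> \<bar>s - t\<bar>"
    using Cons.prems a assms(2)[of e s t] by auto
  ultimately show ?case by (simp add: a pl_length_def)
qed

context bidirected_digraph
begin

lemma edge_point_rev:
  "e \<in> arcs G \<Longrightarrow> edge_point G arev (arev e) (1 - t) = edge_point G arev e t"
  by (auto simp: edge_point_def)

lemma realization_cases:
  assumes "x \<in> realization G arev"
  obtains (v) v where "v \<in> verts G" "x = Inl v"
  | (e) e t where "e \<in> arcs G" "t \<in> {0..1}" "x = edge_point G arev e t"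
  using assms unfolding realization_def by blast

lemma edge_point_in: "e \<in> arcs G \<Longrightarrow> t \<in> {0..1} \<Longrightarrow> edge_point G arev e t \<in> realization G arev"
  unfolding realization_def by blast

lemma vertex_point_in: "v \<in> verts G \<Longrightarrow> Inl v \<in> realization G arev"
  unfolding realization_def by blast

lemma point_cases:
  assumes "x \<in> realization G arev"
  obtains (v) v where "x = Inl v"
  | (e) e t where "e \<in> arcs G" "0 < t" "t < 1" "x = edge_point G arev e t"
  using assms
proof (cases rule: realization_cases)
  case (v u)
  then show ?thesis using that(1) by blast
next
  case (e e t)
  then have "t = 0 \<or> t = 1 \<or> 0 < t \<and> t < 1" unfolding atLeastAtMost_iff by linarith
  then consider "t = 0" | "t = 1" | "0 < t" "t < 1" by blast
  then show ?thesis using e that by cases (auto simp: edge_point_def)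
qed

lemma path_pos:
  assumes x: "x \<in> realization G arev" and y: "y \<in> realization G arev" and "x \<noteq> y"
  shows "\<exists>\<epsilon>>0. \<forall>ps. pl_path G arev x ps y \<longrightarrow> \<epsilon> \<le> pl_length ps"
proof -
  show ?thesis
    using x
  proof (cases rule: point_cases)
    case (v v)
    define F :: "('a, 'b) graph_point \<Rightarrow> real" where
      "F z = (case z of Inl u \<Rightarrow> if u = v then 0 else 1
        | Inr c \<Rightarrow> Min ((\<lambda>(e, t). t + (if tail G e = v then 0 else 1)) ` c))" for z
    have Fe: "F (edge_point G arev e t) =
        min (t + (if tail G e = v then 0 else 1)) (1 - t + (if head G e = v then 0 else 1))"
      if "e \<in> arcs G" "t \<in> {0..1}" for e t
      using that by (auto simp: F_def edge_point_def min_def)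
    have "F y - F x \<le> pl_length ps" if "pl_path G arev x ps y" for ps
    proof (rule lipschitz_path[OF that])
      fix e s t assume "e \<in> arcs G" "s \<in> {0..1::real}" "t \<in> {0..1::real}"
      moreover have "min (t + a) (1 - t + b) - min (s + a) (1 - s + b) \<le> \<bar>s - t\<bar>" for a b :: real
        by linarith
      ultimately show "F (edge_point G arev e t) - F (edge_point G arev e s) \<le> \<bar>s - t\<bar>"
        by (simp only: Fe)
    qed
    moreover have "F x = 0" by (simp add: F_def v)
    moreover have "F y > 0"
    proof -
      show ?thesis
        using y
      proof (cases rule: point_cases)
        case (v u)
        then show ?thesis using \<open>x \<noteq> y\<close> \<open>x = Inl v\<close> by (auto simp: F_def)
      next
        case (e e t)
        then show ?thesis by (simp add: Fe min_def)
      qed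
    qed
    ultimately show ?thesis by (intro exI[of _ "F y"]) simp
  next
    case (e e0 s0)
    note 2 = this
    define r where "r = min s0 (1 - s0)"
    have r: "0 < r" using 2 by (auto simp: r_def)
    define F :: "('a, 'b) graph_point \<Rightarrow> real" where
      "F z = (case z of Inl u \<Rightarrow> r
        | Inr c \<Rightarrow> if \<exists>t. (e0, t) \<in> c then min r \<bar>(THE t. (e0, t) \<in> c) - s0\<bar> else r)" for z
    have ne: "arev e0 \<noteq> e0" "e0 \<noteq> arev e0" using 2 arev_neq by fastforce+
    have Fe: "F (edge_point G arev e t) =
        (if e = e0 then min r \<bar>t - s0\<bar> else if e = arev e0 then min r \<bar>1 - t - s0\<bar> else r)"
      if "e \<in> arcs G" "t \<in> {0..1}" for e t
    proof -
      have e: "e0 = arev e \<longleftrightarrow> e = arev e0" by (metis arev_arev)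
      have "t = 0 \<or> t = 1 \<or> 0 < t \<and> t < 1"
        using that unfolding atLeastAtMost_iff by linarith
      then consider "t = 0" | "t = 1" | "0 < t" "t < 1" by blast
      then show ?thesis
      proof cases
        case 3
        consider "e = e0" | "e = arev e0" | "e \<noteq> e0" "e \<noteq> arev e0" by blast
        then show ?thesis
          by cases (use 3 ne e in \<open>simp_all add: F_def edge_point_def\<close>)
      qed (use 2 in \<open>simp_all add: F_def edge_point_def r_def min_def\<close>)
    qed
    have "F y - F x \<le> pl_length ps" if "pl_path G arev x ps y" for ps
    proof (rule lipschitz_path[OF that])
      fix e s t assume st: "e \<in> arcs G" "s \<in> {0..1::real}" "t \<in> {0..1::real}"
      have "min r \<bar>t - s0\<bar> - min r \<bar>s - s0\<bar> \<le> \<bar>s - t\<bar>"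
        "min r \<bar>1 - t - s0\<bar> - min r \<bar>1 - s - s0\<bar> \<le> \<bar>s - t\<bar>"
        by linarith+
      then show "F (edge_point G arev e t) - F (edge_point G arev e s) \<le> \<bar>s - t\<bar>"
        unfolding Fe[OF st(1,2)] Fe[OF st(1,3)] by simp
    qed
    moreover have "F x = 0" using 2 r by (simp add: Fe)
    moreover have "F y > 0"
    proof (cases y)
      case (Inl u)
      then show ?thesis using r by (simp add: F_def)
    next
      case (Inr c)
      then obtain e t where "e \<in> arcs G" "t \<in> {0..1}" "y = edge_point G arev e t"
        using y unfolding realization_def by blast
      then show ?thesis using \<open>x \<noteq> y\<close> r edge_point_rev[of e0 "1 - t"] 2
        by (auto simp: Fe)
    qed
    ultimately show ?thesis by (intro exI[of _ "F y"]) simp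
  qed
qed

lemma path_exists_verts:
  assumes "u \<rightarrow>\<^sup>*\<^bsub>G\<^esub> v"
  shows "\<exists>ps. pl_path G arev (Inl u) ps (Inl v)"
  using assms unfolding reachable_def
proof (induction rule: converse_rtrancl_on_induct)
  case base
  show ?case by (rule exI[of _ "[]"]) simp
next
  case (step u w)
  then obtain ps where ps: "pl_path G arev (Inl w) ps (Inl v)" by auto
  obtain e where "e \<in> arcs G" "tail G e = u" "head G e = w" using step by auto
  then have "pl_path G arev (Inl u) ((e, 0, 1) # ps) (Inl v)"
    using ps by (auto simp: edge_point_def)
  then show ?case by blast
qed

lemma path_exists:
  assumes con: "connected G"
    and x: "x \<in> realization G arev" and y: "y \<in> realization G arev"
  shows "\<exists>ps. pl_path G arev x ps y"
proof -
  have to_vert: "\<exists>v\<in>verts G. \<exists>ps. pl_path G arev z ps (Inl v)" if "z \<in> realization G arev" for z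
  proof -
    show ?thesis
      using that
    proof (cases rule: realization_cases)
      case (v u)
      then show ?thesis by (intro bexI[of _ u] exI[of _ "[]"]) auto
    next
      case (e e t)
      then show ?thesis
        by (intro bexI[of _ "tail G e"] exI[of _ "[(e, t, 0)]"]) (auto simp: edge_point_def)
    qed
  qed
  obtain u ps where u: "u \<in> verts G" "pl_path G arev x ps (Inl u)" using to_vert[OF x] by auto
  obtain v qs where v: "v \<in> verts G" "pl_path G arev y qs (Inl v)" using to_vert[OF y] by auto
  have "strongly_connected G"
    using con by (simp add: symmetric_connected_imp_strongly_connected sym_arcs)
  then have "u \<rightarrow>\<^sup>*\<^bsub>G\<^esub> v" using u v by (auto simp: strongly_connected_def)
  then obtain rs where "pl_path G arev (Inl u) rs (Inl v)" using path_exists_verts by blast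
  from pl_path_append[OF pl_path_append[OF u(2) this] pl_path_rev[OF v(2)]]
  show ?thesis by blast
qed

lemma Metric_space_realization:
  assumes con: "connected G"
  shows "Metric_space (realization G arev) (path_metric G arev)"
proof
  define L where "L x y = {pl_length ps |ps. pl_path G arev x ps y}" for x y
  have LI: "pl_length ps \<in> L x y" if "pl_path G arev x ps y" for x ps y
    using that unfolding L_def by blast
  have LE: thesis if "l \<in> L x y" "\<And>ps. l = pl_length ps \<Longrightarrow> pl_path G arev x ps y \<Longrightarrow> thesis"
    for l x y thesis
    using that unfolding L_def by blast
  have D: "path_metric G arev x y = Inf (L x y)"
    if "x \<in> realization G arev" "y \<in> realization G arev" for x y
    unfolding path_metric_def L_def using that by simp
  have D0: "path_metric G arev x y = 0"
    if "\<not> (x \<in> realization G arev \<and> y \<in> realization G arev)" for x y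
    unfolding path_metric_def using that by (rule if_not_P)
  have nonneg: "0 \<le> l" if "l \<in> L x y" for l x y
    by (rule LE[OF that]) (simp add: pl_length_nonneg)
  have bdd: "bdd_below (L x y)" for x y
    by (rule bdd_belowI[of _ 0]) (rule nonneg)
  have ex: "L x y \<noteq> {}" if "x \<in> realization G arev" "y \<in> realization G arev" for x y
    using path_exists[OF con that] LI by blast
  have nn: "0 \<le> path_metric G arev x y" for x y
  proof (cases "x \<in> realization G arev \<and> y \<in> realization G arev")
    case True
    then have "0 \<le> Inf (L x y)" by (intro cInf_greatest ex nonneg) auto
    then show ?thesis using D True by simp
  qed (simp add: D0)
  fix x y
  show "0 \<le> path_metric G arev x y" by (rule nn)
  have sub: "L x y \<subseteq> L y x" for x y
  proof
    fix l assume "l \<in> L x y"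
    then obtain ps where "l = pl_length ps" "pl_path G arev x ps y" by (rule LE)
    then show "l \<in> L y x" using LI[OF pl_path_rev] by (simp only: pl_length_rev)
  qed
  have "L x y = L y x" by (rule subset_antisym) (rule sub)+
  then show "path_metric G arev x y = path_metric G arev y x"
    using D[of x y] D[of y x] D0[of x y] D0[of y x]
    by (cases "x \<in> realization G arev \<and> y \<in> realization G arev") auto
  assume x: "x \<in> realization G arev" and y: "y \<in> realization G arev"
  show "path_metric G arev x y = 0 \<longleftrightarrow> x = y"
  proof
    assume 0: "path_metric G arev x y = 0"
    show "x = y"
    proof (rule ccontr)
      assume "x \<noteq> y"
      obtain \<epsilon> where e: "\<epsilon> > 0" "\<And>ps. pl_path G arev x ps y \<Longrightarrow> \<epsilon> \<le> pl_length ps"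
        using path_pos[OF x y \<open>x \<noteq> y\<close>] by blast
      have "\<epsilon> \<le> Inf (L x y)"
      proof (rule cInf_greatest[OF ex[OF x y]])
        fix l assume "l \<in> L x y"
        then show "\<epsilon> \<le> l" by (rule LE) (simp add: e(2))
      qed
      with 0 e(1) D[OF x y] show False by simp
    qed
  next
    assume "x = y"
    then have "pl_path G arev x [] y" by simp
    then have "pl_length ([] :: ('b \<times> real \<times> real) list) \<in> L x y" by (rule LI)
    then have "Inf (L x y) \<le> 0" using cInf_lower[OF _ bdd] by (simp add: pl_length_def)
    then show "path_metric G arev x y = 0" using nn[of x y] D[OF x y] by simp
  qed
  fix z assume z: "z \<in> realization G arev"
  have "Inf (L x z) - Inf (L x y) \<le> Inf (L y z)"
  proof (rule cInf_greatest[OF ex[OF y z]])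
    fix m assume "m \<in> L y z"
    then obtain qs where qs: "m = pl_length qs" "pl_path G arev y qs z" by (rule LE)
    have "Inf (L x z) - m \<le> Inf (L x y)"
    proof (rule cInf_greatest[OF ex[OF x y]])
      fix l assume "l \<in> L x y"
      then obtain ps where ps: "l = pl_length ps" "pl_path G arev x ps y" by (rule LE)
      have "Inf (L x z) \<le> l + m"
        using cInf_lower[OF LI[OF pl_path_append[OF ps(2) qs(2)]] bdd]
        by (simp add: pl_length_append ps(1) qs(1))
      then show "Inf (L x z) - m \<le> l" by simp
    qed
    then show "Inf (L x z) - Inf (L x y) \<le> m" by simp
  qed
  then show "path_metric G arev x z \<le> path_metric G arev x y + path_metric G arev y z"
    using D x y z by simp
qed

end

lemma (in graph_action) head_act:
  assumes "g \<in> carrier \<Gamma>" "e \<in> arcs G"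
  shows "head G (\<psi> g e) = \<phi> g (head G e)"
proof -
  have "head G (\<psi> g e) = tail G (arev (\<psi> g e))"
    using edge.element_image[OF assms refl] by simp
  also have "\<dots> = tail G (\<psi> g (arev e))" using arev_act[OF assms] by simp
  also have "\<dots> = \<phi> g (head G e)" using tail_act[OF assms(1), of "arev e"] assms(2) by simp
  finally show ?thesis .
qed

context graph_action
begin

abbreviation "act \<equiv> realization_action G arev \<phi> \<psi>"

lemma arc_closed: "g \<in> carrier \<Gamma> \<Longrightarrow> e \<in> arcs G \<Longrightarrow> \<psi> g e \<in> arcs G"
  by (rule edge.element_image) simp_all

lemma vert_closed: "g \<in> carrier \<Gamma> \<Longrightarrow> v \<in> verts G \<Longrightarrow> \<phi> g v \<in> verts G"
  by (rule vert.element_image) simp_all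

lemma act_edge_point:
  assumes "g \<in> carrier \<Gamma>" "e \<in> arcs G" "t \<in> {0..1}"
  shows "act g (edge_point G arev e t) = edge_point G arev (\<psi> g e) t"
proof -
  have "act g (edge_point G arev e t) =
      map_sum (\<phi> g) (\<lambda>c. map_prod (\<psi> g) id ` c) (edge_point G arev e t)"
    unfolding realization_action_def using edge_point_in[OF assms(2,3)] by simp
  then show ?thesis
    by (simp add: edge_point_def tail_act head_act arev_act assms)
qed

lemma act_vert:
  assumes "v \<in> verts G"
  shows "act g (Inl v) = Inl (\<phi> g v)"
  unfolding realization_action_def using vertex_point_in[OF assms] by simp

lemma act_closed:
  assumes "g \<in> carrier \<Gamma>" "x \<in> realization G arev"
  shows "act g x \<in> realization G arev"
  using assms(2)
proof (cases rule: realization_cases)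
  case v
  then show ?thesis using assms by (simp add: act_vert vert_closed vertex_point_in)
next
  case e
  then show ?thesis using assms by (simp add: act_edge_point arc_closed edge_point_in)
qed

lemma act_mult:
  assumes "g \<in> carrier \<Gamma>" "h \<in> carrier \<Gamma>" "x \<in> realization G arev"
  shows "act (g \<otimes>\<^bsub>\<Gamma>\<^esub> h) x = act g (act h x)"
  using assms(3)
proof (cases rule: realization_cases)
  case v
  then show ?thesis using assms by (simp add: act_vert vert_closed vert.composition_rule)
next
  case e
  interpret group \<Gamma> using edge.group_hom by (simp add: group_hom_def)
  show ?thesis using e assms by (simp add: act_edge_point arc_closed edge.composition_rule)
qed

lemma act_one:
  assumes "x \<in> realization G arev"
  shows "act \<one>\<^bsub>\<Gamma>\<^esub> x = x"
proof -
  show ?thesis using assms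
  proof (cases rule: realization_cases)
    case (v v)
    have "\<phi> \<one>\<^bsub>\<Gamma>\<^esub> v = v" by (simp add: vert.id_eq_one[symmetric] v)
    then show ?thesis using v by (simp add: act_vert)
  next
    case (e e t)
    interpret group \<Gamma> using edge.group_hom by (simp add: group_hom_def)
    have "\<psi> \<one>\<^bsub>\<Gamma>\<^esub> e = e" by (simp add: edge.id_eq_one[symmetric] e)
    then show ?thesis using e by (simp add: act_edge_point)
  qed
qed

lemma act_path:
  assumes "g \<in> carrier \<Gamma>"
  shows "pl_path G arev x ps y \<Longrightarrow> pl_path G arev (act g x) (map (map_prod (\<psi> g) id) ps) (act g y)"
proof (induction ps arbitrary: x)
  case Nil then show ?case by simp
next
  case (Cons a ps)
  obtain e s t where a: "a = (e, s, t)" by (cases a)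
  show ?case using Cons.prems Cons.IH[of "edge_point G arev e t"] assms
    by (simp add: a act_edge_point arc_closed)
qed

lemma pl_length_map: "pl_length (map (map_prod f id) ps) = pl_length ps"
  by (induction ps) (auto simp: pl_length_def)

lemma hom_realization_action:
  assumes con: "connected G"
  shows "act \<in> hom \<Gamma> (Metric_space.isometry_group (realization G arev) (path_metric G arev))"
proof -
  interpret group \<Gamma> using edge.group_hom by (simp add: group_hom_def)
  interpret Metric_space "realization G arev" "path_metric G arev"
    by (rule Metric_space_realization[OF con])
  have le: "path_metric G arev (act g x) (act g y) \<le> path_metric G arev x y"
    if g: "g \<in> carrier \<Gamma>" and x: "x \<in> realization G arev" and y: "y \<in> realization G arev" for g x y
  proof -
    have bdd: "bdd_below {pl_length ps |ps. pl_path G arev (act g x) ps (act g y)}"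
      using pl_length_nonneg by (intro bdd_belowI[of _ 0]) auto
    have "Inf {pl_length ps |ps. pl_path G arev (act g x) ps (act g y)}
        \<le> Inf {pl_length ps |ps. pl_path G arev x ps y}"
    proof (rule cInf_superset_mono[OF _ bdd])
      show "{pl_length ps |ps. pl_path G arev x ps y} \<noteq> {}"
        using path_exists[OF con x y] by blast
      show "{pl_length ps |ps. pl_path G arev x ps y} \<subseteq> {pl_length ps |ps. pl_path G arev (act g x) ps (act g y)}"
        using act_path[OF g] pl_length_map[symmetric] by blast
    qed
    then show ?thesis using x y act_closed[OF g] by (simp add: path_metric_def)
  qed
  have inv: "act (inv\<^bsub>\<Gamma>\<^esub> g) (act g x) = x" "act g (act (inv\<^bsub>\<Gamma>\<^esub> g) x) = x"
    if "g \<in> carrier \<Gamma>" "x \<in> realization G arev" for g x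
    using that by (simp_all add: act_mult[symmetric] act_one)
  have iso: "act g \<in> carrier isometry_group" if g: "g \<in> carrier \<Gamma>" for g
  proof -
    have "bij_betw (act g) (realization G arev) (realization G arev)"
      by (rule bij_betw_byWitness[where f' = "act (inv\<^bsub>\<Gamma>\<^esub> g)"])
        (use g inv act_closed in auto)
    moreover have "path_metric G arev (act g x) (act g y) = path_metric G arev x y"
      if "x \<in> realization G arev" "y \<in> realization G arev" for x y
      using le[of g x y] le[of "inv\<^bsub>\<Gamma>\<^esub> g" "act g x" "act g y"] that g act_closed inv
      by (simp add: antisym)
    ultimately show ?thesis
      by (auto simp: isometry_group_carrier Bij_def realization_action_def)
  qed
  show ?thesis
  proof (rule homI)
    fix g h assume gh: "g \<in> carrier \<Gamma>" "h \<in> carrier \<Gamma>"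
    have "act g \<otimes>\<^bsub>isometry_group\<^esub> act h = compose (realization G arev) (act g) (act h)"
      using iso gh by (simp add: isometry_group_carrier) (simp add: isometry_group_def BijGroup_def)
    also have "\<dots> = act (g \<otimes>\<^bsub>\<Gamma>\<^esub> h)"
    proof (rule extensionalityI[of _ "realization G arev"])
      show "act (g \<otimes>\<^bsub>\<Gamma>\<^esub> h) \<in> extensional (realization G arev)"
        by (simp add: realization_action_def)
    qed (use gh in \<open>simp_all add: compose_eq act_mult\<close>)
    finally show "act (g \<otimes>\<^bsub>\<Gamma>\<^esub> h) = act g \<otimes>\<^bsub>isometry_group\<^esub> act h" by simp
  qed (rule iso)
qed

end


section \<open>Bounded cohomology\<close>

text \<open>The data of a normed \<open>\<Gamma>\<close>-module, as a subgroup of an ambient abelian group.\<close>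

record ('g, 'v) normed_module =
  vecs :: "'v set"
  vnorm :: "'v \<Rightarrow> real"
  vact :: "'g \<Rightarrow> 'v \<Rightarrow> 'v"

definition tuples :: "('g, 'm) monoid_scheme \<Rightarrow> nat \<Rightarrow> 'g list set" where
  "tuples \<Gamma> n = {xs. length xs = Suc n \<and> set xs \<subseteq> carrier \<Gamma>}"

text \<open>Cochains take the value 0 off \<open>\<Gamma>\<^sup>n\<^sup>+\<^sup>1\<close>, so that they are determined by their values on
  \<open>\<Gamma>\<^sup>n\<^sup>+\<^sup>1\<close>.\<close>

definition bounded_cochains ::
  "('g, 'm) monoid_scheme \<Rightarrow> ('g, 'v::ab_group_add) normed_module \<Rightarrow> nat \<Rightarrow> ('g list \<Rightarrow> 'v) set" where
  "bounded_cochains \<Gamma> V n = {c.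
     (\<forall>xs. xs \<notin> tuples \<Gamma> n \<longrightarrow> c xs = 0) \<and>
     (\<forall>xs\<in>tuples \<Gamma> n. c xs \<in> vecs V) \<and>
     (\<exists>B. \<forall>xs\<in>tuples \<Gamma> n. vnorm V (c xs) \<le> B) \<and>
     (\<forall>g\<in>carrier \<Gamma>. \<forall>xs\<in>tuples \<Gamma> n. c (map (\<lambda>x. g \<otimes>\<^bsub>\<Gamma>\<^esub> x) xs) = vact V g (c xs))}"

definition coboundary_map ::
  "('g, 'm) monoid_scheme \<Rightarrow> nat \<Rightarrow> ('g list \<Rightarrow> 'v::ab_group_add) \<Rightarrow> 'g list \<Rightarrow> 'v" where
  "coboundary_map \<Gamma> n c = (\<lambda>xs.
     if xs \<in> tuples \<Gamma> (Suc n)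
     then \<Sum>i\<le>Suc n. (if even i then id else uminus) (c (take i xs @ drop (Suc i) xs))
     else 0)"

definition bounded_cocycles ::
  "('g, 'm) monoid_scheme \<Rightarrow> ('g, 'v::ab_group_add) normed_module \<Rightarrow> nat \<Rightarrow> ('g list \<Rightarrow> 'v) monoid" where
  "bounded_cocycles \<Gamma> V n =
     \<lparr>carrier = {c \<in> bounded_cochains \<Gamma> V n. coboundary_map \<Gamma> n c = (\<lambda>_. 0)},
      mult = \<lambda>c c' xs. c xs + c' xs, one = \<lambda>_. 0\<rparr>"

definition bounded_coboundaries ::
  "('g, 'm) monoid_scheme \<Rightarrow> ('g, 'v::ab_group_add) normed_module \<Rightarrow> nat \<Rightarrow> ('g list \<Rightarrow> 'v) set" where
  "bounded_coboundaries \<Gamma> V n =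
     (case n of 0 \<Rightarrow> {\<lambda>_. 0} | Suc m \<Rightarrow> coboundary_map \<Gamma> m ` bounded_cochains \<Gamma> V m)"

definition bounded_cohomology ::
  "nat \<Rightarrow> ('g, 'm) monoid_scheme \<Rightarrow> ('g, 'v::ab_group_add) normed_module \<Rightarrow>
    ('g list \<Rightarrow> 'v) set monoid" where
  "bounded_cohomology n \<Gamma> V = bounded_cocycles \<Gamma> V n Mod bounded_coboundaries \<Gamma> V n"

text \<open>Unlike the negation of \<open>trivial_group\<close>, this cannot hold merely because \<open>H\<close> is not a group.\<close>

definition nontrivial :: "('h, 'm) monoid_scheme \<Rightarrow> bool" where
  "nontrivial H \<longleftrightarrow> carrier H \<noteq> {\<one>\<^bsub>H\<^esub>}"

text \<open>\<open>\<ell>\<^sup>p(\<Gamma>)\<close> with the left regular representation; the type argument selects the scalar field.\<close>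

definition ell :: "'k::real_normed_field itself \<Rightarrow> real \<Rightarrow> ('g, 'm) monoid_scheme \<Rightarrow>
    ('g, 'g \<Rightarrow> 'k) normed_module" where
  "ell K p \<Gamma> =
     \<lparr>vecs = {f. (\<forall>x. x \<notin> carrier \<Gamma> \<longrightarrow> f x = 0) \<and>
                 (\<lambda>x. norm (f x) powr p) summable_on carrier \<Gamma>},
      vnorm = \<lambda>f. (\<Sum>\<^sub>\<infinity>x\<in>carrier \<Gamma>. norm (f x) powr p) powr (1 / p),
      vact = \<lambda>g f x. if x \<in> carrier \<Gamma> then f (inv\<^bsub>\<Gamma>\<^esub> g \<otimes>\<^bsub>\<Gamma>\<^esub> x) else 0\<rparr>"

definition class_Creg :: "'k::real_normed_field itself \<Rightarrow> ('g, 'm) monoid_scheme set" where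
  "class_Creg K = {\<Gamma>. group \<Gamma> \<and> countable (carrier \<Gamma>) \<and>
     nontrivial (bounded_cohomology 2 \<Gamma> (ell K 2 \<Gamma>))}"

end

theory Submission
  imports Defs "HOL-Library.Diagonal_Subsequence"
begin

text \<open>
  Pull the metric back to \<open>\<Gamma>\<close> along an orbit. If \<open>\<kappa>\<close> and \<open>\<theta>\<close> are functions on \<open>\<Gamma>\<close> that are Hoelder
  with respect to a visual metric and have separated supports, the wedge
  \<open>F x y = \<kappa> x * \<theta> y - \<theta> x * \<kappa> y\<close> gives a cochain \<open>(a, b) \<mapsto> (x \<mapsto> F (x\<inverse>a) (x\<inverse>b))\<close> with coboundary
  bounded in \<open>\<ell>\<^sup>1\<close>, hence in \<open>\<ell>\<^sup>p\<close>: the defect at \<open>(a, b, c)\<close> vanishes unless \<open>x\<close> is close to a side of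
  the triangle, of which there are boundedly many per unit of length, and it decays exponentially
  with the distance from \<open>x\<close> to the centre, because it is a determinant with two almost equal columns.

  Non-elementarity gives every boundary point at least three translates. Hence, for some
  \<open>g\<close> far out, elements \<open>s\<^sub>i = a\<^sub>i g b\<^sub>i\<inverse>\<close>, \<open>i < 3\<close>, are long and point in three different directions, and so
  do their inverses. The products alternating between \<open>s\<^sub>i\<close> and \<open>s\<^sub>j\<inverse>\<close> form a 3-regular tree in \<open>\<Gamma>\<close>.
  Choose \<open>\<kappa>\<close> and \<open>\<theta>\<close> to be \<open>1\<close> on two of the three branches at the identity and \<open>0\<close> on the other ones; then
  the defect is \<open>1\<close> on all tripods at the identity. Were the cocycle the coboundary of a
  bounded \<open>\<beta>\<close>, then \<open>\<beta>\<close> would be of definite size on one side of every translated tripod, and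
  averaging over all paths of length \<open>n\<close> of the tree would make its \<open>\<ell>\<^sup>p\<close> norm unbounded in \<open>n\<close>.
\<close>

subsection \<open>Hyperbolic pseudometrics and visual functions\<close>

text \<open>Only a pseudometric, because an orbit map need not be injective.
  \<open>four_point\<close> is the basepoint-free form of \<open>gp_hyp\<close>; its constant is
  doubled by clearing the halves in \<open>gp\<close>.\<close>

locale hyperbolic_pseudometric =
  fixes d :: "'a \<Rightarrow> 'a \<Rightarrow> real" and \<delta> :: real
  assumes d_refl [simp]: "d x x = 0"
    and d_sym: "d x y = d y x"
    and d_triangle: "d x z \<le> d x y + d y z"
    and four_point: "d x z + d y w \<le> max (d x y + d z w) (d y z + d x w) + 2 * \<delta>"
begin

definition gp :: "'a \<Rightarrow> 'a \<Rightarrow> 'a \<Rightarrow> real" where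
  "gp w x y = (d x w + d y w - d x y) / 2"

lemma d_nonneg: "0 \<le> d x y"
  using d_triangle[of x x y] d_sym[of x y] by simp

lemma delta_nonneg: "0 \<le> \<delta>"
  using four_point[of undefined undefined undefined undefined] by simp

lemma gp_sym: "gp w x y = gp w y x"
  by (simp add: gp_def d_sym)

lemma gp_nonneg: "0 \<le> gp w x y"
  using d_triangle[of x y w] d_sym[of y w] by (simp add: gp_def)

lemma gp_le_left: "gp w x y \<le> d w x"
  using d_triangle[of y w x] d_sym[of x y] d_sym[of w x] by (simp add: gp_def)

lemma gp_le_right: "gp w x y \<le> d w y"
  using gp_le_left[of w y x] by (simp add: gp_sym)

lemma gp_self: "gp w x x = d w x"
  by (simp add: gp_def d_sym)

lemma gp_add: "gp w x y + gp x w y = d w x"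
  by (simp add: gp_def d_sym field_simps)

lemma gp_hyp: "min (gp w x y) (gp w y z) - \<delta> \<le> gp w x z"
  using four_point[of x z y w] d_sym[of w y] d_sym[of y z] d_sym[of z w]
  by (auto simp: gp_def min_def max_def field_simps split: if_splits)

lemma gp_perturb: "gp w x y \<le> gp w x' y' + d x x' + d y y'"
proof -
  have "d x w \<le> d x x' + d x' w" "d y w \<le> d y y' + d y' w"
    "d x' y' \<le> d x' x + d x y + d y y'"
    using d_triangle[of x w x'] d_triangle[of y w y'] d_triangle[of x' y' x] d_triangle[of x y' y]
    by auto
  then show ?thesis using d_sym[of x x'] by (simp add: gp_def field_simps)
qed

text \<open>Local-to-global step for broken geodesics. By \<open>gp_add\<close> the small turn at
  \<open>z\<close> forces \<open>gp y z u\<close> above \<open>T + \<delta>\<close>, so the small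
  term in \<open>gp_hyp\<close> must be \<open>gp y x u\<close>. The bound obtained is again
  \<open>T + \<delta>\<close>, so the step iterates along a path without loss.\<close>

lemma gp_local_step:
  assumes "gp y x z \<le> T" and "gp z y u \<le> T + \<delta>" and "2 * T + 2 * \<delta> < d y z"
  shows "gp y x u \<le> T + \<delta>"
proof -
  have "gp y z u > T + \<delta>" using gp_add[of y z u] assms by simp
  moreover have "min (gp y x u) (gp y u z) - \<delta> \<le> T" using gp_hyp[of y x u z] assms by simp
  ultimately show ?thesis by (auto simp: gp_sym min_def split: if_splits)
qed

text \<open>The points of small Gromov product with respect to \<open>a\<close> and \<open>b\<close> behave like a geodesic
  from \<open>a\<close> to \<open>b\<close>, parametrised by the distance to \<open>a\<close>.\<close>

lemma near_segment_dist:
  assumes "gp y a b \<le> R" "gp y' a b \<le> R" "\<bar>d a y - d a y'\<bar> \<le> t"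
  shows "d y y' \<le> t + 2 * R + 2 * \<delta>"
proof -
  have "d y y' + d a b \<le> max (d y a + d y' b) (d a y' + d y b) + 2 * \<delta>"
    using four_point[of y y' a b] by simp
  then show ?thesis using assms by (simp add: gp_def d_sym max_def split: if_splits)
qed

text \<open>In a tripod, \<open>gp a b c\<close> is the distance from \<open>a\<close> to the
  centre. For \<open>y\<close> on the side from \<open>a\<close> to \<open>b\<close>, the distance
  to the centre is \<open>gp y b c\<close> before the centre and \<open>gp y c a\<close> beyond it;
  \<open>R\<close> pays for \<open>y\<close> being only near the side.\<close>

lemma gp_max_lower:
  assumes "gp y a b \<le> R"
  shows "\<bar>d a y - gp a b c\<bar> - R \<le> max (gp y b c) (gp y c a)"
proof -
  have "d c b \<le> d c y + d b y" "d c a \<le> d c y + d a y"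
    "d a b \<le> d a y + d b y"
    using d_triangle[of c b y] d_triangle[of c a y] d_triangle[of a b y] by (auto simp: d_sym)
  then show ?thesis using assms unfolding gp_def d_sym[of y] d_sym[of b a] d_sym[of a c] d_sym[of b c] d_sym[of y a] by (auto simp: max_def abs_if field_simps)
qed

end


section \<open>Chain metrics of quasi-metrics\<close>

text \<open>Frink's metrization lemma. Split at the last \<open>k\<close> whose initial sum is at
  most \<open>S / 2\<close>; then the piece after \<open>Suc k\<close> also costs at most
  \<open>S / 2\<close>. By induction both pieces, like the link between them, span at most
  \<open>S\<close>, and joining the three costs the factor \<open>K\<close> twice, with
  \<open>K\<^sup>2 \<le> 2\<close>.\<close>

lemma frink_chain:
  fixes \<rho> :: "'a \<Rightarrow> 'a \<Rightarrow> real"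
  assumes nonneg: "\<And>x y. 0 \<le> \<rho> x y"
    and quasi: "\<And>x y z. \<rho> x z \<le> K * max (\<rho> x y) (\<rho> y z)"
    and K: "0 \<le> K" "K\<^sup>2 \<le> 2"
    and "0 < n"
  shows "\<rho> (x 0) (x n) \<le> 2 * (\<Sum>i<n. \<rho> (x i) (x (Suc i)))"
  using \<open>0 < n\<close>
proof (induction n arbitrary: x rule: less_induct)
  case (less n)
  define S where "S = (\<Sum>i<n. \<rho> (x i) (x (Suc i)))"
  have S0: "0 \<le> S" unfolding S_def by (intro sum_nonneg nonneg)
  define P where "P k \<longleftrightarrow> k < n \<and> (\<Sum>i<k. \<rho> (x i) (x (Suc i))) \<le> S / 2" for k
  have "P 0" using less.prems S0 by (simp add: P_def)
  define k where "k = (GREATEST k. P k)"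
  have Pk: "P k" unfolding k_def by (rule GreatestI_nat[of P 0 n]) (use \<open>P 0\<close> in \<open>auto simp: P_def\<close>)
  have kn: "k < n" using Pk by (simp add: P_def)
  have first: "\<rho> (x 0) (x k) \<le> S" if "k \<noteq> 0"
    using less.IH[of k x] Pk that by (simp add: P_def)
  have step: "\<rho> (x k) (x (Suc k)) \<le> S"
    unfolding S_def using member_le_sum[of k "{..<n}" "\<lambda>i. \<rho> (x i) (x (Suc i))"] kn nonneg by auto
  have last: "\<rho> (x (Suc k)) (x n) \<le> S" if "Suc k \<noteq> n"
  proof -
    have "Suc k < n" using kn that by simp
    have "\<not> P (Suc k)"
    proof
      assume "P (Suc k)"
      then have "Suc k \<le> k" unfolding k_def by (rule Greatest_le_nat[of P _ n]) (auto simp: P_def)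
      then show False by simp
    qed
    then have *: "(\<Sum>i<Suc k. \<rho> (x i) (x (Suc i))) > S / 2" using \<open>Suc k < n\<close> by (simp add: P_def)
    have "S = (\<Sum>i<Suc k. \<rho> (x i) (x (Suc i))) + (\<Sum>i\<in>{Suc k..<n}. \<rho> (x i) (x (Suc i)))"
      unfolding S_def by (subst sum.union_disjoint[symmetric])
        (use kn in \<open>auto intro!: sum.cong\<close>)
    also have "(\<Sum>i\<in>{Suc k..<n}. \<rho> (x i) (x (Suc i))) =
        (\<Sum>i<n - Suc k. \<rho> (x (Suc k + i)) (x (Suc (Suc k + i))))"
      by (rule sum.reindex_bij_witness[of _ "\<lambda>i. Suc k + i" "\<lambda>i. i - Suc k"]) auto
    finally have "(\<Sum>i<n - Suc k. \<rho> (x (Suc k + i)) (x (Suc (Suc k + i)))) \<le> S / 2"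
      using * by simp
    moreover have "\<rho> (x (Suc k + 0)) (x (Suc k + (n - Suc k))) \<le>
        2 * (\<Sum>i<n - Suc k. \<rho> (x (Suc k + i)) (x (Suc k + Suc i)))"
      by (rule less.IH[of "n - Suc k" "\<lambda>i. x (Suc k + i)"]) (use \<open>Suc k < n\<close> in auto)
    ultimately show ?thesis using \<open>Suc k < n\<close> by simp
  qed
  have K1: "K \<le> 2" using K by (intro power2_le_imp_le[of K 2]) auto
  have KS: "K * S \<le> 2 * S" "K * (K * S) \<le> 2 * S"
    using K1 K(2) S0 by (auto intro!: mult_right_mono simp: power2_eq_square mult.assoc[symmetric])
  \<comment> \<open>\<open>\<rho> (x 0) (x 0)\<close> may be positive, so an empty initial piece is
    left out rather than joined on.\<close>
  have mid: "\<rho> (x 0) (x (Suc k)) \<le> (if k = 0 then S else K * S)"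
  proof (cases "k = 0")
    case False
    have "\<rho> (x 0) (x (Suc k)) \<le> K * max (\<rho> (x 0) (x k)) (\<rho> (x k) (x (Suc k)))" by (rule quasi)
    also have "\<dots> \<le> K * S" using first[OF False] step K(1) by (intro mult_left_mono) auto
    finally show ?thesis using False by simp
  qed (use step in simp)
  have "\<rho> (x 0) (x n) \<le> 2 * S"
  proof (cases "Suc k = n")
    case True
    then show ?thesis using mid KS(1) S0 by (auto split: if_splits)
  next
    case False
    have "\<rho> (x 0) (x n) \<le> K * max (\<rho> (x 0) (x (Suc k))) (\<rho> (x (Suc k)) (x n))" by (rule quasi)
    also have "\<dots> \<le> 2 * S"
    proof (cases "\<rho> (x 0) (x (Suc k)) \<le> S")
      case True
      then have "K * max (\<rho> (x 0) (x (Suc k))) (\<rho> (x (Suc k)) (x n)) \<le> K * S"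
        using last[OF False] K(1) by (intro mult_left_mono) auto
      then show ?thesis using KS by simp
    next
      case F: False
      then have "max (\<rho> (x 0) (x (Suc k))) (\<rho> (x (Suc k)) (x n)) \<le> K * S"
        using last[OF False] mid by (auto split: if_splits)
      then have "K * max (\<rho> (x 0) (x (Suc k))) (\<rho> (x (Suc k)) (x n)) \<le> K * (K * S)"
        using K(1) by (intro mult_left_mono) auto
      then show ?thesis using KS by simp
    qed
    finally show ?thesis .
  qed
  then show ?case by (simp add: S_def)
qed

text \<open>The function is a truncation of the distance to \<open>A\<close> in the chain metric of \<open>\<rho>\<close>.\<close>

lemma quasi_metric_separation:
  fixes \<rho> :: "'a \<Rightarrow> 'a \<Rightarrow> real"
  assumes nonneg: "\<And>x y. 0 \<le> \<rho> x y"
    and sym: "\<And>x y. \<rho> x y = \<rho> y x"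
    and quasi: "\<And>x y z. \<rho> x z \<le> K * max (\<rho> x y) (\<rho> y z)"
    and K: "0 \<le> K" "K\<^sup>2 \<le> 2"
    and \<eta>: "0 < \<eta>" and A: "A \<noteq> {}"
  obtains f :: "'a \<Rightarrow> real" where "\<And>x. 0 \<le> f x" "\<And>x. f x \<le> 1" "\<And>x. x \<in> A \<Longrightarrow> f x = 1"
    "\<And>x. f x \<noteq> 0 \<Longrightarrow> x \<in> A \<or> (\<exists>a\<in>A. \<rho> x a < 2 * \<eta>)"
    "\<And>x y. \<bar>f x - f y\<bar> \<le> \<rho> x y / \<eta>"
proof -
  define C where "C x = {\<Sum>i<n. \<rho> (z i) (z (Suc i)) | z n. z 0 = x \<and> z n \<in> A}" for x
  define u where "u x = Inf (C x)" for x
  have CI: "(\<Sum>i<n. \<rho> (z i) (z (Suc i))) \<in> C x" if "z 0 = x" "z n \<in> A" for z n x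
    unfolding C_def using that by blast
  have nn: "0 \<le> c" if "c \<in> C x" for c x
    using that unfolding C_def by (auto intro!: sum_nonneg nonneg)
  then have bdd: "bdd_below (C x)" for x by (intro bdd_belowI) auto
  obtain a where a: "a \<in> A" using A by blast
  have ne: "C x \<noteq> {}" for x
    using CI[of "\<lambda>i. if i = 0 then x else a" x 1] a by auto
  have u0: "0 \<le> u x" for x unfolding u_def by (rule cInf_greatest[OF ne nn])
  have uA: "u x = 0" if "x \<in> A" for x
  proof -
    have "0 \<in> C x" using CI[of "\<lambda>_. x" x 0] that by simp
    then have "u x \<le> 0" unfolding u_def by (rule cInf_lower[OF _ bdd])
    with u0[of x] show ?thesis by simp
  qed
  have lip1: "u x \<le> \<rho> x y + u y" for x y
  proof -
    have "u x - \<rho> x y \<le> Inf (C y)"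
    proof (rule cInf_greatest[OF ne])
      fix c assume "c \<in> C y"
      then obtain z n where z: "c = (\<Sum>i<n. \<rho> (z i) (z (Suc i)))" "z 0 = y" "z n \<in> A"
        unfolding C_def by blast
      have "(\<Sum>i<Suc n. \<rho> (case_nat x z i) (case_nat x z (Suc i))) \<in> C x"
        by (rule CI) (use z in auto)
      also have "(\<Sum>i<Suc n. \<rho> (case_nat x z i) (case_nat x z (Suc i))) = \<rho> x y + c"
        by (subst sum.lessThan_Suc_shift) (simp add: z)
      finally show "u x - \<rho> x y \<le> c" using cInf_lower[OF _ bdd, of "\<rho> x y + c" x] by (simp add: u_def)
    qed
    then show ?thesis by (simp add: u_def)
  qed
  have lip: "\<bar>u x - u y\<bar> \<le> \<rho> x y" for x y
    using lip1[of x y] lip1[of y x] sym[of x y] by linarith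
  \<comment> \<open>The factor 2 is the loss in \<open>frink_chain\<close>; the alternative
    \<open>x \<in> A\<close> comes from the empty chain.\<close>
  have close: "x \<in> A \<or> (\<exists>a\<in>A. \<rho> x a < 2 * \<eta>)" if ux: "u x < \<eta>" for x
  proof -
    obtain c where "c \<in> C x" "c < \<eta>"
      using ux cInf_less_iff[OF ne[of x] bdd[of x], of \<eta>] unfolding u_def by auto
    then obtain z n where z: "(\<Sum>i<n. \<rho> (z i) (z (Suc i))) < \<eta>" "z 0 = x" "z n \<in> A"
      unfolding C_def by blast
    show ?thesis
    proof (cases "n = 0")
      case False
      then have "\<rho> (z 0) (z n) \<le> 2 * (\<Sum>i<n. \<rho> (z i) (z (Suc i)))"
          using frink_chain[where \<rho>=\<rho> and K=K, OF nonneg quasi K, of n z] by simp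
      then show ?thesis using z by (intro disjI2 bexI[of _ "z n"]) auto
    qed (use z in simp)
  qed
  show ?thesis
  proof (rule that[of "\<lambda>x. max 0 (1 - u x / \<eta>)"])
    fix x y
    show "0 \<le> max 0 (1 - u x / \<eta>)" "max 0 (1 - u x / \<eta>) \<le> 1" using u0[of x] \<eta> by auto
    show "max 0 (1 - u x / \<eta>) = 1" if "x \<in> A" using uA[OF that] by simp
    show "x \<in> A \<or> (\<exists>a\<in>A. \<rho> x a < 2 * \<eta>)" if "max 0 (1 - u x / \<eta>) \<noteq> 0"
      using that \<eta> by (intro close) (auto simp: max_def field_simps split: if_splits)
    have "\<bar>max 0 (1 - u x / \<eta>) - max 0 (1 - u y / \<eta>)\<bar> \<le> \<bar>u x / \<eta> - u y / \<eta>\<bar>" by linarith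
    also have "\<dots> = \<bar>u x - u y\<bar> / \<eta>" using \<eta> by (simp add: diff_divide_distrib[symmetric])
    also have "\<dots> \<le> \<rho> x y / \<eta>" using \<eta> lip[of x y] by (intro divide_right_mono) auto
    finally show "\<bar>max 0 (1 - u x / \<eta>) - max 0 (1 - u y / \<eta>)\<bar> \<le> \<rho> x y / \<eta>" .
  qed
qed

subsection \<open>A quasicocycle on a hyperbolic group action\<close>

text \<open>The nonnegative and the negative integers each contribute at most one geometric
  series.\<close>

lemma sum_int_geometric_le:
  fixes q :: real
  assumes "0 \<le> q" "q < 1" "finite I"
  shows "(\<Sum>m\<in>I. q ^ nat \<bar>m\<bar>) \<le> 2 / (1 - q)"
proof -
  have geo: "(\<Sum>m\<in>J. q ^ nat \<bar>m\<bar>) \<le> 1 / (1 - q)" if "finite J" "inj_on (\<lambda>m. nat \<bar>m\<bar>) J" for J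
  proof -
    have "(\<Sum>m\<in>J. q ^ nat \<bar>m\<bar>) = (\<Sum>k\<in>(\<lambda>m. nat \<bar>m\<bar>) ` J. q ^ k)"
      using that by (simp add: sum.reindex)
    also have "\<dots> \<le> (\<Sum>k. q ^ k)"
      using assms that by (intro sum_le_suminf summable_geometric) auto
    also have "\<dots> = 1 / (1 - q)" using assms by (intro suminf_geometric) auto
    finally show ?thesis .
  qed
  have "(\<Sum>m\<in>I. q ^ nat \<bar>m\<bar>) =
      (\<Sum>m\<in>I \<inter> {0..}. q ^ nat \<bar>m\<bar>) + (\<Sum>m\<in>I \<inter> {..<0}. q ^ nat \<bar>m\<bar>)"
    using assms(3) by (subst sum.union_disjoint[symmetric]) (auto intro!: sum.cong)
  also have "\<dots> \<le> 1 / (1 - q) + 1 / (1 - q)"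
    by (intro add_mono geo) (use assms in \<open>auto simp: inj_on_def\<close>)
  finally show ?thesis by simp
qed

text \<open>\<open>finite_ball\<close> counts group elements, so only finitely many of them have
  pseudodistance zero from the identity.\<close>

locale hyperbolic_group = group \<Gamma> + hyperbolic_pseudometric d \<delta>
  for \<Gamma> :: "('g, 'm) monoid_scheme" (structure) and d :: "'g \<Rightarrow> 'g \<Rightarrow> real" and \<delta> +
  assumes left_invariant:
      "g \<in> carrier \<Gamma> \<Longrightarrow> x \<in> carrier \<Gamma> \<Longrightarrow> y \<in> carrier \<Gamma> \<Longrightarrow> d (g \<otimes> x) (g \<otimes> y) = d x y"
    and finite_ball: "finite {g \<in> carrier \<Gamma>. d \<one> g \<le> r}"
begin

lemma gp_left_invariant:
  assumes "g \<in> carrier \<Gamma>" "w \<in> carrier \<Gamma>" "x \<in> carrier \<Gamma>" "y \<in> carrier \<Gamma>"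
  shows "gp (g \<otimes> w) (g \<otimes> x) (g \<otimes> y) = gp w x y"
  using assms by (simp add: gp_def left_invariant)

lemma gp_one:
  assumes "g \<in> carrier \<Gamma>" "x \<in> carrier \<Gamma>" "y \<in> carrier \<Gamma>"
  shows "gp \<one> (inv g \<otimes> x) (inv g \<otimes> y) = gp g x y"
  using gp_left_invariant[of "inv g" g x y] assms by simp

lemma dist_one:
  assumes "g \<in> carrier \<Gamma>" "x \<in> carrier \<Gamma>"
  shows "d \<one> (inv g \<otimes> x) = d g x"
  using left_invariant[of "inv g" g x] assms by simp

lemma dist_one_inv: "g \<in> carrier \<Gamma> \<Longrightarrow> d \<one> (inv g) = d \<one> g"
  using left_invariant[of g \<one> "inv g"] by (simp add: d_sym)

text \<open>Translating one point of \<open>Y\<close> to the identity moves \<open>Y\<close>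
  injectively into a ball.\<close>

lemma card_bounded_diameter:
  assumes "Y \<subseteq> carrier \<Gamma>" "\<And>y y'. y \<in> Y \<Longrightarrow> y' \<in> Y \<Longrightarrow> d y y' \<le> r"
  shows "card Y \<le> card {g \<in> carrier \<Gamma>. d \<one> g \<le> r}"
proof (cases "Y = {}")
  case False
  then obtain y where y: "y \<in> Y" by blast
  have "inj_on (\<lambda>x. inv y \<otimes> x) Y" using y assms(1) by (intro inj_onI) (auto simp: subset_iff)
  moreover have "(\<lambda>x. inv y \<otimes> x) ` Y \<subseteq> {g \<in> carrier \<Gamma>. d \<one> g \<le> r}"
    using y assms by (auto simp: dist_one subset_iff)
  ultimately show ?thesis using finite_ball card_inj_on_le by blast
qed simp

text \<open>Points near the side are sorted by their integer position relative to the centre of the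
  triangle. Points with the same position are mutually close by \<open>near_segment_dist\<close>, so
  their number is bounded, and by \<open>gp_max_lower\<close> the weights decay geometrically with
  the position.\<close>

lemma sum_near_segment_le:
  assumes q: "0 < q" "q < 1"
    and Y: "finite Y" "Y \<subseteq> carrier \<Gamma>" "\<And>y. y \<in> Y \<Longrightarrow> gp y a b \<le> R"
  shows "(\<Sum>y\<in>Y. q powr max (gp y b c) (gp y c a)) \<le>
    card {g \<in> carrier \<Gamma>. d \<one> g \<le> 1 + 2 * R + 2 * \<delta>} * (2 / (1 - q)) * q powr (- 1 - R)"
proof -
  define N where "N = card {g \<in> carrier \<Gamma>. d \<one> g \<le> 1 + 2 * R + 2 * \<delta>}"
  define m where "m y = \<lfloor>d a y - gp a b c\<rfloor>" for y
  have w: "q powr max (gp y b c) (gp y c a) \<le> q powr (- 1 - R) * q ^ nat \<bar>m y\<bar>" if "y \<in> Y" for y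
  proof -
    \<comment> \<open>The loss of 1 is due to rounding the position to an integer, the loss of
      \<open>R\<close> to \<open>gp_max_lower\<close>.\<close>
    have "real_of_int \<bar>m y\<bar> - 1 - R \<le> max (gp y b c) (gp y c a)"
      using gp_max_lower[OF Y(3)[OF that], of c] unfolding m_def by linarith
    then have "q powr max (gp y b c) (gp y c a) \<le> q powr ((- 1 - R) + real (nat \<bar>m y\<bar>))"
      using q by (intro powr_mono') auto
    also have "\<dots> = q powr (- 1 - R) * q ^ nat \<bar>m y\<bar>"
      using q by (simp only: powr_add powr_realpow)
    finally show ?thesis .
  qed
  have fib: "card {y \<in> Y. m y = k} \<le> N" for k
    unfolding N_def
  proof (rule card_bounded_diameter)
    fix y y' assume "y \<in> {y \<in> Y. m y = k}" "y' \<in> {y \<in> Y. m y = k}"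
    then show "d y y' \<le> 1 + 2 * R + 2 * \<delta>"
      by (intro near_segment_dist[of _ a b] Y(3)) (auto simp: m_def, linarith?)
  qed (use Y in auto)
  have "(\<Sum>y\<in>Y. q ^ nat \<bar>m y\<bar>) = (\<Sum>k\<in>m ` Y. \<Sum>y\<in>{y \<in> Y. m y = k}. q ^ nat \<bar>m y\<bar>)"
    by (rule sum.image_gen[OF Y(1)])
  also have "\<dots> = (\<Sum>k\<in>m ` Y. card {y \<in> Y. m y = k} * q ^ nat \<bar>k\<bar>)"
    by (intro sum.cong) auto
  also have "\<dots> \<le> (\<Sum>k\<in>m ` Y. N * q ^ nat \<bar>k\<bar>)"
    using fib q by (intro sum_mono mult_right_mono) auto
  also have "\<dots> = N * (\<Sum>k\<in>m ` Y. q ^ nat \<bar>k\<bar>)" by (simp add: sum_distrib_left)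
  also have "\<dots> \<le> N * (2 / (1 - q))"
    using q Y(1) by (intro mult_left_mono sum_int_geometric_le) auto
  finally have *: "(\<Sum>y\<in>Y. q ^ nat \<bar>m y\<bar>) \<le> N * (2 / (1 - q))" .
  have "(\<Sum>y\<in>Y. q powr max (gp y b c) (gp y c a)) \<le> (\<Sum>y\<in>Y. q powr (- 1 - R) * q ^ nat \<bar>m y\<bar>)"
    by (intro sum_mono w)
  also have "\<dots> = q powr (- 1 - R) * (\<Sum>y\<in>Y. q ^ nat \<bar>m y\<bar>)" by (simp add: sum_distrib_left)
  also have "\<dots> \<le> q powr (- 1 - R) * (N * (2 / (1 - q)))"
    using * by (intro mult_left_mono) auto
  finally show ?thesis by (simp add: N_def mult_ac)
qed

text \<open>The defect is cyclically symmetric, so its decay can be measured from any side. By the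
  separation of supports, every \<open>y\<close> with nonzero defect is near some side and is
  charged to it; \<open>sum_near_segment_le\<close> bounds the total charge of each of the three
  sides.\<close>

lemma wedge_defect_bounded:
  fixes \<kappa> \<theta> :: "'g \<Rightarrow> real"
  defines "F \<equiv> \<lambda>x y. \<kappa> x * \<theta> y - \<theta> x * \<kappa> y"
  assumes q: "0 < q" "q < 1" and C: "0 \<le> C"
    and range: "\<And>x. 0 \<le> \<kappa> x" "\<And>x. \<kappa> x \<le> 1" "\<And>x. 0 \<le> \<theta> x" "\<And>x. \<theta> x \<le> 1"
    and hoelder: "\<And>x y. \<bar>\<kappa> x - \<kappa> y\<bar> \<le> C * q powr gp \<one> x y"
      "\<And>x y. \<bar>\<theta> x - \<theta> y\<bar> \<le> C * q powr gp \<one> x y"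
    and supp: "\<And>x y. \<kappa> x \<noteq> 0 \<Longrightarrow> \<theta> y \<noteq> 0 \<Longrightarrow> gp \<one> x y \<le> R"
  shows "\<exists>B. \<forall>a\<in>carrier \<Gamma>. \<forall>b\<in>carrier \<Gamma>. \<forall>c\<in>carrier \<Gamma>. \<forall>Y\<subseteq>carrier \<Gamma>. finite Y \<longrightarrow>
    (\<Sum>y\<in>Y. \<bar>F (inv y \<otimes> a) (inv y \<otimes> b) + F (inv y \<otimes> b) (inv y \<otimes> c) - F (inv y \<otimes> a) (inv y \<otimes> c)\<bar>) \<le> B"
proof -
  define D where "D a b c = F a b + F b c - F a c" for a b c
  have anti: "F y x = - F x y" for x y by (simp add: F_def)
  have D_cyc: "D a b c = D b c a" for a b c
    unfolding D_def using anti[of b a] anti[of c a] by simp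
  have D1: "\<bar>D a b c\<bar> \<le> 2 * C * q powr gp \<one> a b" for a b c
  proof -
    \<comment> \<open>Subtracting the values at \<open>a\<close> displays \<open>D\<close> as a 2 by
      2 determinant: one column is small by the Hoelder bounds, the other has entries of modulus at
      most 1.\<close>
    have "D a b c = (\<kappa> b - \<kappa> a) * (\<theta> c - \<theta> a) - (\<theta> b - \<theta> a) * (\<kappa> c - \<kappa> a)"
      by (simp add: D_def F_def algebra_simps)
    also have "\<bar>\<dots>\<bar> \<le> \<bar>\<kappa> b - \<kappa> a\<bar> * \<bar>\<theta> c - \<theta> a\<bar> + \<bar>\<theta> b - \<theta> a\<bar> * \<bar>\<kappa> c - \<kappa> a\<bar>"
      by (simp add: abs_mult[symmetric])
    also have "\<dots> \<le> \<bar>\<kappa> b - \<kappa> a\<bar> * 1 + \<bar>\<theta> b - \<theta> a\<bar> * 1"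
      using range[of a] range[of c] by (intro add_mono mult_left_mono) (auto simp: abs_if)
    also have "\<dots> \<le> 2 * C * q powr gp \<one> a b"
      using hoelder[of a b] by (simp add: abs_minus_commute)
    finally show ?thesis .
  qed
  have D2: "\<bar>D a b c\<bar> \<le> 2 * C * q powr max (gp \<one> b c) (gp \<one> c a)" for a b c
    using D1[of b c a] D1[of c a b] D_cyc[of a b c] D_cyc[of b c a] by (simp add: max_def)
  have D3: "gp \<one> a b \<le> R \<or> gp \<one> b c \<le> R \<or> gp \<one> c a \<le> R" if "D a b c \<noteq> 0" for a b c
  proof -
    have F0: "F x y = 0" if "\<not> gp \<one> x y \<le> R" for x y
    proof -
      have "\<kappa> x * \<theta> y = 0" "\<theta> x * \<kappa> y = 0"
        using supp[of x y] supp[of y x] gp_sym[of \<one> x y] that by auto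
      then show ?thesis unfolding F_def by linarith
    qed
    show ?thesis
    proof (rule ccontr)
      assume "\<not> ?thesis"
      then have "F a b = 0" "F b c = 0" "F c a = 0" using F0 by auto
      with that anti[of c a] show False by (simp add: D_def)
    qed
  qed
  define B where "B = 2 * C * (card {g \<in> carrier \<Gamma>. d \<one> g \<le> 1 + 2 * R + 2 * \<delta>} * (2 / (1 - q)) * q powr (- 1 - R))"
  \<comment> \<open>The charge that \<open>y\<close> makes to the side from \<open>a\<close> to
    \<open>b\<close>; it is zero unless \<open>y\<close> is near that side.\<close>
  define S where "S y a b c = (if gp y a b \<le> R then 2 * C * q powr max (gp y b c) (gp y c a) else 0)" for y a b c
  have S0: "0 \<le> S y a b c" for y a b c using C by (simp add: S_def)
  have SB: "(\<Sum>y\<in>Y. S y a b c) \<le> B" if "Y \<subseteq> carrier \<Gamma>" "finite Y" for Y a b c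
  proof -
    have "(\<Sum>y\<in>Y. S y a b c) = 2 * C * (\<Sum>y\<in>{y\<in>Y. gp y a b \<le> R}. q powr max (gp y b c) (gp y c a))"
      using that by (simp add: S_def sum.If_cases sum_distrib_left Int_def)
    also have "\<dots> \<le> B" unfolding B_def
      by (intro mult_left_mono sum_near_segment_le) (use that q C in auto)
    finally show ?thesis .
  qed
  have DS: "\<bar>D (inv y \<otimes> a) (inv y \<otimes> b) (inv y \<otimes> c)\<bar> \<le> S y a b c + S y b c a + S y c a b"
    if "y \<in> carrier \<Gamma>" "a \<in> carrier \<Gamma>" "b \<in> carrier \<Gamma>" "c \<in> carrier \<Gamma>" for y a b c
  proof -
    let ?a = "inv y \<otimes> a" and ?b = "inv y \<otimes> b" and ?c = "inv y \<otimes> c"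
    have "\<bar>D ?a ?b ?c\<bar> \<le> S y a b c" if "gp y a b \<le> R"
      using D2[of ?a ?b ?c] that \<open>y \<in> _\<close> \<open>a \<in> _\<close> \<open>b \<in> _\<close> \<open>c \<in> _\<close> by (simp add: S_def gp_one)
    moreover have "\<bar>D ?a ?b ?c\<bar> \<le> S y b c a" if "gp y b c \<le> R"
      using D2[of ?b ?c ?a] that \<open>y \<in> _\<close> \<open>a \<in> _\<close> \<open>b \<in> _\<close> \<open>c \<in> _\<close> D_cyc[of ?a ?b ?c]
      by (simp add: S_def gp_one)
    moreover have "\<bar>D ?a ?b ?c\<bar> \<le> S y c a b" if "gp y c a \<le> R"
      using D2[of ?c ?a ?b] that \<open>y \<in> _\<close> \<open>a \<in> _\<close> \<open>b \<in> _\<close> \<open>c \<in> _\<close> D_cyc[of ?c ?a ?b]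
      by (simp add: S_def gp_one)
    moreover have "gp y a b \<le> R \<or> gp y b c \<le> R \<or> gp y c a \<le> R" if "D ?a ?b ?c \<noteq> 0"
      using D3[OF that] \<open>y \<in> _\<close> \<open>a \<in> _\<close> \<open>b \<in> _\<close> \<open>c \<in> _\<close> by (simp add: gp_one)
    ultimately show ?thesis
      using S0[of y a b c] S0[of y b c a] S0[of y c a b] by (cases "D ?a ?b ?c = 0") auto
  qed
  have "(\<Sum>y\<in>Y. \<bar>D (inv y \<otimes> a) (inv y \<otimes> b) (inv y \<otimes> c)\<bar>) \<le> 3 * B"
    if "a \<in> carrier \<Gamma>" "b \<in> carrier \<Gamma>" "c \<in> carrier \<Gamma>" "Y \<subseteq> carrier \<Gamma>" "finite Y" for a b c Y
  proof -
    have "(\<Sum>y\<in>Y. \<bar>D (inv y \<otimes> a) (inv y \<otimes> b) (inv y \<otimes> c)\<bar>) \<le>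
        (\<Sum>y\<in>Y. S y a b c + S y b c a + S y c a b)"
      by (intro sum_mono DS) (use that in auto)
    also have "\<dots> \<le> 3 * B"
      using SB[OF that(4,5), of a b c] SB[OF that(4,5), of b c a] SB[OF that(4,5), of c a b]
      by (simp add: sum.distrib)
    finally show ?thesis .
  qed
  then show ?thesis unfolding D_def by blast
qed

text \<open>\<open>\<kappa>\<close> and \<open>\<theta>\<close> come from
  \<open>quasi_metric_separation\<close> for the visual quasi-metric \<open>\<rho>\<close>:
  \<open>\<kappa>\<close> is 1 on \<open>A\<close> and 0 on \<open>B\<close> and \<open>C\<close>,
  while \<open>\<theta>\<close> is 1 on \<open>B\<close> and 0 on \<open>A\<close> and
  \<open>C\<close>. On a tripod the wedge then leaves the single term
  \<open>\<kappa> a * \<theta> b\<close>.\<close>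

lemma exists_quasicocycle:
  assumes A: "A \<noteq> {}" "B \<noteq> {}"
    and sep: "\<And>a b. a \<in> A \<Longrightarrow> b \<in> B \<Longrightarrow> gp \<one> a b \<le> T"
      "\<And>a c. a \<in> A \<Longrightarrow> c \<in> C \<Longrightarrow> gp \<one> a c \<le> T"
      "\<And>b c. b \<in> B \<Longrightarrow> c \<in> C \<Longrightarrow> gp \<one> b c \<le> T"
    and disj: "A \<inter> B = {}" "A \<inter> C = {}" "B \<inter> C = {}"
  obtains F :: "'g \<Rightarrow> 'g \<Rightarrow> real" and K where "\<And>x y. F y x = - F x y" "\<And>x y. \<bar>F x y\<bar> \<le> 1"
    "\<And>a b c. a \<in> A \<Longrightarrow> b \<in> B \<Longrightarrow> c \<in> C \<Longrightarrow> F a b + F b c - F a c = 1"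
    "\<And>a b c Y. a \<in> carrier \<Gamma> \<Longrightarrow> b \<in> carrier \<Gamma> \<Longrightarrow> c \<in> carrier \<Gamma> \<Longrightarrow> Y \<subseteq> carrier \<Gamma> \<Longrightarrow> finite Y \<Longrightarrow>
      (\<Sum>y\<in>Y. \<bar>F (inv y \<otimes> a) (inv y \<otimes> b) + F (inv y \<otimes> b) (inv y \<otimes> c) - F (inv y \<otimes> a) (inv y \<otimes> c)\<bar>) \<le> K"
proof -
  \<comment> \<open>Chosen so that the quasi-metric constant \<open>q powr (- \<delta>)\<close> has
    square at most 2; the summand 1 keeps the exponent defined for
    \<open>\<delta> = 0\<close>.\<close>
  define q :: real where "q = 2 powr (- 1 / (2 * \<delta> + 1))"
  have \<delta>1: "0 < 2 * \<delta> + 1" using delta_nonneg by simp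
  have q: "0 < q" "q < 1" using \<delta>1 by (auto simp: q_def intro!: powr_less_one)
  define \<rho> where "\<rho> x y = q powr gp \<one> x y" for x y
  \<comment> \<open>Small enough that \<open>\<rho> x y < 2 * \<eta>\<close> forces a product above
    \<open>T + 2 * \<delta>\<close>, which leaves room for two uses of \<open>gp_hyp\<close> in
    \<open>supp\<close>.\<close>
  define \<eta> where "\<eta> = q powr (T + 2 * \<delta>) / 4"
  have \<eta>: "0 < \<eta>" using q by (simp add: \<eta>_def)
  have K: "0 \<le> q powr (- \<delta>)" "(q powr (- \<delta>))\<^sup>2 \<le> 2"
  proof -
    have "(q powr (- \<delta>))\<^sup>2 = 2 powr (2 * \<delta> / (2 * \<delta> + 1))"
      using q by (simp add: q_def powr_powr power2_eq_square powr_add[symmetric])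
    also have "\<dots> \<le> 2 powr 1" using \<delta>1 by (intro powr_mono) auto
    finally show "(q powr (- \<delta>))\<^sup>2 \<le> 2" by simp
  qed simp
  have quasi: "\<rho> x z \<le> q powr (- \<delta>) * max (\<rho> x y) (\<rho> y z)" for x y z
  proof -
    have "\<rho> x z \<le> q powr (- \<delta> + min (gp \<one> x y) (gp \<one> y z))"
      unfolding \<rho>_def using q gp_hyp[of \<one> x y z] by (intro powr_mono') auto
    also have "\<dots> = q powr (- \<delta>) * q powr min (gp \<one> x y) (gp \<one> y z)" by (simp only: powr_add)
    also have "\<dots> \<le> q powr (- \<delta>) * max (\<rho> x y) (\<rho> y z)"
      by (intro mult_left_mono) (auto simp: \<rho>_def min_def)
    finally show ?thesis .
  qed
  have \<rho>0: "0 \<le> \<rho> x y" and \<rho>s: "\<rho> x y = \<rho> y x" for x y by (simp_all add: \<rho>_def gp_sym)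
  have close: "T + 2 * \<delta> < gp \<one> x y" if "\<rho> x y < 2 * \<eta>" for x y
  proof (rule ccontr)
    assume "\<not> ?thesis"
    then have "q powr (T + 2 * \<delta>) \<le> \<rho> x y" unfolding \<rho>_def using q by (intro powr_mono') auto
    then have "4 * \<eta> \<le> \<rho> x y" by (simp add: \<eta>_def)
    with that \<eta> show False by simp
  qed
  note sep_fun = quasi_metric_separation[where \<rho> = \<rho>, OF \<rho>0 \<rho>s quasi K \<eta>]
  obtain \<kappa> where \<kappa>: "\<And>x. 0 \<le> \<kappa> x" "\<And>x. \<kappa> x \<le> 1" "\<And>x. x \<in> A \<Longrightarrow> \<kappa> x = 1"
    "\<And>x. \<kappa> x \<noteq> 0 \<Longrightarrow> x \<in> A \<or> (\<exists>a\<in>A. \<rho> x a < 2 * \<eta>)"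
    "\<And>x y. \<bar>\<kappa> x - \<kappa> y\<bar> \<le> \<rho> x y / \<eta>" using sep_fun[OF A(1)] by metis
  obtain \<theta> where \<theta>: "\<And>x. 0 \<le> \<theta> x" "\<And>x. \<theta> x \<le> 1" "\<And>x. x \<in> B \<Longrightarrow> \<theta> x = 1"
    "\<And>x. \<theta> x \<noteq> 0 \<Longrightarrow> x \<in> B \<or> (\<exists>a\<in>B. \<rho> x a < 2 * \<eta>)"
    "\<And>x y. \<bar>\<theta> x - \<theta> y\<bar> \<le> \<rho> x y / \<eta>" using sep_fun[OF A(2)] by metis
  have far: "\<not> \<rho> x y < 2 * \<eta>" if "gp \<one> y x \<le> T" for x y
    using close[of x y] that delta_nonneg by (auto simp: gp_sym)
  \<comment> \<open>Disjointness enters separately from \<open>sep\<close>: a common point of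
    \<open>A\<close> and \<open>B\<close> at distance at most \<open>T\<close> from the identity
    would not violate \<open>sep\<close>.\<close>
  have \<kappa>0: "\<kappa> x = 0" if x: "x \<in> B \<union> C" for x
  proof -
    have "x \<notin> A" using x disj by blast
    moreover have "\<not> \<rho> x a < 2 * \<eta>" if "a \<in> A" for a
      using x sep(1,2)[OF that] by (intro far) blast
    ultimately show ?thesis using \<kappa>(4)[of x] by blast
  qed
  have \<theta>0: "\<theta> x = 0" if x: "x \<in> A \<union> C" for x
  proof -
    have "x \<notin> B" using x disj by blast
    moreover have "\<not> \<rho> x b < 2 * \<eta>" if "b \<in> B" for b
      using x sep(1)[OF _ that, of x] sep(3)[OF that, of x] gp_sym[of \<one> x b] by (intro far) auto
    ultimately show ?thesis using \<theta>(4)[of x] by blast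
  qed
  \<comment> \<open>Replace first \<open>a\<close> by \<open>x\<close>, then \<open>b\<close> by
    \<open>y\<close>; each exchange costs one \<open>\<delta>\<close>.\<close>
  have supp: "gp \<one> x y \<le> T + 2 * \<delta>" if xy: "\<kappa> x \<noteq> 0" "\<theta> y \<noteq> 0" for x y
  proof -
    obtain a where a: "a \<in> A" "x = a \<or> T + 2 * \<delta> < gp \<one> a x"
      using \<kappa>(4)[OF xy(1)] close[of x] gp_sym[of \<one> x] by metis
    obtain b where b: "b \<in> B" "y = b \<or> T + 2 * \<delta> < gp \<one> y b"
      using \<theta>(4)[OF xy(2)] close[of y] by metis
    have "gp \<one> a b \<le> T" by (rule sep(1)) fact+
    moreover have "min (gp \<one> a x) (gp \<one> x b) - \<delta> \<le> gp \<one> a b" by (rule gp_hyp)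
    ultimately have "gp \<one> x b \<le> T + \<delta>" using a delta_nonneg by (auto simp: min_def split: if_splits)
    moreover have "min (gp \<one> x y) (gp \<one> y b) - \<delta> \<le> gp \<one> x b" by (rule gp_hyp)
    ultimately show ?thesis using b delta_nonneg by (auto simp: min_def split: if_splits)
  qed
  let ?F = "\<lambda>x y. \<kappa> x * \<theta> y - \<theta> x * \<kappa> y"
  have "\<exists>K. \<forall>a\<in>carrier \<Gamma>. \<forall>b\<in>carrier \<Gamma>. \<forall>c\<in>carrier \<Gamma>. \<forall>Y\<subseteq>carrier \<Gamma>. finite Y \<longrightarrow>
    (\<Sum>y\<in>Y. \<bar>?F (inv y \<otimes> a) (inv y \<otimes> b) + ?F (inv y \<otimes> b) (inv y \<otimes> c) - ?F (inv y \<otimes> a) (inv y \<otimes> c)\<bar>) \<le> K"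
    by (rule wedge_defect_bounded[OF q, of "1 / \<eta>" \<kappa> \<theta> "T + 2 * \<delta>"])
      (use \<kappa> \<theta> supp \<eta> in \<open>auto simp: \<rho>_def\<close>)
  then obtain K where K: "\<And>a b c Y. a \<in> carrier \<Gamma> \<Longrightarrow> b \<in> carrier \<Gamma> \<Longrightarrow> c \<in> carrier \<Gamma> \<Longrightarrow> Y \<subseteq> carrier \<Gamma> \<Longrightarrow> finite Y \<Longrightarrow>
    (\<Sum>y\<in>Y. \<bar>?F (inv y \<otimes> a) (inv y \<otimes> b) + ?F (inv y \<otimes> b) (inv y \<otimes> c) - ?F (inv y \<otimes> a) (inv y \<otimes> c)\<bar>) \<le> K"
    by blast
  show ?thesis
  proof (rule that[of ?F K])
    fix x y
    have "0 \<le> \<kappa> x * \<theta> y" "\<kappa> x * \<theta> y \<le> 1" "0 \<le> \<theta> x * \<kappa> y" "\<theta> x * \<kappa> y \<le> 1"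
      using \<kappa>(1,2) \<theta>(1,2) by (auto intro!: mult_nonneg_nonneg mult_le_one)
    then show "\<bar>?F x y\<bar> \<le> 1" by linarith
  next
    fix a b c assume "a \<in> A" "b \<in> B" "c \<in> C"
    then show "?F a b + ?F b c - ?F a c = 1"
      using \<kappa>(3)[of a] \<theta>(3)[of b] \<kappa>0[of b] \<kappa>0[of c] \<theta>0[of a] \<theta>0[of c] by simp
  qed (use K in auto)
qed

end

subsection \<open>The 3-regular tree\<close>

text \<open>At tree vertices reached by an even number of letters the three edges leave along the
  \<open>s i\<close>, at the others along their inverses. Hence turns are controlled within each of
  the two families, never between them.\<close>

locale alternating_free = hyperbolic_group +
  fixes s :: "nat \<Rightarrow> 'a" and T :: real
  assumes s_closed: "i < 3 \<Longrightarrow> s i \<in> carrier \<Gamma>"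
    and s_turn: "i < 3 \<Longrightarrow> j < 3 \<Longrightarrow> i \<noteq> j \<Longrightarrow> gp \<one> (s i) (s j) \<le> T"
    and s_inv_turn: "i < 3 \<Longrightarrow> j < 3 \<Longrightarrow> i \<noteq> j \<Longrightarrow> gp \<one> (inv (s i)) (inv (s j)) \<le> T"
    and s_long: "i < 3 \<Longrightarrow> 2 * T + 3 * \<delta> < d \<one> (s i)"
begin

definition letter :: "bool \<Rightarrow> nat \<Rightarrow> 'a" where
  "letter b i = (if b then s i else inv (s i))"

primrec ev :: "bool \<Rightarrow> nat list \<Rightarrow> 'a" where
  "ev b [] = \<one>"
| "ev b (i # w) = letter b i \<otimes> ev (\<not> b) w"

text \<open>These are the paths in the 3-regular tree whose edges are coloured with 3 colours; the
  generators are read alternately forwards and backwards.\<close>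

definition words :: "nat \<Rightarrow> nat list set" where
  "words n = {w. length w = n \<and> set w \<subseteq> {..<3} \<and> distinct_adj w}"

text \<open>One branch at the identity. Even lengths are taken because the inverse of such a word,
  and the rest of a word after an even cut, are again read with orientation
  \<open>True\<close>.\<close>

definition cone :: "nat \<Rightarrow> 'a set" where
  "cone i = {ev True w | w k. w \<in> words (2 * Suc k) \<and> hd w = i}"

lemma T_nonneg: "0 \<le> T"
  using s_turn[of 0 1] gp_nonneg[of \<one> "s 0" "s 1"] by simp

lemma letter_closed: "i < 3 \<Longrightarrow> letter b i \<in> carrier \<Gamma>"
  by (simp add: letter_def s_closed)

lemma letter_not: "i < 3 \<Longrightarrow> letter (\<not> b) i = inv (letter b i)"
  by (simp add: letter_def s_closed)

lemma letter_turn: "i < 3 \<Longrightarrow> j < 3 \<Longrightarrow> i \<noteq> j \<Longrightarrow> gp \<one> (letter b i) (letter b j) \<le> T"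
  by (simp add: letter_def s_turn s_inv_turn)

lemma letter_long: "i < 3 \<Longrightarrow> 2 * T + 3 * \<delta> < d \<one> (letter b i)"
  by (simp add: letter_def s_long dist_one_inv s_closed)

lemma ev_closed: "set w \<subseteq> {..<3} \<Longrightarrow> ev b w \<in> carrier \<Gamma>"
  by (induction w arbitrary: b) (auto intro: letter_closed)

text \<open>The equation \<open>b = even n\<close> encodes the orientation after \<open>n\<close>
  letters: \<open>b\<close> itself for even \<open>n\<close>, its negation for odd
  \<open>n\<close>.\<close>

lemma ev_append:
  "set u \<subseteq> {..<3} \<Longrightarrow> set v \<subseteq> {..<3} \<Longrightarrow>
    ev b (u @ v) = ev b u \<otimes> ev (b = even (length u)) v"
proof (induction u arbitrary: b)
  case (Cons i u)
  then show ?case using letter_closed[of i b] ev_closed[of u] ev_closed[of v]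
    by (cases b; cases "even (length u)") (simp_all add: m_assoc)
qed (simp add: ev_closed)

lemma inv_ev: "set w \<subseteq> {..<3} \<Longrightarrow> inv (ev b w) = ev (b = even (length w)) (rev w)"
proof (induction w arbitrary: b)
  case (Cons i w)
  have "inv (ev b (i # w)) = inv (ev (\<not> b) w) \<otimes> inv (letter b i)"
    using Cons.prems by (simp add: inv_mult_group letter_closed ev_closed)
  also have "\<dots> = ev ((\<not> b) = even (length w)) (rev w) \<otimes> letter (\<not> b) i"
    using Cons by (simp add: letter_not)
  also have "\<dots> = ev (b = even (length (i # w))) (rev (i # w))"
    using Cons.prems letter_closed[of i]
    by (cases b; cases "even (length w)") (simp_all add: ev_append)
  finally show ?case .
qed simp

text \<open>Seen from the far end of the first edge, the way back is
  \<open>letter (\<not> b) i\<close>, so the induction hypothesis bounds the turn there.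
  \<open>gp_local_step\<close> carries this bound across the long edge to the identity.\<close>

lemma ev_turn:
  "set (i # w) \<subseteq> {..<3} \<Longrightarrow> distinct_adj (i # w) \<Longrightarrow> j < 3 \<Longrightarrow> j \<noteq> i \<Longrightarrow>
    gp \<one> (letter b j) (ev b (i # w)) \<le> T + \<delta>"
proof (induction w arbitrary: i j b)
  case Nil
  then show ?case using letter_turn[of j i b] delta_nonneg letter_closed[of i b] by simp
next
  case (Cons k w)
  have cl: "letter b i \<in> carrier \<Gamma>" "ev (\<not> b) (k # w) \<in> carrier \<Gamma>"
    using Cons.prems by (auto intro!: letter_closed ev_closed)
  have "gp \<one> (letter (\<not> b) i) (ev (\<not> b) (k # w)) \<le> T + \<delta>"
    by (rule Cons.IH) (use Cons.prems in auto)
  then have "gp (letter b i) \<one> (ev b (i # k # w)) \<le> T + \<delta>"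
    using cl Cons.prems gp_left_invariant[of "letter b i" \<one> "letter (\<not> b) i" "ev (\<not> b) (k # w)"]
    by (simp add: letter_not)
  moreover have "gp \<one> (letter b j) (letter b i) \<le> T" using Cons.prems by (intro letter_turn) auto
  moreover have "2 * T + 2 * \<delta> < d \<one> (letter b i)"
    using Cons.prems letter_long[of i b] delta_nonneg by simp
  ultimately show ?case using gp_local_step[of \<one> "letter b j" "letter b i"] by blast
qed

text \<open>The turn at the far end of the first edge is at most \<open>T + \<delta>\<close>; by
  \<open>gp_add\<close> the rest of the edge, of length above \<open>T + 2 * \<delta>\<close>, is
  shared with the whole path.\<close>

lemma letter_close:
  assumes "set (i # w) \<subseteq> {..<3}" "distinct_adj (i # w)"
  shows "T + 2 * \<delta> < gp \<one> (letter b i) (ev b (i # w))"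
proof -
  have i: "i < 3" using assms(1) by simp
  have long: "2 * T + 3 * \<delta> < d \<one> (letter b i)" by (rule letter_long[OF i])
  show ?thesis
  proof (cases w)
    case Nil
    then have "gp \<one> (letter b i) (ev b (i # w)) = d \<one> (letter b i)"
      using letter_closed[OF i] by (simp add: gp_self)
    then show ?thesis using long T_nonneg delta_nonneg by linarith
  next
    case (Cons k v)
    have cl: "letter b i \<in> carrier \<Gamma>" "ev (\<not> b) w \<in> carrier \<Gamma>"
      using assms by (auto intro!: letter_closed ev_closed)
    have "gp \<one> (letter (\<not> b) i) (ev (\<not> b) w) \<le> T + \<delta>"
      unfolding Cons by (rule ev_turn) (use assms Cons in auto)
    moreover have "gp (letter b i) \<one> (ev b (i # w)) = gp \<one> (letter (\<not> b) i) (ev (\<not> b) w)"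
      using cl gp_left_invariant[of "letter b i" \<one> "inv (letter b i)" "ev (\<not> b) w"]
      by (simp add: letter_not[OF i])
    ultimately show ?thesis using gp_add[of \<one> "letter b i" "ev b (i # w)"] long by linarith
  qed
qed

text \<open>In particular a nonempty reduced word never evaluates to the identity, so the tree
  embeds in the group.\<close>

lemma ev_long:
  assumes "set w \<subseteq> {..<3}" "distinct_adj w" "w \<noteq> []"
  shows "T + 2 * \<delta> < d \<one> (ev b w)"
proof -
  obtain i v where w: "w = i # v" using assms(3) by (cases w) auto
  show ?thesis using letter_close[of i v b] assms gp_le_right[of \<one> "letter b i" "ev b w"] by (simp add: w)
qed

text \<open>Both paths are compared with the first letter of \<open>u\<close>: \<open>u\<close>
  follows it beyond \<open>T + 2 * \<delta>\<close>, whereas \<open>v\<close> leaves it by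
  \<open>T + \<delta>\<close>.\<close>

lemma ev_separated:
  assumes "set u \<subseteq> {..<3}" "distinct_adj u" "u \<noteq> []"
    and "set v \<subseteq> {..<3}" "distinct_adj v" "v \<noteq> []" and "hd u \<noteq> hd v"
  shows "gp \<one> (ev b u) (ev b v) \<le> T + 2 * \<delta>"
proof -
  obtain i u' j v' where uv: "u = i # u'" "v = j # v'" using assms(3,6) by (cases u; cases v) auto
  have "T + 2 * \<delta> < gp \<one> (letter b i) (ev b u)" unfolding uv by (rule letter_close) (use assms uv in auto)
  moreover have "gp \<one> (letter b i) (ev b v) \<le> T + \<delta>" unfolding uv by (rule ev_turn) (use assms uv in auto)
  moreover have "min (gp \<one> (letter b i) (ev b u)) (gp \<one> (ev b u) (ev b v)) - \<delta> \<le> gp \<one> (letter b i) (ev b v)"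
    by (rule gp_hyp)
  ultimately show ?thesis by (simp add: min_def split: if_splits)
qed

lemma coneE:
  assumes "x \<in> cone i"
  obtains w where "x = ev True w" "set w \<subseteq> {..<3}" "distinct_adj w" "w \<noteq> []" "hd w = i"
proof -
  obtain w k where "x = ev True w" "w \<in> words (2 * Suc k)" "hd w = i"
    using assms unfolding cone_def by blast
  moreover from this have "w \<noteq> []" by (auto simp: words_def)
  ultimately show ?thesis using that unfolding words_def by blast
qed

lemma cone_closed: "cone i \<subseteq> carrier \<Gamma>"
  using ev_closed by (auto elim!: coneE)

lemma cone_separated:
  assumes "x \<in> cone i" "y \<in> cone j" "i \<noteq> j"
  shows "gp \<one> x y \<le> T + 2 * \<delta>"
proof -
  obtain u where u: "x = ev True u" "set u \<subseteq> {..<3}" "distinct_adj u" "u \<noteq> []" "hd u = i"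
    using assms(1) by (rule coneE)
  obtain v where v: "y = ev True v" "set v \<subseteq> {..<3}" "distinct_adj v" "v \<noteq> []" "hd v = j"
    using assms(2) by (rule coneE)
  show ?thesis unfolding u(1) v(1) by (rule ev_separated) (use u v assms(3) in simp_all)
qed

text \<open>The product of a common point with itself is its length, which \<open>ev_long\<close>
  puts above the separation bound.\<close>

lemma cone_disjoint:
  assumes "i \<noteq> j"
  shows "cone i \<inter> cone j = {}"
proof -
  have False if x: "x \<in> cone i" "x \<in> cone j" for x
  proof -
    obtain w where w: "x = ev True w" "set w \<subseteq> {..<3}" "distinct_adj w" "w \<noteq> []"
      using x(1) by (rule coneE)
    have "d \<one> x \<le> T + 2 * \<delta>" using cone_separated[OF x assms] by (simp add: gp_self)
    moreover have "T + 2 * \<delta> < d \<one> x" unfolding w(1) using w(2-4) by (rule ev_long)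
    ultimately show False by simp
  qed
  then show ?thesis by blast
qed

section \<open>Counting and averaging paths of the tree\<close>

lemma finite_words: "finite (words n)"
  by (rule finite_subset[OF _ finite_lists_length_eq[of "{..<3}" n]]) (auto simp: words_def)

lemma card_words_hd: "i < 3 \<Longrightarrow> card {w \<in> words (Suc n). hd w = i} = 2 ^ n"
proof (induction n arbitrary: i)
  case 0
  have "{w \<in> words (Suc 0). hd w = i} = {[i]}"
    using 0 by (auto simp: words_def length_Suc_conv)
  then show ?case by simp
next
  case (Suc n)
  have "{w \<in> words (Suc (Suc n)). hd w = i} =
      (#) i ` (\<Union>j\<in>{..<3} - {i}. {w \<in> words (Suc n). hd w = j})"
  proof (intro equalityI subsetI)
    fix w assume "w \<in> {w \<in> words (Suc (Suc n)). hd w = i}"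
    then obtain j v where w: "w = i # j # v" "length v = n" "set w \<subseteq> {..<3}" "distinct_adj w"
      by (auto simp: words_def length_Suc_conv)
    then have "j # v \<in> words (Suc n)" "j \<in> {..<3} - {i}" by (auto simp: words_def)
    then show "w \<in> (#) i ` (\<Union>j\<in>{..<3} - {i}. {w \<in> words (Suc n). hd w = j})"
      unfolding w(1) by (intro imageI UN_I[of j]) auto
  next
    fix w assume "w \<in> (#) i ` (\<Union>j\<in>{..<3} - {i}. {w \<in> words (Suc n). hd w = j})"
    then obtain v where v: "w = i # v" "hd v \<noteq> i" "v \<in> words (Suc n)" by blast
    then show "w \<in> {w \<in> words (Suc (Suc n)). hd w = i}"
      using Suc.prems by (auto simp: words_def distinct_adj_Cons)
  qed
  then have "card {w \<in> words (Suc (Suc n)). hd w = i} =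
      card (\<Union>j\<in>{..<3} - {i}. {w \<in> words (Suc n). hd w = j})"
    by (simp add: card_image)
  also have "\<dots> = (\<Sum>j\<in>{..<3} - {i}. card {w \<in> words (Suc n). hd w = j})"
    by (rule card_UN_disjoint) (use finite_words in auto)
  also have "\<dots> = (\<Sum>j\<in>{..<3} - {i}. 2 ^ n)" by (intro sum.cong refl Suc.IH) auto
  also have "\<dots> = 2 ^ Suc n" using Suc.prems by (simp add: card_Diff_subset)
  finally show ?case .
qed

lemma card_words: "card (words (Suc n)) = 3 * 2 ^ n"
proof -
  have "words (Suc n) = (\<Union>i\<in>{..<3}. {w \<in> words (Suc n). hd w = i})"
    by (auto simp: words_def length_Suc_conv)
  also have "card \<dots> = (\<Sum>i\<in>{..<3}. card {w \<in> words (Suc n). hd w = i})"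
    by (rule card_UN_disjoint) (use finite_words in auto)
  also have "\<dots> = (\<Sum>i<3::nat. 2 ^ n)" by (intro sum.cong refl card_words_hd) auto
  finally show ?thesis by simp
qed

lemma cone_nonempty: "i < 3 \<Longrightarrow> cone i \<noteq> {}"
proof -
  assume "i < 3"
  then have "card {w \<in> words (Suc (Suc 0)). hd w = i} \<noteq> 0" by (simp add: card_words_hd)
  then have "{w \<in> words (Suc (Suc 0)). hd w = i} \<noteq> {}" by (metis card.empty)
  then obtain w where "w \<in> words (Suc (Suc 0))" "hd w = i" by blast
  then have "ev True w \<in> cone i"
    unfolding cone_def by (intro CollectI exI[of _ w] exI[of _ 0]) (simp add: numeral_2_eq_2)
  then show ?thesis by blast
qed

text \<open>A path through the identity, cut there into its two halves, both read outwards.\<close>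

definition bent_pairs :: "nat \<Rightarrow> nat \<Rightarrow> (nat list \<times> nat list) set" where
  "bent_pairs k l = {(u, v). u \<in> words (2 * k) \<and> v \<in> words (2 * l) \<and> hd u \<noteq> hd v}"

lemma finite_bent_pairs: "finite (bent_pairs k l)"
  by (rule finite_subset[OF _ finite_cartesian_product[OF finite_words finite_words]])
    (auto simp: bent_pairs_def)

text \<open>Cutting a word after \<open>2 * k\<close> letters is a bijection: the condition
  \<open>hd u \<noteq> hd v\<close> is reducedness across the cut.\<close>

lemma sum_bent_pairs:
  assumes "0 < k" "k < n"
  shows "(\<Sum>(u, v)\<in>bent_pairs k (n - k). H u v) =
    (\<Sum>w\<in>words (2 * n). H (rev (take (2 * k) w)) (drop (2 * k) w))"
proof (rule sum.reindex_bij_witness[of _ "\<lambda>w. (rev (take (2 * k) w), drop (2 * k) w)"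
      "\<lambda>(u, v). rev u @ v"])
  fix w assume w: "w \<in> words (2 * n)"
  have tk: "take (2 * k) w \<noteq> []" "drop (2 * k) w \<noteq> []" using w assms by (auto simp: words_def)
  have "distinct_adj (take (2 * k) w @ drop (2 * k) w)" using w by (simp add: words_def)
  then have "distinct_adj (take (2 * k) w)" "distinct_adj (drop (2 * k) w)"
    "last (take (2 * k) w) \<noteq> hd (drop (2 * k) w)"
    using tk unfolding distinct_adj_append_iff by auto
  then show "(rev (take (2 * k) w), drop (2 * k) w) \<in> bent_pairs k (n - k)"
    using w assms tk set_take_subset[of "2 * k" w] set_drop_subset[of "2 * k" w]
    by (auto simp: bent_pairs_def words_def hd_rev diff_mult_distrib2)
next
  fix uv assume "uv \<in> bent_pairs k (n - k)"
  then obtain u v where uv: "uv = (u, v)" "u \<in> words (2 * k)" "v \<in> words (2 * (n - k))" "hd u \<noteq> hd v"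
    by (auto simp: bent_pairs_def)
  show "(case uv of (u, v) \<Rightarrow> rev u @ v) \<in> words (2 * n)"
    using uv assms by (auto simp: words_def distinct_adj_append_iff last_rev)
  show "(rev (take (2 * k) (case uv of (u, v) \<Rightarrow> rev u @ v)), drop (2 * k) (case uv of (u, v) \<Rightarrow> rev u @ v)) = uv"
    using uv by (simp add: words_def)
  show "H (rev (take (2 * k) (case uv of (u, v) \<Rightarrow> rev u @ v)))
      (drop (2 * k) (case uv of (u, v) \<Rightarrow> rev u @ v)) = (case uv of (u, v) \<Rightarrow> H u v)"
    using uv by (simp add: words_def)
qed simp

text \<open>Let \<open>y k\<close> be the vertex of the path after \<open>2 * k\<close> letters.
  Translating by its inverse turns the fixed endpoints \<open>\<one>\<close> and
  \<open>ev True w\<close> into the two halves read outwards from the cut. The vertices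
  \<open>y k\<close> are distinct, so \<open>upper\<close> applies to a single pair of
  endpoints.\<close>

lemma sum_cuts_le:
  fixes H :: "'a \<Rightarrow> 'a \<Rightarrow> real"
  assumes upper: "\<And>a b Y. a \<in> carrier \<Gamma> \<Longrightarrow> b \<in> carrier \<Gamma> \<Longrightarrow> Y \<subseteq> carrier \<Gamma> \<Longrightarrow> finite Y \<Longrightarrow>
      (\<Sum>y\<in>Y. H (inv y \<otimes> a) (inv y \<otimes> b)) \<le> C"
    and w: "w \<in> words (2 * n)"
  shows "(\<Sum>k\<in>{0<..<n}. H (ev True (rev (take (2 * k) w))) (ev True (drop (2 * k) w))) \<le> C"
proof -
  define y where "y k = ev True (take (2 * k) w)" for k
  have set_w: "set w \<subseteq> {..<3}" "length w = 2 * n" "distinct_adj w" using w by (auto simp: words_def)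
  have set_t: "set (take k w) \<subseteq> {..<3}" "set (drop k w) \<subseteq> {..<3}" for k
    using set_w set_take_subset[of k w] set_drop_subset[of k w] by auto
  have y: "y k \<in> carrier \<Gamma>" for k unfolding y_def by (intro ev_closed set_t)
  have y1: "inv (y k) = ev True (rev (take (2 * k) w))" if "k < n" for k
    unfolding y_def using that set_w by (subst inv_ev[OF set_t(1)]) simp
  have y2: "inv (y k) \<otimes> ev True w = ev True (drop (2 * k) w)" if "k < n" for k
  proof -
    have "ev True w = ev True (take (2 * k) w @ drop (2 * k) w)" by simp
    also have "\<dots> = y k \<otimes> ev True (drop (2 * k) w)"
      unfolding y_def using that set_w by (subst ev_append[OF set_t]) simp
    finally show ?thesis using y[of k] ev_closed[OF set_t(2)] by (simp add: m_assoc[symmetric])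
  qed
  have less: "y k \<noteq> y l" if "k < l" "l < n" for k l
  proof
    assume eq: "y k = y l"
    define v where "v = take (2 * (l - k)) (drop (2 * k) w)"
    have "2 * l = 2 * k + 2 * (l - k)" using that by simp
    then have "take (2 * l) w = take (2 * k + 2 * (l - k)) w" by (rule arg_cong)
    also have "\<dots> = take (2 * k) w @ v" by (simp only: take_add v_def)
    finally have "take (2 * l) w = take (2 * k) w @ v" .
    then have "y l = ev True (take (2 * k) w @ v)" by (simp add: y_def)
    moreover have v: "set v \<subseteq> {..<3}" "distinct_adj v" "v \<noteq> []"
    proof -
      show "set v \<subseteq> {..<3}"
        using set_t(2)[of "2 * k"] set_take_subset[of "2 * (l - k)" "drop (2 * k) w"]
        unfolding v_def by blast
      have "distinct_adj (drop (2 * k) w)"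
        using set_w(3) distinct_adj_appendD2[of "take (2 * k) w" "drop (2 * k) w"] by simp
      then have "distinct_adj (v @ drop (2 * (l - k)) (drop (2 * k) w))"
        by (simp only: v_def append_take_drop_id)
      then show "distinct_adj v" by (rule distinct_adj_appendD1)
      show "v \<noteq> []" using that set_w(2) by (simp add: v_def)
    qed
    ultimately have "y l = y k \<otimes> ev True v"
      unfolding y_def using that set_w by (subst (asm) ev_append[OF set_t(1)]) simp_all
    then have "ev True v = \<one>" using eq y[of k] ev_closed[OF v(1)] by simp
    then show False using ev_long[OF v, of True] T_nonneg delta_nonneg by simp
  qed
  have "y k \<noteq> y l" if "k < n" "l < n" "k \<noteq> l" for k l
    using less[of k l] less[of l k] that by (cases "k < l") auto
  then have inj: "inj_on y {0<..<n}" by (intro inj_onI) (metis greaterThanLessThan_iff)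
  have "(\<Sum>k\<in>{0<..<n}. H (ev True (rev (take (2 * k) w))) (ev True (drop (2 * k) w))) =
      (\<Sum>k\<in>{0<..<n}. H (inv (y k) \<otimes> \<one>) (inv (y k) \<otimes> ev True w))"
    using y by (intro sum.cong refl) (simp add: y1[symmetric] y2)
  also have "\<dots> = (\<Sum>x\<in>y ` {0<..<n}. H (inv x \<otimes> \<one>) (inv x \<otimes> ev True w))"
    by (simp add: sum.reindex[OF inj])
  also have "\<dots> \<le> C" by (rule upper) (use y ev_closed set_w in auto)
  finally show ?thesis .
qed

text \<open>A random path of length \<open>2n\<close> meets a bounded amount of \<open>H\<close> among its \<open>n - 1\<close> cuts, while
  every tripod forces a definite amount of \<open>H\<close> onto one of its three sides.\<close>

lemma averaging:
  fixes H :: "'a \<Rightarrow> 'a \<Rightarrow> real"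
  assumes nonneg: "\<And>a b. 0 \<le> H a b"
    and upper: "\<And>a b Y. a \<in> carrier \<Gamma> \<Longrightarrow> b \<in> carrier \<Gamma> \<Longrightarrow> Y \<subseteq> carrier \<Gamma> \<Longrightarrow> finite Y \<Longrightarrow>
      (\<Sum>y\<in>Y. H (inv y \<otimes> a) (inv y \<otimes> b)) \<le> C"
    and \<epsilon>: "0 < \<epsilon>"
    and lower: "\<And>a b c. a \<in> cone 0 \<Longrightarrow> b \<in> cone 1 \<Longrightarrow> c \<in> cone 2 \<Longrightarrow> \<epsilon> \<le> H a b + H b c + H a c"
  shows False
proof -
  define h where "h u v = H (ev True u) (ev True v)" for u v
  have h0: "0 \<le> h u v" for u v by (simp add: h_def nonneg)
  have C: "0 \<le> C" using upper[of \<one> \<one> "{}"] by simp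
  define g where "g k l = (\<Sum>(u, v)\<in>bent_pairs k l. h u v)" for k l
  \<comment> \<open>The mean of \<open>h\<close> over bent pairs, up to the factor 3/2: there are
    \<open>3 * 2 ^ (2 * n - 1)\<close> reduced words of length \<open>2 * n\<close>, with
    \<open>n = k + l\<close>.\<close>
  define \<gamma> where "\<gamma> k l = g k l / 2 ^ (2 * k + 2 * l)" for k l
  have \<gamma>0: "0 \<le> \<gamma> k l" for k l by (auto simp: \<gamma>_def g_def h0 intro!: divide_nonneg_pos sum_nonneg)
  have cut: "(\<Sum>k\<in>{0<..<n}. H (ev True (rev (take (2 * k) w))) (ev True (drop (2 * k) w))) \<le> C"
    if "w \<in> words (2 * n)" for w n
    by (rule sum_cuts_le[where H = H, OF _ that]) (rule upper)
  have up: "(\<Sum>k\<in>{0<..<n}. \<gamma> k (n - k)) \<le> 3 / 2 * C" for n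
  proof (cases "n = 0")
    case False
    then obtain m where m: "2 * n = Suc m" by (cases "2 * n") auto
    have "(\<Sum>k\<in>{0<..<n}. g k (n - k)) =
        (\<Sum>k\<in>{0<..<n}. \<Sum>w\<in>words (2 * n). h (rev (take (2 * k) w)) (drop (2 * k) w))"
      unfolding g_def by (intro sum.cong refl sum_bent_pairs) auto
    also have "\<dots> = (\<Sum>w\<in>words (2 * n). \<Sum>k\<in>{0<..<n}. h (rev (take (2 * k) w)) (drop (2 * k) w))"
      by (rule sum.swap)
    also have "\<dots> \<le> (\<Sum>w\<in>words (2 * n). C)"
      unfolding h_def by (intro sum_mono cut)
    also have "\<dots> = 3 * 2 ^ m * C" by (simp add: m card_words)
    finally have "(\<Sum>k\<in>{0<..<n}. g k (n - k)) / 2 ^ (2 * n) \<le> 3 / 2 * C"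
      unfolding m power_Suc by (simp add: field_simps)
    moreover have "(\<Sum>k\<in>{0<..<n}. \<gamma> k (n - k)) = (\<Sum>k\<in>{0<..<n}. g k (n - k)) / 2 ^ (2 * n)"
      unfolding sum_divide_distrib \<gamma>_def by (intro sum.cong refl) (simp add: diff_mult_distrib2)
    ultimately show ?thesis by simp
  qed (use C in simp)
  \<comment> \<open>Sum \<open>lower\<close> over all tripods with arms of lengths
    \<open>2 * k\<close>, \<open>2 * l\<close>, \<open>2 * m\<close> in the three branches. These
    have \<open>a / 2\<close>, \<open>b / 2\<close> and \<open>c / 2\<close> arms, and each pair of
    arms is counted once per third arm; division by \<open>a * b * c / 2\<close> leaves
    \<open>\<epsilon> / 4\<close>.\<close>
  have low: "\<epsilon> / 4 \<le> \<gamma> k l + \<gamma> l m + \<gamma> k m" if "0 < k" "0 < l" "0 < m" for k l m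
  proof -
    define W where "W i k = {w \<in> words (2 * k). hd w = i}" for i k
    have fW: "finite (W i k)" for i k using finite_words by (simp add: W_def)
    have cW: "real (card (W i k)) = 2 ^ (2 * k) / 2" if "i < 3" "0 < k" for i k
    proof -
      obtain n where "2 * k = Suc n" using \<open>0 < k\<close> by (cases "2 * k") auto
      then show ?thesis using card_words_hd[OF that(1), of n] by (simp add: W_def)
    qed
    have Wc: "ev True w \<in> cone i" if "w \<in> W i k" "0 < k" for w i k
      using that unfolding W_def cone_def by (cases k) auto
    have Wg: "(\<Sum>u\<in>W i k. \<Sum>v\<in>W j l. h u v) \<le> g k l" if "i \<noteq> j" for i j k l
      unfolding g_def sum.cartesian_product
      by (rule sum_mono2[OF finite_bent_pairs]) (use that h0 in \<open>auto simp: bent_pairs_def W_def\<close>)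
    let ?t = "\<lambda>f. \<Sum>u\<in>W 0 k. \<Sum>v\<in>W 1 l. \<Sum>w\<in>W 2 m. (f u v w :: real)"
    have "\<epsilon> \<le> h u v + h v w + h u w" if "u \<in> W 0 k" "v \<in> W 1 l" "w \<in> W 2 m" for u v w
      unfolding h_def
      by (rule lower[OF Wc[OF that(1) \<open>0 < k\<close>] Wc[OF that(2) \<open>0 < l\<close>] Wc[OF that(3) \<open>0 < m\<close>]])
    then have "?t (\<lambda>u v w. \<epsilon>) \<le> ?t (\<lambda>u v w. h u v + h v w + h u w)" by (intro sum_mono)
    also have "\<dots> = ?t (\<lambda>u v w. h u v) + ?t (\<lambda>u v w. h v w) + ?t (\<lambda>u v w. h u w)"
      by (simp add: sum.distrib)
    also have "?t (\<lambda>u v w. h u v) = card (W 2 m) * (\<Sum>u\<in>W 0 k. \<Sum>v\<in>W 1 l. h u v)"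
      by (simp add: sum_distrib_left)
    also have "?t (\<lambda>u v w. h v w) = card (W 0 k) * (\<Sum>v\<in>W 1 l. \<Sum>w\<in>W 2 m. h v w)"
      by simp
    also have "?t (\<lambda>u v w. h u w) = card (W 1 l) * (\<Sum>u\<in>W 0 k. \<Sum>w\<in>W 2 m. h u w)"
      by (simp add: sum_distrib_left)
    also have "card (W 2 m) * (\<Sum>u\<in>W 0 k. \<Sum>v\<in>W 1 l. h u v) +
        card (W 0 k) * (\<Sum>v\<in>W 1 l. \<Sum>w\<in>W 2 m. h v w) +
        card (W 1 l) * (\<Sum>u\<in>W 0 k. \<Sum>w\<in>W 2 m. h u w) \<le>
        card (W 2 m) * g k l + card (W 0 k) * g l m + card (W 1 l) * g k m"
      by (intro add_mono mult_left_mono Wg) auto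
    finally have main: "card (W 0 k) * (card (W 1 l) * (card (W 2 m) * \<epsilon>)) \<le>
        card (W 2 m) * g k l + card (W 0 k) * g l m + card (W 1 l) * g k m"
      by simp
    define a b c :: real where "a = 2 ^ (2 * k)" and "b = 2 ^ (2 * l)" and "c = 2 ^ (2 * m)"
    have abc: "0 < a" "0 < b" "0 < c" by (simp_all add: a_def b_def c_def)
    have g: "g k l = a * b * \<gamma> k l" "g l m = b * c * \<gamma> l m" "g k m = a * c * \<gamma> k m"
      by (simp_all add: \<gamma>_def a_def b_def c_def power_add)
    have card_abc: "real (card (W 0 k)) = a / 2" "real (card (W 1 l)) = b / 2" "real (card (W 2 m)) = c / 2"
      using that by (simp_all only: cW a_def b_def c_def)
    have "a * b * c * (\<epsilon> / 4) \<le> a * b * c * (\<gamma> k l + \<gamma> l m + \<gamma> k m)"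
      using main unfolding card_abc g by (simp add: algebra_simps)
    moreover have "0 < a * b * c" using abc by simp
    ultimately show ?thesis by (simp only: mult_le_cancel_left_pos)
  qed
  \<comment> \<open>Summing \<open>low\<close> over a cube of side \<open>N\<close> gives cubic
    growth on the left and \<open>3 * N * S\<close> on the right, where \<open>S\<close> is only
    linear in \<open>N\<close>. This contradicts \<open>0 < \<epsilon>\<close> for large
    \<open>N\<close>.\<close>
  have bound: "real N * \<epsilon> \<le> 54 * C" if "0 < N" for N
  proof -
    define S where "S = (\<Sum>k\<in>{1..N}. \<Sum>l\<in>{1..N}. \<gamma> k l)"
    have "(\<Sum>k\<in>{1..N}. \<Sum>l\<in>{1..N}. \<Sum>m\<in>{1..N}. \<epsilon> / 4) \<le>
        (\<Sum>k\<in>{1..N}. \<Sum>l\<in>{1..N}. \<Sum>m\<in>{1..N}. \<gamma> k l + \<gamma> l m + \<gamma> k m)"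
      by (intro sum_mono low) auto
    also have "\<dots> = N * S + N * S + N * S"
      by (simp add: sum.distrib S_def sum_distrib_left)
    finally have 1: "real N * (real N * (real N * \<epsilon>)) \<le> 12 * (real N * S)" by (simp add: mult.commute)
    have "S = (\<Sum>(k, l)\<in>{1..N} \<times> {1..N}. \<gamma> k l)" by (simp add: S_def sum.cartesian_product)
    also have "\<dots> = (\<Sum>(n, k)\<in>(\<lambda>(k, l). (k + l, k)) ` ({1..N} \<times> {1..N}). \<gamma> k (n - k))"
      by (subst sum.reindex) (auto simp: inj_on_def intro!: sum.cong)
    \<comment> \<open>The square is covered by the antidiagonals \<open>k + l = n\<close> with
      \<open>n \<le> 2 * N\<close>; each of them is bounded by \<open>up\<close>.\<close>
    also have "\<dots> \<le> (\<Sum>(n, k)\<in>(SIGMA n:{1..2 * N}. {0<..<n}). \<gamma> k (n - k))"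
      by (intro sum_mono2) (auto simp: \<gamma>0)
    also have "\<dots> = (\<Sum>n\<in>{1..2 * N}. \<Sum>k\<in>{0<..<n}. \<gamma> k (n - k))"
      by (simp add: sum.Sigma)
    also have "\<dots> \<le> (\<Sum>n\<in>{1..2 * N}. 3 / 2 * C)" by (intro sum_mono up)
    finally have "S \<le> 3 * N * C" by (simp add: mult_ac)
    then have "12 * (real N * S) \<le> real N * (real N * (36 * C))"
    proof -
      have "12 * real N * S \<le> 12 * real N * (3 * N * C)"
        using \<open>S \<le> 3 * N * C\<close> by (intro mult_left_mono) auto
      then show ?thesis by (simp add: mult_ac)
    qed
    with 1 have "real N * (real N * (real N * \<epsilon>)) \<le> real N * (real N * (36 * C))" by linarith
    then have "real N * \<epsilon> \<le> 36 * C" using that by simp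
    with C show ?thesis by simp
  qed
  obtain N :: nat where "54 * C / \<epsilon> < N" using reals_Archimedean2 by blast
  moreover have "0 \<le> 54 * C / \<epsilon>" using C \<epsilon> by simp
  ultimately have "0 < real N" "54 * C < N * \<epsilon>" using \<epsilon> by (linarith, simp add: field_simps)
  then show False using bound[of N] by simp
qed

end

subsection \<open>Bounded cohomology\<close>

text \<open>Argued with cosets alone: if the coboundaries were the only coset, the coset of
  \<open>c\<close> would consist of coboundaries, yet it contains \<open>c\<close>, since 0 is a
  coboundary.\<close>

lemma nontrivial_bounded_cohomology:
  assumes "c \<in> carrier (bounded_cocycles \<Gamma> V n)" "c \<notin> bounded_coboundaries \<Gamma> V n"
    "(\<lambda>_. 0) \<in> bounded_coboundaries \<Gamma> V n"
  shows "nontrivial (bounded_cohomology n \<Gamma> V)"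
  unfolding nontrivial_def
proof
  let ?Z = "bounded_cocycles \<Gamma> V n" and ?B = "bounded_coboundaries \<Gamma> V n"
  assume "carrier (bounded_cohomology n \<Gamma> V) = {\<one>\<^bsub>bounded_cohomology n \<Gamma> V\<^esub>}"
  then have "rcosets\<^bsub>?Z\<^esub> ?B = {?B}" by (simp add: bounded_cohomology_def FactGroup_def)
  moreover have "?B #>\<^bsub>?Z\<^esub> c \<in> rcosets\<^bsub>?Z\<^esub> ?B" using assms(1) by (auto simp: RCOSETS_def)
  ultimately have "?B #>\<^bsub>?Z\<^esub> c = ?B" by blast
  moreover have "c \<in> ?B #>\<^bsub>?Z\<^esub> c"
    unfolding r_coset_def using assms(3) by (auto simp: bounded_cocycles_def intro!: bexI[of _ "\<lambda>_. 0"])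
  ultimately show False using assms(2) by simp
qed

lemma powr_le_of_le_one: "0 \<le> x \<Longrightarrow> x \<le> 1 \<Longrightarrow> 1 \<le> p \<Longrightarrow> x powr p \<le> (x::real)"
  using powr_mono'[of 1 p x] by (cases "x = 0") auto

context alternating_free
begin

lemma tuples_1: "xs \<in> tuples \<Gamma> 1 \<longleftrightarrow> (\<exists>a\<in>carrier \<Gamma>. \<exists>b\<in>carrier \<Gamma>. xs = [a, b])"
  by (auto simp: tuples_def length_Suc_conv)

lemma tuples_2:
  "xs \<in> tuples \<Gamma> 2 \<longleftrightarrow> (\<exists>a\<in>carrier \<Gamma>. \<exists>b\<in>carrier \<Gamma>. \<exists>c\<in>carrier \<Gamma>. xs = [a, b, c])"
  by (auto simp: tuples_def length_Suc_conv numeral_2_eq_2)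

lemma tuples_3:
  "xs \<in> tuples \<Gamma> 3 \<longleftrightarrow>
    (\<exists>a\<in>carrier \<Gamma>. \<exists>b\<in>carrier \<Gamma>. \<exists>c\<in>carrier \<Gamma>. \<exists>e\<in>carrier \<Gamma>. xs = [a, b, c, e])"
  by (auto simp: tuples_def length_Suc_conv numeral_3_eq_3)

lemma zero_coboundary:
  "(\<lambda>_. 0) \<in> bounded_coboundaries \<Gamma> (ell (K :: 'k::real_normed_field itself) p \<Gamma>) 2"
proof -
  have "(\<lambda>_. 0) \<in> bounded_cochains \<Gamma> (ell K p \<Gamma>) 1"
    by (auto simp: bounded_cochains_def ell_def zero_fun_def fun_eq_iff intro!: exI[of _ 0])
  moreover have "coboundary_map \<Gamma> 1 (\<lambda>_. 0) = (\<lambda>_. 0 :: 'a \<Rightarrow> 'k)"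
    by (auto simp: coboundary_map_def fun_eq_iff intro!: sum.neutral)
  ultimately show ?thesis
    unfolding bounded_coboundaries_def numeral_2_eq_2 by (auto intro!: image_eqI[of _ _ "\<lambda>_. 0"])
qed

lemma coboundary_map_1:
  assumes "a \<in> carrier \<Gamma>" "b \<in> carrier \<Gamma>" "c \<in> carrier \<Gamma>"
  shows "coboundary_map \<Gamma> 1 \<beta> [a, b, c] = \<beta> [b, c] - \<beta> [a, c] + \<beta> [a, b]"
  using assms by (auto simp: coboundary_map_def tuples_def numeral_2_eq_2)

lemma coboundary_map_2:
  assumes "a \<in> carrier \<Gamma>" "b \<in> carrier \<Gamma>" "c \<in> carrier \<Gamma>" "e \<in> carrier \<Gamma>"
  shows "coboundary_map \<Gamma> 2 \<omega> [a, b, c, e] = \<omega> [b, c, e] - \<omega> [a, c, e] + \<omega> [a, b, e] - \<omega> [a, b, c]"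
proof -
  have "{..Suc 2} = {0, 1, 2, 3 :: nat}" by auto
  then show ?thesis using assms by (simp add: coboundary_map_def tuples_def)
qed

text \<open>\<open>\<omega>\<close> is formally the coboundary of the translates of
  \<open>F\<close>, which are bounded but need not be \<open>p\<close>-summable, whereas the defect
  is. For a bounded primitive \<open>\<beta>\<close> with values in the module, the function
  \<open>H\<close> would satisfy all hypotheses of \<open>averaging\<close>.\<close>

theorem nontrivial_ell_cohomology:
  fixes K :: "'k::real_normed_field itself"
  assumes p: "1 \<le> p"
  shows "nontrivial (bounded_cohomology 2 \<Gamma> (ell K p \<Gamma>))"
proof -
  have ne: "cone 0 \<noteq> {}" "cone 1 \<noteq> {}" by (simp_all add: cone_nonempty)
  have sep: "\<And>x y. x \<in> cone 0 \<Longrightarrow> y \<in> cone 1 \<Longrightarrow> gp \<one> x y \<le> T + 2 * \<delta>"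
    "\<And>x y. x \<in> cone 0 \<Longrightarrow> y \<in> cone 2 \<Longrightarrow> gp \<one> x y \<le> T + 2 * \<delta>"
    "\<And>x y. x \<in> cone 1 \<Longrightarrow> y \<in> cone 2 \<Longrightarrow> gp \<one> x y \<le> T + 2 * \<delta>"
    by (erule (1) cone_separated; simp)+
  have disj: "cone 0 \<inter> cone 1 = {}" "cone 0 \<inter> cone 2 = {}" "cone 1 \<inter> cone 2 = {}"
    by (simp_all add: cone_disjoint)
  obtain F :: "'a \<Rightarrow> 'a \<Rightarrow> real" and B where anti: "\<And>x y. F y x = - F x y"
    and F1: "\<And>x y. \<bar>F x y\<bar> \<le> 1"
    and tripod: "\<And>a b c. a \<in> cone 0 \<Longrightarrow> b \<in> cone 1 \<Longrightarrow> c \<in> cone 2 \<Longrightarrow> F a b + F b c - F a c = 1"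
    and bound: "\<And>a b c Y. a \<in> carrier \<Gamma> \<Longrightarrow> b \<in> carrier \<Gamma> \<Longrightarrow> c \<in> carrier \<Gamma> \<Longrightarrow> Y \<subseteq> carrier \<Gamma> \<Longrightarrow> finite Y \<Longrightarrow>
      (\<Sum>y\<in>Y. \<bar>F (inv y \<otimes> a) (inv y \<otimes> b) + F (inv y \<otimes> b) (inv y \<otimes> c) - F (inv y \<otimes> a) (inv y \<otimes> c)\<bar>) \<le> B"
  proof (rule exists_quasicocycle[OF ne sep disj])
    fix F :: "'a \<Rightarrow> 'a \<Rightarrow> real" and K
    assume *: "\<And>x y. F y x = - F x y" "\<And>x y. \<bar>F x y\<bar> \<le> 1"
      "\<And>a b c. a \<in> cone 0 \<Longrightarrow> b \<in> cone 1 \<Longrightarrow> c \<in> cone 2 \<Longrightarrow> F a b + F b c - F a c = 1"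
      "\<And>a b c Y. a \<in> carrier \<Gamma> \<Longrightarrow> b \<in> carrier \<Gamma> \<Longrightarrow> c \<in> carrier \<Gamma> \<Longrightarrow> Y \<subseteq> carrier \<Gamma> \<Longrightarrow> finite Y \<Longrightarrow>
      (\<Sum>y\<in>Y. \<bar>F (inv y \<otimes> a) (inv y \<otimes> b) + F (inv y \<otimes> b) (inv y \<otimes> c) - F (inv y \<otimes> a) (inv y \<otimes> c)\<bar>) \<le> K"
    show thesis by (rule that[OF *])
  qed
  define D where "D a b c = F a b + F b c - F a c" for a b c
  have D3: "\<bar>D a b c\<bar> \<le> 3" for a b c
    using F1[of a b] F1[of b c] F1[of a c] by (simp add: D_def)
  define \<omega> :: "'a list \<Rightarrow> 'a \<Rightarrow> 'k" where
    "\<omega> xs = (if xs \<in> tuples \<Gamma> 2 then (\<lambda>x. if x \<in> carrier \<Gamma>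
      then of_real (D (inv x \<otimes> xs ! 0) (inv x \<otimes> xs ! 1) (inv x \<otimes> xs ! 2)) else 0) else 0)" for xs
  have \<omega>: "\<omega> [a, b, c] x = of_real (D (inv x \<otimes> a) (inv x \<otimes> b) (inv x \<otimes> c))"
    if "a \<in> carrier \<Gamma>" "b \<in> carrier \<Gamma>" "c \<in> carrier \<Gamma>" "x \<in> carrier \<Gamma>" for a b c x
    using that by (simp add: \<omega>_def tuples_2)
  have \<omega>_off: "\<omega> xs x = 0" if "x \<notin> carrier \<Gamma>" for xs x using that by (simp add: \<omega>_def)
  have fin: "(\<Sum>x\<in>Y. norm (\<omega> [a, b, c] x) powr p) \<le> 3 powr p * B / 3"
    if abc: "a \<in> carrier \<Gamma>" "b \<in> carrier \<Gamma>" "c \<in> carrier \<Gamma>" and Y: "Y \<subseteq> carrier \<Gamma>" "finite Y" for a b c Y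
  proof -
    have "norm (\<omega> [a, b, c] x) powr p \<le>
        3 powr p / 3 * \<bar>D (inv x \<otimes> a) (inv x \<otimes> b) (inv x \<otimes> c)\<bar>" if "x \<in> Y" for x
    proof -
      let ?D = "\<bar>D (inv x \<otimes> a) (inv x \<otimes> b) (inv x \<otimes> c)\<bar>"
      \<comment> \<open>After division by the bound 3 the base is at most 1, where raising to the
        power \<open>p \<ge> 1\<close> does not increase it. So the summable bound on the defect
        suffices for every such \<open>p\<close>.\<close>
      have "?D powr p = (3 * (?D / 3)) powr p" by simp
      also have "\<dots> = 3 powr p * (?D / 3) powr p" by (rule powr_mult)
      also have "\<dots> \<le> 3 powr p * (?D / 3)"
        using D3 p by (intro mult_left_mono powr_le_of_le_one) auto
      finally show ?thesis using that abc Y by (simp add: \<omega> subset_iff)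
    qed
    then have "(\<Sum>x\<in>Y. norm (\<omega> [a, b, c] x) powr p) \<le>
        (\<Sum>x\<in>Y. 3 powr p / 3 * \<bar>D (inv x \<otimes> a) (inv x \<otimes> b) (inv x \<otimes> c)\<bar>)"
      by (rule sum_mono)
    also have "\<dots> = 3 powr p / 3 * (\<Sum>x\<in>Y. \<bar>D (inv x \<otimes> a) (inv x \<otimes> b) (inv x \<otimes> c)\<bar>)"
      by (simp add: sum_distrib_left)
    also have "\<dots> \<le> 3 powr p / 3 * B"
      using bound[OF abc Y] by (intro mult_left_mono) (auto simp: D_def)
    finally show ?thesis by simp
  qed
  have summ: "(\<lambda>x. norm (\<omega> [a, b, c] x) powr p) summable_on carrier \<Gamma>"
    and norm: "(\<Sum>\<^sub>\<infinity>x\<in>carrier \<Gamma>. norm (\<omega> [a, b, c] x) powr p) powr (1 / p) \<le> (3 powr p * B / 3) powr (1 / p)"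
    if abc: "a \<in> carrier \<Gamma>" "b \<in> carrier \<Gamma>" "c \<in> carrier \<Gamma>" for a b c
  proof -
    have "bdd_above (sum (\<lambda>x. norm (\<omega> [a, b, c] x) powr p) ` {Y. Y \<subseteq> carrier \<Gamma> \<and> finite Y})"
      by (rule bdd_aboveI2[where M = "3 powr p * B / 3"]) (use fin[OF abc] in blast)
    then show 1: "(\<lambda>x. norm (\<omega> [a, b, c] x) powr p) summable_on carrier \<Gamma>"
      by (intro nonneg_bdd_above_summable_on) simp_all
    have "(\<Sum>\<^sub>\<infinity>x\<in>carrier \<Gamma>. norm (\<omega> [a, b, c] x) powr p) \<le> 3 powr p * B / 3"
      by (rule infsum_le_finite_sums[OF 1]) (use fin[OF abc] in auto)
    then show "(\<Sum>\<^sub>\<infinity>x\<in>carrier \<Gamma>. norm (\<omega> [a, b, c] x) powr p) powr (1 / p) \<le> (3 powr p * B / 3) powr (1 / p)"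
      using p by (intro powr_mono2 infsum_nonneg) auto
  qed
  have cochain: "\<omega> \<in> bounded_cochains \<Gamma> (ell K p \<Gamma>) 2"
    unfolding bounded_cochains_def
  proof (intro CollectI conjI allI impI ballI exI)
    fix xs assume "xs \<notin> tuples \<Gamma> 2" then show "\<omega> xs = 0" by (simp add: \<omega>_def)
  next
    fix xs assume "xs \<in> tuples \<Gamma> 2"
    then show "\<omega> xs \<in> vecs (ell K p \<Gamma>)" using summ \<omega>_off by (auto simp: tuples_2 ell_def)
  next
    fix xs assume "xs \<in> tuples \<Gamma> 2"
    then show "vnorm (ell K p \<Gamma>) (\<omega> xs) \<le> (3 powr p * B / 3) powr (1 / p)"
      using norm by (auto simp: tuples_2 ell_def)
  next
    fix g xs assume g: "g \<in> carrier \<Gamma>" and "xs \<in> tuples \<Gamma> 2"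
    then obtain a b c where abc: "a \<in> carrier \<Gamma>" "b \<in> carrier \<Gamma>" "c \<in> carrier \<Gamma>" "xs = [a, b, c]"
      by (auto simp: tuples_2)
    show "\<omega> (map ((\<otimes>) g) xs) = vact (ell K p \<Gamma>) g (\<omega> xs)"
    proof
      fix x
      show "\<omega> (map ((\<otimes>) g) xs) x = vact (ell K p \<Gamma>) g (\<omega> xs) x"
      proof (cases "x \<in> carrier \<Gamma>")
        case True
        then show ?thesis using g abc by (simp add: \<omega> ell_def inv_mult_group m_assoc)
      qed (simp add: \<omega>_off ell_def)
    qed
  qed
  have "coboundary_map \<Gamma> 2 \<omega> xs = 0" for xs
  proof (cases "xs \<in> tuples \<Gamma> 3")
    case True
    then obtain a b c e where abce: "a \<in> carrier \<Gamma>" "b \<in> carrier \<Gamma>" "c \<in> carrier \<Gamma>" "e \<in> carrier \<Gamma>"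
      and xs: "xs = [a, b, c, e]" by (auto simp: tuples_3)
    \<comment> \<open>Pointwise this is the coboundary of a coboundary, so all terms in
      \<open>F\<close> cancel.\<close>
    have "(\<omega> [b, c, e] - \<omega> [a, c, e] + \<omega> [a, b, e] - \<omega> [a, b, c]) x = 0" for x
      using abce by (cases "x \<in> carrier \<Gamma>") (simp_all add: \<omega> \<omega>_off D_def)
    then have "\<omega> [b, c, e] - \<omega> [a, c, e] + \<omega> [a, b, e] - \<omega> [a, b, c] = 0" by (simp add: fun_eq_iff)
    then show ?thesis unfolding xs coboundary_map_2[OF abce] .
  qed (simp add: coboundary_map_def)
  then have cocycle: "\<omega> \<in> carrier (bounded_cocycles \<Gamma> (ell K p \<Gamma>) 2)"
    using cochain by (simp add: bounded_cocycles_def fun_eq_iff)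
  have "\<omega> \<notin> bounded_coboundaries \<Gamma> (ell K p \<Gamma>) 2"
  proof
    assume "\<omega> \<in> bounded_coboundaries \<Gamma> (ell K p \<Gamma>) 2"
    then obtain \<beta> where \<beta>: "\<beta> \<in> bounded_cochains \<Gamma> (ell K p \<Gamma>) 1" and \<omega>\<beta>: "\<omega> = coboundary_map \<Gamma> 1 \<beta>"
      by (auto simp: bounded_coboundaries_def numeral_2_eq_2)
    obtain b where b: "\<And>xs. xs \<in> tuples \<Gamma> 1 \<Longrightarrow> vnorm (ell K p \<Gamma>) (\<beta> xs) \<le> b"
      using \<beta> unfolding bounded_cochains_def by blast
    have vec: "\<beta> xs \<in> vecs (ell K p \<Gamma>)" if "xs \<in> tuples \<Gamma> 1" for xs
      using \<beta> that unfolding bounded_cochains_def by blast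
    \<comment> \<open>By equivariance, the values at the identity over all translated pairs recover
      the whole function \<open>\<beta> [x, z]\<close>; its norm thus becomes the sum in the
      hypothesis \<open>upper\<close> of \<open>averaging\<close>.\<close>
    have equi: "\<beta> [inv y \<otimes> x, inv y \<otimes> z] \<one> = \<beta> [x, z] y"
      if "x \<in> carrier \<Gamma>" "z \<in> carrier \<Gamma>" "y \<in> carrier \<Gamma>" for x y z
    proof -
      have "\<beta> (map ((\<otimes>) (inv y)) [x, z]) = vact (ell K p \<Gamma>) (inv y) (\<beta> [x, z])"
        using \<beta> that tuples_1[of "[x, z]"] inv_closed[of y] unfolding bounded_cochains_def by blast
      then show ?thesis using that by (simp add: ell_def)
    qed
    define H where "H x z = norm (\<beta> [x, z] \<one>) powr p" for x z
    show False
    proof (rule averaging[of H "b powr p" "(1 / 3) powr p"])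
      fix x z Y assume xz: "x \<in> carrier \<Gamma>" "z \<in> carrier \<Gamma>" and Y: "Y \<subseteq> carrier \<Gamma>" "finite Y"
      have t: "[x, z] \<in> tuples \<Gamma> 1" unfolding tuples_1 using xz by blast
      define s where "s = (\<Sum>\<^sub>\<infinity>y\<in>carrier \<Gamma>. norm (\<beta> [x, z] y) powr p)"
      have s0: "0 \<le> s" unfolding s_def by (intro infsum_nonneg) auto
      have "(\<Sum>y\<in>Y. H (inv y \<otimes> x) (inv y \<otimes> z)) = (\<Sum>y\<in>Y. norm (\<beta> [x, z] y) powr p)"
        unfolding H_def using xz Y by (intro sum.cong refl) (auto simp: equi)
      also have "\<dots> \<le> s" unfolding s_def
        using vec[OF t] Y by (intro finite_sum_le_infsum) (auto simp: ell_def)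
      also have "s = (s powr (1 / p)) powr p" using s0 p by (simp add: powr_powr)
      also have "\<dots> \<le> b powr p"
        using b[OF t] p by (intro powr_mono2) (auto simp: s_def ell_def)
      finally show "(\<Sum>y\<in>Y. H (inv y \<otimes> x) (inv y \<otimes> z)) \<le> b powr p" .
    next
      fix x y z assume xyz: "x \<in> cone 0" "y \<in> cone 1" "z \<in> cone 2"
      then have c: "x \<in> carrier \<Gamma>" "y \<in> carrier \<Gamma>" "z \<in> carrier \<Gamma>" using cone_closed by blast+
      have "\<omega> [x, y, z] \<one> = 1" using \<omega>[OF c one_closed] tripod[OF xyz] c by (simp add: D_def)
      then have "\<beta> [y, z] \<one> - \<beta> [x, z] \<one> + \<beta> [x, y] \<one> = 1"
        unfolding \<omega>\<beta> coboundary_map_1[OF c] by simp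
      then have "1 = norm (\<beta> [y, z] \<one> - \<beta> [x, z] \<one> + \<beta> [x, y] \<one>)" by simp
      also have "\<dots> \<le> norm (\<beta> [y, z] \<one> - \<beta> [x, z] \<one>) + norm (\<beta> [x, y] \<one>)" by (rule norm_triangle_ineq)
      also have "\<dots> \<le> norm (\<beta> [y, z] \<one>) + norm (\<beta> [x, z] \<one>) + norm (\<beta> [x, y] \<one>)"
        using norm_triangle_ineq4 by simp
      \<comment> \<open>Three norms with sum at least 1: one of them is at least 1/3.\<close>
      finally consider "1 / 3 \<le> norm (\<beta> [y, z] \<one>)" | "1 / 3 \<le> norm (\<beta> [x, z] \<one>)" | "1 / 3 \<le> norm (\<beta> [x, y] \<one>)"
        by linarith
      moreover have big: "(1 / 3) powr p \<le> H u v" if "1 / 3 \<le> norm (\<beta> [u, v] \<one>)" for u v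
        unfolding H_def using that p by (intro powr_mono2) auto
      moreover have "0 \<le> H u v" for u v by (simp add: H_def)
      ultimately show "(1 / 3) powr p \<le> H x y + H y z + H x z"
        by (smt (verit, best))
    qed (auto simp: H_def)
  qed
  then show ?thesis by (rule nontrivial_bounded_cohomology[OF cocycle _ zero_coboundary])
qed

end

subsection \<open>Boundary points and their translates\<close>

context Metric_space
begin

lemma gromov_product_swap: "gromov_product w x y = gromov_product w y x"
  by (simp add: gromov_product_def commute)

lemma gromov_product_basepoint:
  assumes "w \<in> M" "w' \<in> M" "x \<in> M" "y \<in> M"
  shows "gromov_product w x y \<le> gromov_product w' x y + d w w'"
  using triangle[of x w' w] triangle[of y w' w] assms commute[of w w']
  by (simp add: gromov_product_def field_simps)

lemma filterlim_at_top_double_sequence: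
  "filterlim (\<lambda>(i, j). f i j :: real) at_top (sequentially \<times>\<^sub>F sequentially) \<longleftrightarrow>
    (\<forall>C. \<exists>N. \<forall>i\<ge>N. \<forall>j\<ge>N. C \<le> f i j)"
  unfolding filterlim_at_top eventually_prod_sequentially by fastforce

text \<open>The filter limit behind \<open>gromov_sequences\<close> and \<open>gromov_equiv\<close>,
  unfolded at one basepoint; changing the basepoint alters products by a bounded amount.\<close>

definition diverging_products :: "'a \<Rightarrow> (nat \<Rightarrow> 'a) \<Rightarrow> (nat \<Rightarrow> 'a) \<Rightarrow> bool" where
  "diverging_products w s t \<longleftrightarrow> (\<forall>C. \<exists>N. \<forall>i\<ge>N. \<forall>j\<ge>N. C \<le> gromov_product w (s i) (t j))"

lemma diverging_products_basepoint:
  assumes "w \<in> M" "w' \<in> M" "range s \<subseteq> M" "range t \<subseteq> M" "diverging_products w s t"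
  shows "diverging_products w' s t"
  unfolding diverging_products_def
proof
  fix C
  obtain N where N: "\<And>i j. i \<ge> N \<Longrightarrow> j \<ge> N \<Longrightarrow> C + d w w' \<le> gromov_product w (s i) (t j)"
    using assms(5) unfolding diverging_products_def by blast
  have "C \<le> gromov_product w' (s i) (t j)" if "i \<ge> N" "j \<ge> N" for i j
    using N[OF that] gromov_product_basepoint[OF assms(1,2), of "s i" "t j"] assms(3,4) by force
  then show "\<exists>N. \<forall>i\<ge>N. \<forall>j\<ge>N. C \<le> gromov_product w' (s i) (t j)" by blast
qed

lemma gromov_sequences_iff:
  assumes "w \<in> M"
  shows "s \<in> gromov_sequences \<longleftrightarrow> range s \<subseteq> M \<and> diverging_products w s s"
  using assms diverging_products_basepoint[OF assms, of _ s s]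
  unfolding gromov_sequences_def filterlim_at_top_double_sequence diverging_products_def[symmetric]
  by blast

lemma gromov_equiv_iff:
  assumes "w \<in> M"
  shows "(s, t) \<in> gromov_equiv \<longleftrightarrow>
    s \<in> gromov_sequences \<and> t \<in> gromov_sequences \<and> diverging_products w s t"
proof -
  have "range s \<subseteq> M" "range t \<subseteq> M" if "s \<in> gromov_sequences" "t \<in> gromov_sequences"
    using that gromov_sequences_iff[OF assms] by blast+
  then show ?thesis
    using assms diverging_products_basepoint[OF assms, of _ s t]
    unfolding gromov_equiv_def filterlim_at_top_double_sequence diverging_products_def[symmetric]
    by blast
qed

lemma gromov_sequences_subseq:
  assumes "s \<in> gromov_sequences" "strict_mono r"
  shows "s \<circ> r \<in> gromov_sequences"
proof -
  have "range s \<subseteq> M" using assms(1) unfolding gromov_sequences_def by blast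
  then have "s 0 \<in> M" by auto
  then obtain w where w: "w \<in> M" ..
  have div: "diverging_products w s s" using assms(1) by (simp only: gromov_sequences_iff[OF w])
  have "diverging_products w (s \<circ> r) (s \<circ> r)"
    unfolding diverging_products_def
  proof
    fix C
    obtain N where N: "\<And>i j. i \<ge> N \<Longrightarrow> j \<ge> N \<Longrightarrow> C \<le> gromov_product w (s i) (s j)"
      using div unfolding diverging_products_def by blast
    show "\<exists>N. \<forall>i\<ge>N. \<forall>j\<ge>N. C \<le> gromov_product w ((s \<circ> r) i) ((s \<circ> r) j)"
    proof (intro exI allI impI)
      fix i j assume "N \<le> i" "N \<le> j"
      then show "C \<le> gromov_product w ((s \<circ> r) i) ((s \<circ> r) j)"
        using N[of "r i" "r j"] seq_suble[OF assms(2), of i] seq_suble[OF assms(2), of j] by simp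
    qed
  qed
  then show ?thesis using \<open>range s \<subseteq> M\<close> unfolding gromov_sequences_iff[OF w] by auto
qed

end

section \<open>Isometric actions on a hyperbolic space\<close>

text \<open>The last two assumptions are what the graph has to provide:
  \<open>finite_orbit_ball\<close> expresses properness, and \<open>convergent_subseq\<close> is
  sequential compactness at infinity for the orbit.\<close>

locale isometric_action = group \<Gamma> + Metric_space M d
  for \<Gamma> :: "('g, 'm) monoid_scheme" (structure) and M :: "'a set" and d +
  fixes \<alpha> :: "'g \<Rightarrow> 'a \<Rightarrow> 'a" and v0 :: 'a and \<delta> :: real
  assumes maps: "g \<in> carrier \<Gamma> \<Longrightarrow> x \<in> M \<Longrightarrow> \<alpha> g x \<in> M"
    and mult: "g \<in> carrier \<Gamma> \<Longrightarrow> h \<in> carrier \<Gamma> \<Longrightarrow> x \<in> M \<Longrightarrow> \<alpha> (g \<otimes> h) x = \<alpha> g (\<alpha> h x)"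
    and unit: "x \<in> M \<Longrightarrow> \<alpha> \<one> x = x"
    and isom: "g \<in> carrier \<Gamma> \<Longrightarrow> x \<in> M \<Longrightarrow> y \<in> M \<Longrightarrow> d (\<alpha> g x) (\<alpha> g y) = d x y"
    and base: "v0 \<in> M"
    and hyp: "w \<in> M \<Longrightarrow> x \<in> M \<Longrightarrow> y \<in> M \<Longrightarrow> z \<in> M \<Longrightarrow>
      min (gromov_product w x y) (gromov_product w y z) - \<delta> \<le> gromov_product w x z"
    and finite_orbit_ball: "finite {g \<in> carrier \<Gamma>. d v0 (\<alpha> g v0) \<le> r}"
    and convergent_subseq: "range f \<subseteq> carrier \<Gamma> \<Longrightarrow> (\<And>n. real n \<le> d v0 (\<alpha> (f n) v0)) \<Longrightarrow>
      \<exists>\<sigma>. strict_mono \<sigma> \<and> (\<lambda>n. \<alpha> (f (\<sigma> n)) v0) \<in> gromov_sequences"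
begin

text \<open>The values off the carrier only serve to make \<open>orbit_dist\<close> a pseudometric on the whole type.\<close>

definition orbit_dist :: "'g \<Rightarrow> 'g \<Rightarrow> real" where
  "orbit_dist g h = (let c = \<lambda>g. if g \<in> carrier \<Gamma> then g else \<one> in d (\<alpha> (c g) v0) (\<alpha> (c h) v0))"

lemma orbit_dist: "g \<in> carrier \<Gamma> \<Longrightarrow> h \<in> carrier \<Gamma> \<Longrightarrow> orbit_dist g h = d (\<alpha> g v0) (\<alpha> h v0)"
  by (simp add: orbit_dist_def)

lemma inv_maps: "g \<in> carrier \<Gamma> \<Longrightarrow> x \<in> M \<Longrightarrow> \<alpha> (inv g) (\<alpha> g x) = x"
  using mult[of "inv g" g x] by (simp add: unit)

lemma maps_inv: "g \<in> carrier \<Gamma> \<Longrightarrow> x \<in> M \<Longrightarrow> \<alpha> g (\<alpha> (inv g) x) = x"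
  using mult[of g "inv g" x] by (simp add: unit)

sublocale orb: hyperbolic_group \<Gamma> orbit_dist \<delta>
proof
  define c where "c g = (if g \<in> carrier \<Gamma> then g else \<one>)" for g
  have c: "c g \<in> carrier \<Gamma>" for g by (simp add: c_def)
  have v0: "orbit_dist g h = d (\<alpha> (c g) v0) (\<alpha> (c h) v0)" for g h
    by (simp add: orbit_dist_def c_def)
  have M: "\<alpha> (c g) v0 \<in> M" for g by (rule maps[OF c base])
  fix x y z w
  show "orbit_dist x x = 0" "orbit_dist x y = orbit_dist y x"
    using M by (simp_all add: v0 commute)
  show "orbit_dist x z \<le> orbit_dist x y + orbit_dist y z"
    unfolding v0 by (intro triangle M)
  show "orbit_dist x z + orbit_dist y w \<le>
      max (orbit_dist x y + orbit_dist z w) (orbit_dist y z + orbit_dist x w) + 2 * \<delta>"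
    using hyp[OF M M M M, of w x y z] unfolding v0 gromov_product_def
    by (auto simp: min_def max_def field_simps split: if_splits)
next
  fix g x y assume "g \<in> carrier \<Gamma>" "x \<in> carrier \<Gamma>" "y \<in> carrier \<Gamma>"
  then show "orbit_dist (g \<otimes> x) (g \<otimes> y) = orbit_dist x y"
    by (simp add: orbit_dist mult isom maps base)
next
  fix r
  have "{g \<in> carrier \<Gamma>. orbit_dist \<one> g \<le> r} = {g \<in> carrier \<Gamma>. d v0 (\<alpha> g v0) \<le> r}"
    by (auto simp: orbit_dist unit base)
  then show "finite {g \<in> carrier \<Gamma>. orbit_dist \<one> g \<le> r}" using finite_orbit_ball by simp
qed

lemma orb_gp:
  "g \<in> carrier \<Gamma> \<Longrightarrow> h \<in> carrier \<Gamma> \<Longrightarrow> orb.gp \<one> g h = gromov_product v0 (\<alpha> g v0) (\<alpha> h v0)"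
  by (simp add: orb.gp_def gromov_product_def orbit_dist unit base)

lemma diverging_products_trans:
  assumes "range s \<subseteq> M" "range t \<subseteq> M" "range u \<subseteq> M"
    and "diverging_products v0 s t" "diverging_products v0 t u"
  shows "diverging_products v0 s u"
  unfolding diverging_products_def
proof
  fix C
  obtain N where N: "\<And>i j. i \<ge> N \<Longrightarrow> j \<ge> N \<Longrightarrow> C + \<delta> \<le> gromov_product v0 (s i) (t j)"
    using assms(4) unfolding diverging_products_def by blast
  obtain N' where N': "\<And>i j. i \<ge> N' \<Longrightarrow> j \<ge> N' \<Longrightarrow> C + \<delta> \<le> gromov_product v0 (t i) (u j)"
    using assms(5) unfolding diverging_products_def by blast
  define K where "K = max N N'"
  have "C \<le> gromov_product v0 (s i) (u j)" if "i \<ge> K" "j \<ge> K" for i j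
    using N[of i K] N'[of K j] hyp[OF base, of "s i" "t K" "u j"] assms(1-3) that
    by (force simp: K_def)
  then show "\<exists>N. \<forall>i\<ge>N. \<forall>j\<ge>N. C \<le> gromov_product v0 (s i) (u j)" by blast
qed

lemma diverging_products_sym: "diverging_products v0 s t \<Longrightarrow> diverging_products v0 t s"
  unfolding diverging_products_def using gromov_product_swap by metis

lemma equiv_gromov_equiv: "equiv gromov_sequences gromov_equiv"
proof (rule equivI)
  show "gromov_equiv \<subseteq> gromov_sequences \<times> gromov_sequences"
    unfolding gromov_equiv_def by blast
  show "refl_on gromov_sequences gromov_equiv"
    by (intro refl_onI) (auto simp: gromov_equiv_iff[OF base] gromov_sequences_iff[OF base])
  show "sym gromov_equiv"
    by (intro symI) (auto simp: gromov_equiv_iff[OF base] intro: diverging_products_sym)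
  show "trans gromov_equiv"
    by (intro transI)
      (auto simp: gromov_equiv_iff[OF base] gromov_sequences_iff[OF base]
        intro: diverging_products_trans)
qed

text \<open>Failure of divergence yields only some arbitrarily late pairs with product below
  \<open>C\<close>. Late points of one sequence have large mutual products, so \<open>hyp\<close>,
  used once in each variable, spreads the bound to all late pairs at cost
  \<open>2 * \<delta>\<close>.\<close>

lemma inequivalent_bounded:
  assumes "s \<in> gromov_sequences" "t \<in> gromov_sequences" "(s, t) \<notin> gromov_equiv"
  shows "\<exists>C N. \<forall>i\<ge>N. \<forall>j\<ge>N. gromov_product v0 (s i) (t j) \<le> C"
proof -
  have st: "range s \<subseteq> M" "range t \<subseteq> M" "diverging_products v0 s s" "diverging_products v0 t t"
    "\<not> diverging_products v0 s t"
    using assms by (auto simp: gromov_equiv_iff[OF base] gromov_sequences_iff[OF base])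
  obtain C where C: "\<And>N. \<exists>i\<ge>N. \<exists>j\<ge>N. gromov_product v0 (s i) (t j) < C"
    using st(5) unfolding diverging_products_def by (meson not_le)
  obtain N where N: "\<And>i j. i \<ge> N \<Longrightarrow> j \<ge> N \<Longrightarrow> C + 2 * \<delta> \<le> gromov_product v0 (s i) (s j)"
    using st(3) unfolding diverging_products_def by blast
  obtain N' where N': "\<And>i j. i \<ge> N' \<Longrightarrow> j \<ge> N' \<Longrightarrow> C + 2 * \<delta> \<le> gromov_product v0 (t i) (t j)"
    using st(4) unfolding diverging_products_def by blast
  define K where "K = max N N'"
  obtain i0 j0 where ij0: "i0 \<ge> K" "j0 \<ge> K" "gromov_product v0 (s i0) (t j0) < C" using C by blast
  have M: "s i \<in> M" "t i \<in> M" for i using st(1,2) by auto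
  have "gromov_product v0 (s i) (t j) \<le> C + 2 * \<delta>" if "i \<ge> K" "j \<ge> K" for i j
  proof (rule ccontr)
    assume *: "\<not> ?thesis"
    have "min (gromov_product v0 (s i) (t j)) (gromov_product v0 (t j) (t j0)) - \<delta> \<le> gromov_product v0 (s i) (t j0)"
      "min (gromov_product v0 (s i0) (s i)) (gromov_product v0 (s i) (t j0)) - \<delta> \<le> gromov_product v0 (s i0) (t j0)"
      by (intro hyp base M)+
    moreover have "C + 2 * \<delta> \<le> gromov_product v0 (t j) (t j0)" "C + 2 * \<delta> \<le> gromov_product v0 (s i0) (s i)"
      using N[of i0 i] N'[of j j0] that ij0 by (auto simp: K_def)
    ultimately show False using * ij0(3) orb.delta_nonneg by (auto simp: min_def split: if_splits)
  qed
  then show ?thesis by blast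
qed

lemma gromov_product_isom:
  "g \<in> carrier \<Gamma> \<Longrightarrow> w \<in> M \<Longrightarrow> x \<in> M \<Longrightarrow> y \<in> M \<Longrightarrow>
    gromov_product (\<alpha> g w) (\<alpha> g x) (\<alpha> g y) = gromov_product w x y"
  by (simp add: gromov_product_def isom)

lemma diverging_products_isom:
  assumes "g \<in> carrier \<Gamma>" "range s \<subseteq> M" "range t \<subseteq> M" "diverging_products v0 s t"
  shows "diverging_products v0 (\<alpha> g \<circ> s) (\<alpha> g \<circ> t)"
proof (rule diverging_products_basepoint)
  show "\<alpha> g v0 \<in> M" "v0 \<in> M" using assms maps base by auto
  show "range (\<alpha> g \<circ> s) \<subseteq> M" "range (\<alpha> g \<circ> t) \<subseteq> M" using assms maps by auto
  have "gromov_product (\<alpha> g v0) ((\<alpha> g \<circ> s) i) ((\<alpha> g \<circ> t) j) = gromov_product v0 (s i) (t j)" for i j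
    using assms base by (simp add: gromov_product_isom range_subsetD)
  then show "diverging_products (\<alpha> g v0) (\<alpha> g \<circ> s) (\<alpha> g \<circ> t)"
    using assms(4) by (simp add: diverging_products_def)
qed

lemma gromov_equiv_isom:
  assumes "g \<in> carrier \<Gamma>" "(s, t) \<in> gromov_equiv"
  shows "(\<alpha> g \<circ> s, \<alpha> g \<circ> t) \<in> gromov_equiv"
proof -
  have st: "range s \<subseteq> M" "range t \<subseteq> M" "diverging_products v0 s s" "diverging_products v0 t t" "diverging_products v0 s t"
    using assms by (auto simp: gromov_equiv_iff[OF base] gromov_sequences_iff[OF base])
  show ?thesis unfolding gromov_equiv_iff[OF base] gromov_sequences_iff[OF base]
    using st assms(1) maps
    by (intro conjI diverging_products_isom) auto
qed

lemma gromov_sequences_isom: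
  "g \<in> carrier \<Gamma> \<Longrightarrow> s \<in> gromov_sequences \<Longrightarrow> \<alpha> g \<circ> s \<in> gromov_sequences"
  using gromov_equiv_isom[of g s s] equiv_class_self[OF equiv_gromov_equiv, of s]
  unfolding gromov_equiv_def by blast

text \<open>\<open>boundary_map\<close> is an image of a set of sequences; pulling back by
  \<open>inv g\<close> shows that the image is a full class.\<close>

lemma boundary_map_class:
  assumes g: "g \<in> carrier \<Gamma>" and s: "s \<in> gromov_sequences"
  shows "boundary_map (\<alpha> g) (gromov_equiv `` {s}) = gromov_equiv `` {\<alpha> g \<circ> s}"
proof
  show "boundary_map (\<alpha> g) (gromov_equiv `` {s}) \<subseteq> gromov_equiv `` {\<alpha> g \<circ> s}"
    using gromov_equiv_isom[OF g] by (auto simp: boundary_map_def)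
  show "gromov_equiv `` {\<alpha> g \<circ> s} \<subseteq> boundary_map (\<alpha> g) (gromov_equiv `` {s})"
  proof
    fix t assume "t \<in> gromov_equiv `` {\<alpha> g \<circ> s}"
    then have t: "(\<alpha> g \<circ> s, t) \<in> gromov_equiv" by simp
    then have tM: "range t \<subseteq> M" by (auto simp: gromov_equiv_iff[OF base] gromov_sequences_iff[OF base])
    have sM: "range s \<subseteq> M" using s by (simp add: gromov_sequences_iff[OF base])
    have "(\<alpha> (inv g) \<circ> (\<alpha> g \<circ> s), \<alpha> (inv g) \<circ> t) \<in> gromov_equiv"
      using gromov_equiv_isom[OF _ t, of "inv g"] g by simp
    moreover have "\<alpha> (inv g) \<circ> (\<alpha> g \<circ> s) = s"
      using sM g by (auto simp: fun_eq_iff inv_maps range_subsetD)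
    moreover have "t = \<alpha> g \<circ> (\<alpha> (inv g) \<circ> t)"
      using tM g by (auto simp: fun_eq_iff maps_inv range_subsetD)
    ultimately show "t \<in> boundary_map (\<alpha> g) (gromov_equiv `` {s})"
      unfolding boundary_map_def by auto
  qed
qed

text \<open>As no boundary point is fixed, some \<open>h\<close> moves the class of
  \<open>s\<close>. As the resulting pair is not invariant either, some \<open>k\<close> moves one
  of its points outside the pair.\<close>

lemma three_translates:
  assumes nonel: "\<not> elementary (\<alpha> ` carrier \<Gamma>)" and s: "s \<in> gromov_sequences"
  shows "\<exists>a :: nat \<Rightarrow> 'g. (\<forall>i. a i \<in> carrier \<Gamma>) \<and>
    (\<forall>i<3. \<forall>j<3. i \<noteq> j \<longrightarrow> (\<alpha> (a i) \<circ> s, \<alpha> (a j) \<circ> s) \<notin> gromov_equiv)"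
proof -
  define \<xi> where "\<xi> g = gromov_equiv `` {\<alpha> g \<circ> s}" for g
  have sM: "range s \<subseteq> M" using s by (simp add: gromov_sequences_iff[OF base])
  have bd: "\<xi> g \<in> gromov_boundary" if "g \<in> carrier \<Gamma>" for g
    unfolding \<xi>_def gromov_boundary_def by (intro quotientI gromov_sequences_isom that s)
  have bm: "boundary_map (\<alpha> h) (\<xi> g) = \<xi> (h \<otimes> g)" if "g \<in> carrier \<Gamma>" "h \<in> carrier \<Gamma>" for g h
  proof -
    have "\<alpha> h \<circ> (\<alpha> g \<circ> s) = \<alpha> (h \<otimes> g) \<circ> s"
      using sM that by (auto simp: fun_eq_iff mult range_subsetD)
    then show ?thesis unfolding \<xi>_def using boundary_map_class[OF that(2) gromov_sequences_isom[OF that(1) s]] by simp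
  qed
  have shift: "\<xi> g = \<xi> h" if "\<xi> (k \<otimes> g) = \<xi> (k \<otimes> h)" "g \<in> carrier \<Gamma>" "h \<in> carrier \<Gamma>" "k \<in> carrier \<Gamma>" for g h k
    using bm[of "k \<otimes> g" "inv k"] bm[of "k \<otimes> h" "inv k"] that by (simp add: m_assoc[symmetric])
  note nonel' = nonel[unfolded elementary_def de_Morgan_disj, THEN conjunct2]
  have no_point: "\<not> (\<exists>\<xi>\<in>gromov_boundary. \<forall>h\<in>\<alpha> ` carrier \<Gamma>. boundary_map h \<xi> = \<xi>)"
    and no_pair: "\<not> (\<exists>P\<subseteq>gromov_boundary. card P = 2 \<and> (\<forall>h\<in>\<alpha> ` carrier \<Gamma>. boundary_map h ` P = P))"
    by (rule nonel'[THEN conjunct1], rule nonel'[THEN conjunct2])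
  obtain h where h: "h \<in> carrier \<Gamma>" "\<xi> h \<noteq> \<xi> \<one>"
  proof -
    have "\<exists>h\<in>carrier \<Gamma>. boundary_map (\<alpha> h) (\<xi> \<one>) \<noteq> \<xi> \<one>"
      using no_point bd[OF one_closed] by blast
    then show ?thesis using that bm[OF one_closed] by auto
  qed
  obtain k where k: "k \<in> carrier \<Gamma>" "\<xi> k \<noteq> \<xi> \<one>" "\<xi> k \<noteq> \<xi> h"
  proof -
    define P where "P = {\<xi> \<one>, \<xi> h}"
    have P: "card P = 2" "P \<subseteq> gromov_boundary" using h bd by (auto simp: P_def card_2_iff)
    have "\<exists>k\<in>carrier \<Gamma>. boundary_map (\<alpha> k) ` P \<noteq> P"
    proof (rule ccontr)
      assume "\<not> ?thesis"
      then have "\<forall>h\<in>\<alpha> ` carrier \<Gamma>. boundary_map h ` P = P" by simp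
      with P have "\<exists>P\<subseteq>gromov_boundary. card P = 2 \<and> (\<forall>h\<in>\<alpha> ` carrier \<Gamma>. boundary_map h ` P = P)"
        by (intro exI[of _ P] conjI)
      with no_pair show False by contradiction
    qed
    then obtain k where k: "k \<in> carrier \<Gamma>" "boundary_map (\<alpha> k) ` {\<xi> \<one>, \<xi> h} \<noteq> {\<xi> \<one>, \<xi> h}"
      unfolding P_def ..
    then have "{\<xi> k, \<xi> (k \<otimes> h)} \<noteq> {\<xi> \<one>, \<xi> h}" using h by (simp add: bm)
    \<comment> \<open>Two distinct classes inside the pair would exhaust it, so at least one of them
      lies outside.\<close>
    moreover have "\<xi> k \<noteq> \<xi> (k \<otimes> h)" using shift[of k \<one> h] h k by auto
    ultimately have "\<not> (\<xi> k \<in> {\<xi> \<one>, \<xi> h} \<and> \<xi> (k \<otimes> h) \<in> {\<xi> \<one>, \<xi> h})" by blast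
    then show ?thesis using that[of k] that[of "k \<otimes> h"] h k by auto
  qed
  define a where "a i = (if i = 0 then \<one> else if i = Suc 0 then h else k)" for i :: nat
  have "\<xi> (a i) \<noteq> \<xi> (a j)" if "i < 3" "j < 3" "i \<noteq> j" for i j
  proof -
    have "i \<in> {0, 1, 2}" "j \<in> {0, 1, 2}" using that by auto
    then show ?thesis using that(3) h k by (auto simp: a_def)
  qed
  then have "(\<alpha> (a i) \<circ> s, \<alpha> (a j) \<circ> s) \<notin> gromov_equiv" if "i < 3" "j < 3" "i \<noteq> j" for i j
    using that equiv_class_eq[OF equiv_gromov_equiv] unfolding \<xi>_def by blast
  then show ?thesis using h k by (intro exI[of _ a]) (simp add: a_def)
qed

text \<open>The bounds for single pairs are made uniform by maxima over the finitely many pairs of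
  indices. Both sides carry the same \<open>n\<close>, since later one far element is used in all
  three directions.\<close>

lemma three_translates_bounded:
  assumes nonel: "\<not> elementary (\<alpha> ` carrier \<Gamma>)"
    and h: "range h \<subseteq> carrier \<Gamma>" "(\<lambda>n. \<alpha> (h n) v0) \<in> gromov_sequences"
  shows "\<exists>(a :: nat \<Rightarrow> 'g) C N. (\<forall>i. a i \<in> carrier \<Gamma>) \<and>
    (\<forall>i<3. \<forall>j<3. \<forall>n\<ge>N. i \<noteq> j \<longrightarrow> orb.gp \<one> (a i \<otimes> h n) (a j \<otimes> h n) \<le> C)"
proof -
  let ?s = "\<lambda>n. \<alpha> (h n) v0"
  obtain a :: "nat \<Rightarrow> 'g" where *: "(\<forall>i. a i \<in> carrier \<Gamma>) \<and>
      (\<forall>i<3. \<forall>j<3. i \<noteq> j \<longrightarrow> (\<alpha> (a i) \<circ> ?s, \<alpha> (a j) \<circ> ?s) \<notin> gromov_equiv)"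
    using three_translates[OF nonel h(2)] ..
  then have a: "a i \<in> carrier \<Gamma>" for i by simp
  have "\<exists>C N. \<forall>n\<ge>N. orb.gp \<one> (a i \<otimes> h n) (a j \<otimes> h n) \<le> C" if ij: "i < 3" "j < 3" "i \<noteq> j" for i j
  proof -
    have equiv: "(\<alpha> (a i) \<circ> ?s, \<alpha> (a j) \<circ> ?s) \<notin> gromov_equiv" using * ij by simp
    obtain C N where "\<forall>m\<ge>N. \<forall>n\<ge>N. gromov_product v0 ((\<alpha> (a i) \<circ> ?s) m) ((\<alpha> (a j) \<circ> ?s) n) \<le> C"
      using inequivalent_bounded[OF gromov_sequences_isom[OF a h(2)] gromov_sequences_isom[OF a h(2)] equiv]
      by (elim exE)
    moreover have "h n \<in> carrier \<Gamma>" for n using h(1) by auto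
    ultimately show ?thesis using a by (intro exI[of _ C] exI[of _ N]) (auto simp: orb_gp mult base)
  qed
  then obtain C N where CN: "\<And>i j n. i < 3 \<Longrightarrow> j < 3 \<Longrightarrow> i \<noteq> j \<Longrightarrow> n \<ge> N i j \<Longrightarrow>
      orb.gp \<one> (a i \<otimes> h n) (a j \<otimes> h n) \<le> (C i j :: real)" by metis
  define P where "P = {..<3::nat} \<times> {..<3::nat}"
  have P: "finite P" by (simp add: P_def)
  show ?thesis
  proof (intro exI[of _ a] exI[of _ "Max ((\<lambda>(i, j). C i j) ` P)"]
      exI[of _ "Max ((\<lambda>(i, j). N i j) ` P)"] conjI allI impI)
    fix i j :: nat and n assume ij: "i < 3" "j < 3" and n: "Max ((\<lambda>(i, j). N i j) ` P) \<le> n" and ne: "i \<noteq> j"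
    have "(i, j) \<in> P" using ij by (simp add: P_def)
    then have "N i j \<le> Max ((\<lambda>(i, j). N i j) ` P)" "C i j \<le> Max ((\<lambda>(i, j). C i j) ` P)"
      using P by (force intro!: Max_ge)+
    then show "orb.gp \<one> (a i \<otimes> h n) (a j \<otimes> h n) \<le> Max ((\<lambda>(i, j). C i j) ` P)"
      using CN[OF ij ne, of n] n by linarith
  qed (rule a)
qed

text \<open>A bounded orbit would make the group finite by \<open>finite_orbit_ball\<close>; the
  orbit would then be a nonempty invariant finite, hence compact, set.\<close>

lemma unbounded_orbit:
  assumes nonel: "\<not> elementary (\<alpha> ` carrier \<Gamma>)"
  shows "\<exists>g\<in>carrier \<Gamma>. r < d v0 (\<alpha> g v0)"
proof (rule ccontr)
  assume "\<not> ?thesis"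
  then have "{g \<in> carrier \<Gamma>. d v0 (\<alpha> g v0) \<le> r} = carrier \<Gamma>" by force
  then have fin: "finite (carrier \<Gamma>)" using finite_orbit_ball[of r] by simp
  define K where "K = (\<lambda>g. \<alpha> g v0) ` carrier \<Gamma>"
  have "compactin mtopology K"
    unfolding K_def using fin maps base by (intro finite_imp_compactin) auto
  moreover have "K \<noteq> {}" using one_closed by (auto simp: K_def)
  moreover have "\<alpha> g ` K = K" if g: "g \<in> carrier \<Gamma>" for g
  proof
    show "\<alpha> g ` K \<subseteq> K" using g base by (auto simp: K_def mult[symmetric])
    show "K \<subseteq> \<alpha> g ` K"
    proof
      fix x assume "x \<in> K"
      then obtain k where k: "k \<in> carrier \<Gamma>" "x = \<alpha> k v0" by (auto simp: K_def)
      then have "x = \<alpha> g (\<alpha> (inv g \<otimes> k) v0)" using g base by (simp add: mult[symmetric] m_assoc[symmetric])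
      then show "x \<in> \<alpha> g ` K" unfolding K_def using g k by auto
    qed
  qed
  ultimately have "\<exists>K. K \<noteq> {} \<and> compactin mtopology K \<and> (\<forall>h\<in>\<alpha> ` carrier \<Gamma>. h ` K = K)"
    by (intro exI[of _ K]) simp
  with nonel[unfolded elementary_def de_Morgan_disj, THEN conjunct1] show False by contradiction
qed

text \<open>Two extractions make both \<open>h n\<close> and \<open>inv (h n)\<close> converge at
  infinity. The \<open>a i\<close> spread the forward limit and the \<open>b i\<close> the backward
  limit into three directions. The factor \<open>inv (b i)\<close> displaces the endpoint of
  \<open>a i \<otimes> h n\<close> only boundedly, and \<open>inv (s i)\<close> behaves
  symmetrically.\<close>

lemma exists_alternating_free:
  assumes nonel: "\<not> elementary (\<alpha> ` carrier \<Gamma>)"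
  shows "\<exists>s T. alternating_free \<Gamma> orbit_dist \<delta> s T"
proof -
  have "\<forall>n. \<exists>g. g \<in> carrier \<Gamma> \<and> real n < d v0 (\<alpha> g v0)"
    using unbounded_orbit[OF nonel] by blast
  from choice[OF this] obtain g where "\<forall>n. g n \<in> carrier \<Gamma> \<and> real n < d v0 (\<alpha> (g n) v0)" ..
  then have g: "g n \<in> carrier \<Gamma>" "real n < d v0 (\<alpha> (g n) v0)" for n by simp_all
  have "\<exists>\<sigma>. strict_mono \<sigma> \<and> (\<lambda>n. \<alpha> (g (\<sigma> n)) v0) \<in> gromov_sequences"
    by (rule convergent_subseq) (use g less_imp_le[OF g(2)] in auto)
  then obtain r where r: "strict_mono r" "(\<lambda>n. \<alpha> (g (r n)) v0) \<in> gromov_sequences" by (elim exE conjE)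
  have norm_inv: "d v0 (\<alpha> (inv x) v0) = d v0 (\<alpha> x v0)" if "x \<in> carrier \<Gamma>" for x
    using orb.dist_one_inv[OF that] that by (simp add: orbit_dist unit base)
  have inv_long: "real n \<le> d v0 (\<alpha> (inv (g (r n))) v0)" for n
    using g(2)[of "r n"] seq_suble[OF r(1), of n] g(1) by (simp add: norm_inv)
  have "\<exists>\<sigma>. strict_mono \<sigma> \<and> (\<lambda>n. \<alpha> (inv (g (r (\<sigma> n)))) v0) \<in> gromov_sequences"
    by (rule convergent_subseq[of "\<lambda>n. inv (g (r n))"]) (use g inv_long in auto)
  then obtain r' where r': "strict_mono r'" "(\<lambda>n. \<alpha> (inv (g (r (r' n)))) v0) \<in> gromov_sequences"
    by (elim exE conjE)
  define h where "h n = g (r (r' n))" for n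
  have h: "h n \<in> carrier \<Gamma>" for n by (simp add: h_def g)
  have h_long: "real n \<le> orbit_dist \<one> (h n)" for n
  proof -
    have "n \<le> r (r' n)" using seq_suble[OF r(1)] seq_suble[OF r'(1)] order_trans by blast
    then show ?thesis using g(2)[of "r (r' n)"] g(1) by (simp add: h_def orbit_dist unit base)
  qed
  have fwd: "(\<lambda>n. \<alpha> (h n) v0) \<in> gromov_sequences"
    using gromov_sequences_subseq[OF r(2) r'(1)] by (simp add: h_def comp_def)
  have bwd: "(\<lambda>n. \<alpha> (inv (h n)) v0) \<in> gromov_sequences" using r'(2) by (simp add: h_def)
  have "range h \<subseteq> carrier \<Gamma>" "range (\<lambda>n. inv (h n)) \<subseteq> carrier \<Gamma>" using h by auto
  note bounded = three_translates_bounded[OF nonel this(1) fwd] three_translates_bounded[OF nonel this(2) bwd]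
  obtain a :: "nat \<Rightarrow> 'g" and A N where a': "(\<forall>i. a i \<in> carrier \<Gamma>) \<and>
      (\<forall>i<3. \<forall>j<3. \<forall>n\<ge>N. i \<noteq> j \<longrightarrow> orb.gp \<one> (a i \<otimes> h n) (a j \<otimes> h n) \<le> A)"
    using bounded(1) by (elim exE)
  obtain b :: "nat \<Rightarrow> 'g" and B N' where b': "(\<forall>i. b i \<in> carrier \<Gamma>) \<and>
      (\<forall>i<3. \<forall>j<3. \<forall>n\<ge>N'. i \<noteq> j \<longrightarrow> orb.gp \<one> (b i \<otimes> inv (h n)) (b j \<otimes> inv (h n)) \<le> B)"
    using bounded(2) by (elim exE)
  have a: "a i \<in> carrier \<Gamma>" "b i \<in> carrier \<Gamma>" for i using a' b' by simp_all
  define C where "C = (\<Sum>i<3. orbit_dist \<one> (a i)) + (\<Sum>i<3. orbit_dist \<one> (b i))"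
  have aC: "orbit_dist \<one> (a i) \<le> C" and bC: "orbit_dist \<one> (b i) \<le> C" if "i < 3" for i
  proof -
    have "orbit_dist \<one> (a i) \<le> (\<Sum>i<3. orbit_dist \<one> (a i))" "orbit_dist \<one> (b i) \<le> (\<Sum>i<3. orbit_dist \<one> (b i))"
      using that by (auto intro!: member_le_sum orb.d_nonneg)
    moreover have "0 \<le> (\<Sum>i<3. orbit_dist \<one> (a i))" "0 \<le> (\<Sum>i<3. orbit_dist \<one> (b i))"
      by (auto intro!: sum_nonneg orb.d_nonneg)
    ultimately show "orbit_dist \<one> (a i) \<le> C" "orbit_dist \<one> (b i) \<le> C" by (auto simp: C_def)
  qed
  \<comment> \<open>Each of the two points in a product is displaced by at most
    \<open>C\<close>.\<close>
  define T where "T = max A B + 2 * C"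
  \<comment> \<open>The extra \<open>2 * C\<close> covers the length that \<open>s i\<close> may
    lose against \<open>h n\<close> through \<open>a i\<close> and \<open>b i\<close>.\<close>
  obtain n where n: "n \<ge> N" "n \<ge> N'" "2 * T + 3 * \<delta> + 2 * C < real n"
  proof -
    obtain m :: nat where "2 * T + 3 * \<delta> + 2 * C < real m" using reals_Archimedean2 by blast
    then show ?thesis using that[of "max m (max N N')"] by simp
  qed
  have tail: "orbit_dist (x \<otimes> inv y) x = orbit_dist \<one> y" if "x \<in> carrier \<Gamma>" "y \<in> carrier \<Gamma>" for x y
    using that orb.left_invariant[of x "inv y" \<one>] orb.dist_one_inv[of y] by (simp add: orb.d_sym)
  define s where "s i = a i \<otimes> h n \<otimes> inv (b i)" for i
  have s_inv: "inv (s i) = b i \<otimes> inv (h n) \<otimes> inv (a i)" for i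
    using a h by (simp add: s_def inv_mult_group m_assoc)
  have "alternating_free \<Gamma> orbit_dist \<delta> s T"
  proof
    fix i j :: nat assume ij: "i < 3" "j < 3" "i \<noteq> j"
    have "orb.gp \<one> (a i \<otimes> h n) (a j \<otimes> h n) \<le> A"
      "orb.gp \<one> (b i \<otimes> inv (h n)) (b j \<otimes> inv (h n)) \<le> B"
      using a' b' ij n by blast+
    note turn = this
    have "orb.gp \<one> (s i) (s j) \<le> orb.gp \<one> (a i \<otimes> h n) (a j \<otimes> h n) +
        orbit_dist (s i) (a i \<otimes> h n) + orbit_dist (s j) (a j \<otimes> h n)" by (rule orb.gp_perturb)
    also have "\<dots> \<le> A + C + C"
      using turn bC[OF ij(1)] bC[OF ij(2)] a h by (simp add: s_def tail)
    also have "\<dots> \<le> T" by (simp add: T_def)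
    finally show "orb.gp \<one> (s i) (s j) \<le> T" .
    have "orb.gp \<one> (inv (s i)) (inv (s j)) \<le> orb.gp \<one> (b i \<otimes> inv (h n)) (b j \<otimes> inv (h n)) +
        orbit_dist (inv (s i)) (b i \<otimes> inv (h n)) + orbit_dist (inv (s j)) (b j \<otimes> inv (h n))" by (rule orb.gp_perturb)
    also have "\<dots> \<le> B + C + C"
      using turn aC[OF ij(1)] aC[OF ij(2)] a h by (simp add: s_inv tail)
    also have "\<dots> \<le> T" by (simp add: T_def)
    finally show "orb.gp \<one> (inv (s i)) (inv (s j)) \<le> T" .
  next
    fix i :: nat assume i: "i < 3"
    show "s i \<in> carrier \<Gamma>" using a h by (simp add: s_def)
    have "orbit_dist (a i) (a i \<otimes> h n) \<le> orbit_dist (a i) \<one> + orbit_dist \<one> (s i) + orbit_dist (s i) (a i \<otimes> h n)"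
      using orb.d_triangle[of "a i" "a i \<otimes> h n" \<one>] orb.d_triangle[of \<one> "a i \<otimes> h n" "s i"] by simp
    moreover have "orbit_dist (a i) (a i \<otimes> h n) = orbit_dist \<one> (h n)"
      using orb.left_invariant[of "a i" \<one> "h n"] a h by simp
    moreover have "orbit_dist (s i) (a i \<otimes> h n) = orbit_dist \<one> (b i)" using a h by (simp add: s_def tail)
    ultimately show "2 * T + 3 * \<delta> < orbit_dist \<one> (s i)"
      using h_long[of n] n(3) aC[OF i] bC[OF i] orb.d_sym[of "a i" \<one>] by linarith
  qed
  then show ?thesis by blast
qed

end

subsection \<open>Vertices of a graph in its path metric\<close>

context bidirected_digraph
begin

lemma path_metric_le:
  assumes "x \<in> realization G arev" "y \<in> realization G arev" "pl_path G arev x ps y"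
  shows "path_metric G arev x y \<le> pl_length ps"
proof -
  have "bdd_below {pl_length ps | ps. pl_path G arev x ps y}"
    using pl_length_nonneg by (intro bdd_belowI[of _ 0]) auto
  then show ?thesis unfolding path_metric_def using assms by (auto intro!: cInf_lower)
qed

lemma le_path_metric:
  assumes "connected G" "x \<in> realization G arev" "y \<in> realization G arev"
    and "\<And>ps. pl_path G arev x ps y \<Longrightarrow> r \<le> pl_length ps"
  shows "r \<le> path_metric G arev x y"
proof -
  have "{pl_length ps | ps. pl_path G arev x ps y} \<noteq> {}" using path_exists[OF assms(1-3)] by blast
  then have "r \<le> Inf {pl_length ps | ps. pl_path G arev x ps y}"
    by (rule cInf_greatest) (use assms(4) in blast)
  then show ?thesis unfolding path_metric_def using assms(2,3) by simp
qed

text \<open>Balls are grown arc by arc, so that finiteness and equivariance follow by induction on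
  the radius.\<close>

primrec vball :: "'a \<Rightarrow> nat \<Rightarrow> 'a set" where
  "vball u 0 = {u}"
| "vball u (Suc n) = vball u n \<union> head G ` {e \<in> arcs G. tail G e \<in> vball u n}"

lemma vball_subset: "u \<in> verts G \<Longrightarrow> vball u n \<subseteq> verts G"
  by (induction n) auto

lemma vball_mono: "m \<le> n \<Longrightarrow> vball u m \<subseteq> vball u n"
  by (rule lift_Suc_mono_le[of "vball u"]) auto

lemma center_in_vball: "u \<in> vball u n"
  using vball_mono[of 0 n u] by auto

lemma vball_trans: "w \<in> vball u m \<Longrightarrow> v \<in> vball w k \<Longrightarrow> v \<in> vball u (m + k)"
  by (induction k arbitrary: v) auto

lemma vball_split: "v \<in> vball u (m + k) \<Longrightarrow> \<exists>w\<in>vball u m. v \<in> vball w k"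
proof (induction k arbitrary: v)
  case (Suc k)
  then consider "v \<in> vball u (m + k)" | e where "e \<in> arcs G" "tail G e \<in> vball u (m + k)" "v = head G e"
    by auto
  then show ?case
  proof cases
    case 1
    then show ?thesis using Suc.IH by auto
  next
    case 2
    then obtain w where "w \<in> vball u m" "tail G e \<in> vball w k" using Suc.IH by blast
    then show ?thesis using 2 by auto
  qed
qed simp

lemma finite_arcs_from:
  assumes "bounded_valency G" "finite V" "V \<subseteq> verts G"
  shows "finite {e \<in> arcs G. tail G e \<in> V}"
proof -
  have "{e \<in> arcs G. tail G e \<in> V} = (\<Union>v\<in>V. out_arcs G v)" by auto
  then show ?thesis using assms by (auto simp: bounded_valency_def subset_iff)
qed

lemma finite_vball:
  assumes "bounded_valency G" "u \<in> verts G"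
  shows "finite (vball u n)"
proof (induction n)
  case (Suc n)
  then show ?case using finite_arcs_from[OF assms(1) Suc vball_subset[OF assms(2)]] by simp
qed simp

lemma vball_exhaust:
  assumes "connected G" "u \<in> verts G" "v \<in> verts G"
  shows "\<exists>n. v \<in> vball u n"
proof -
  have "strongly_connected G"
    using assms(1) by (simp add: symmetric_connected_imp_strongly_connected sym_arcs)
  then have "u \<rightarrow>\<^sup>*\<^bsub>G\<^esub> v" using assms by (auto simp: strongly_connected_def)
  then show ?thesis
  proof (induction rule: reachable_induct)
    case base
    then show ?case using center_in_vball by blast
  next
    case (step x y)
    then obtain n e where "x \<in> vball u n" "e \<in> arcs G" "tail G e = x" "head G e = y" by auto
    then have "y \<in> vball u (Suc n)" by auto
    then show ?case by blast
  qed
qed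

lemma vball_path:
  assumes "u \<in> verts G" "v \<in> vball u n"
  shows "\<exists>ps. pl_path G arev (Inl u) ps (Inl v) \<and> pl_length ps \<le> n"
  using assms(2)
proof (induction n arbitrary: v)
  case 0
  then show ?case by (intro exI[of _ "[]"]) (simp add: pl_length_def)
next
  case (Suc n)
  then consider "v \<in> vball u n" | e where "e \<in> arcs G" "tail G e \<in> vball u n" "v = head G e"
    by auto
  then show ?case
  proof cases
    case 1
    then show ?thesis using Suc.IH by force
  next
    case 2
    then obtain ps where ps: "pl_path G arev (Inl u) ps (Inl (tail G e))" "pl_length ps \<le> n"
      using Suc.IH by blast
    have "pl_path G arev (Inl (tail G e)) [(e, 0, 1)] (Inl v)"
      using 2 by (simp add: edge_point_def)
    from pl_path_append[OF ps(1) this] show ?thesis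
      using ps(2) by (intro exI[of _ "ps @ [(e, 0, 1)]"]) (simp add: pl_length_append pl_length_def)
  qed
qed

lemma path_metric_vball:
  assumes "u \<in> verts G" "v \<in> vball u n"
  shows "path_metric G arev (Inl u) (Inl v) \<le> n"
proof -
  obtain ps where "pl_path G arev (Inl u) ps (Inl v)" "pl_length ps \<le> n"
    using vball_path[OF assms] by blast
  moreover have "v \<in> verts G" using vball_subset[OF assms(1)] assms(2) by blast
  ultimately show ?thesis using path_metric_le[of "Inl u" "Inl v" ps] assms(1) vertex_point_in by force
qed

definition vdist :: "'a \<Rightarrow> 'a \<Rightarrow> nat" where
  "vdist u v = (LEAST n. v \<in> vball u n)"

lemma vdist_vball:
  assumes "connected G" "u \<in> verts G" "v \<in> verts G"
  shows "v \<in> vball u n \<longleftrightarrow> vdist u v \<le> n"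
proof
  show "vdist u v \<le> n" if "v \<in> vball u n" unfolding vdist_def using that by (rule Least_le)
  have "v \<in> vball u (vdist u v)"
    unfolding vdist_def using vball_exhaust[OF assms] by (rule LeastI_ex)
  then show "v \<in> vball u n" if "vdist u v \<le> n" using vball_mono[OF that] by blast
qed

lemma vdist_arc:
  assumes "connected G" "u \<in> verts G" "e \<in> arcs G"
  shows "vdist u (head G e) \<le> Suc (vdist u (tail G e))"
proof -
  have "tail G e \<in> vball u (vdist u (tail G e))" using vdist_vball assms by simp
  then have "head G e \<in> vball u (Suc (vdist u (tail G e)))" using assms(3) by auto
  moreover have "head G e \<in> verts G" using assms(3) by simp
  ultimately show ?thesis by (simp only: vdist_vball[OF assms(1,2)])
qed

text \<open>\<open>F\<close> extends the combinatorial distance from \<open>u\<close> over the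
  edges. The minimum over both ends respects the identification of an arc with its reverse,
  \<open>vdist_arc\<close> makes it agree with the values at vertices, and it is 1-Lipschitz along
  each arc, so \<open>lipschitz_path\<close> applies.\<close>

lemma edge_point_far:
  fixes t :: real
  assumes con: "connected G" and u: "u \<in> verts G" and e: "e \<in> arcs G" and t: "t \<in> {0..1}"
  shows "min (t + vdist u (tail G e)) (1 - t + vdist u (head G e)) \<le>
    path_metric G arev (Inl u) (edge_point G arev e t)"
proof -
  define F :: "('a, 'b) graph_point \<Rightarrow> real" where
    "F z = (case z of Inl v \<Rightarrow> vdist u v
      | Inr c \<Rightarrow> Min ((\<lambda>(e, t). t + vdist u (tail G e)) ` c))" for z
  have Fe: "F (edge_point G arev e t) = min (t + vdist u (tail G e)) (1 - t + vdist u (head G e))"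
    if "e \<in> arcs G" "t \<in> {0..1}" for e t
    using that vdist_arc[OF con u, of e] vdist_arc[OF con u, of "arev e"]
    by (auto simp: F_def edge_point_def min_def)
  have "F (Inl u) = 0"
    using vdist_vball[OF con u u, of 0] by (simp add: F_def)
  moreover have "F (edge_point G arev e t) - F (Inl u) \<le> pl_length ps"
    if "pl_path G arev (Inl u) ps (edge_point G arev e t)" for ps
  proof (rule lipschitz_path[OF that])
    fix e s t assume "e \<in> arcs G" "s \<in> {0..1::real}" "t \<in> {0..1::real}"
    moreover have "min (t + a) (1 - t + b) - min (s + a) (1 - s + b) \<le> \<bar>s - t\<bar>" for a b :: real
      by linarith
    ultimately show "F (edge_point G arev e t) - F (edge_point G arev e s) \<le> \<bar>s - t\<bar>"
      by (simp add: Fe)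
  qed
  ultimately have "F (edge_point G arev e t) \<le> path_metric G arev (Inl u) (edge_point G arev e t)"
    using e t u by (intro le_path_metric con vertex_point_in edge_point_in) simp_all
  then show ?thesis using e t by (simp add: Fe)
qed

text \<open>A vertex other than \<open>u\<close> is the head of an arc by connectedness, that is,
  its edge point with parameter 1.\<close>

lemma vertex_far:
  assumes con: "connected G" and u: "u \<in> verts G" and v: "v \<in> verts G"
  shows "vdist u v \<le> path_metric G arev (Inl u) (Inl v)"
proof (cases "v = u")
  case True
  then show ?thesis using vdist_vball[OF con u u, of 0] Metric_space.nonneg[OF Metric_space_realization[OF con]] by simp
next
  case False
  obtain n where "v \<in> vball u n" using vball_exhaust[OF assms] by blast
  then have "\<exists>e\<in>arcs G. v = head G e" using False by (induction n) auto
  then obtain e where e: "e \<in> arcs G" "v = head G e" by blast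
  have "min (1 + real (vdist u (tail G e))) (vdist u v) = vdist u v"
    using vdist_arc[OF con u e(1)] e(2) by simp
  then show ?thesis using edge_point_far[OF con u e(1), of 1] e(2) by (simp add: edge_point_def)
qed

text \<open>\<open>w\<close> is the vertex at step \<open>R\<close> of a shortest path from
  \<open>u\<close> to \<open>v\<close>.\<close>

lemma interpolate:
  assumes con: "connected G" and u: "u \<in> verts G" and v: "v \<in> verts G"
    and R: "R \<le> path_metric G arev (Inl u) (Inl v)"
  shows "\<exists>w\<in>vball u R. R \<le> Metric_space.gromov_product (path_metric G arev) (Inl u) (Inl w) (Inl v)"
proof -
  interpret Metric_space "realization G arev" "path_metric G arev"
    by (rule Metric_space_realization[OF con])
  have "v \<in> vball u (vdist u v)" using vdist_vball[OF con u v] by simp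
  then have "R \<le> vdist u v" using R path_metric_vball[OF u, of v "vdist u v"] by simp
  then have "v \<in> vball u (R + (vdist u v - R))" using \<open>v \<in> vball u (vdist u v)\<close> by simp
  then obtain w where w: "w \<in> vball u R" "v \<in> vball w (vdist u v - R)" using vball_split by blast
  have wv: "w \<in> verts G" using w(1) vball_subset[OF u] by blast
  have "path_metric G arev (Inl w) (Inl v) \<le> vdist u v - R" using path_metric_vball[OF wv w(2)] .
  moreover have "real (vdist u v) \<le> path_metric G arev (Inl u) (Inl v)" by (rule vertex_far[OF con u v])
  moreover have "path_metric G arev (Inl u) (Inl v) \<le> path_metric G arev (Inl u) (Inl w) + path_metric G arev (Inl w) (Inl v)"
    by (intro triangle vertex_point_in u v wv)
  ultimately have "R \<le> gromov_product (Inl u) (Inl w) (Inl v)"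
    unfolding gromov_product_def commute[of "Inl w" "Inl u"] commute[of "Inl v" "Inl u"]
    using \<open>R \<le> vdist u v\<close> by (simp add: of_nat_diff)
  then show ?thesis using w(1) by blast
qed

end

section \<open>Properness and finiteness of orbit balls\<close>

context graph_action
begin

lemma vball_equivariant:
  assumes "g \<in> carrier \<Gamma>" "u \<in> verts G"
  shows "v \<in> vball u n \<Longrightarrow> \<phi> g v \<in> vball (\<phi> g u) n"
proof (induction n arbitrary: v)
  case (Suc n)
  then consider "v \<in> vball u n" | e where "e \<in> arcs G" "tail G e \<in> vball u n" "v = head G e"
    by auto
  then show ?case
  proof cases
    case 2
    then have "\<psi> g e \<in> arcs G" "tail G (\<psi> g e) \<in> vball (\<phi> g u) n" "\<phi> g v = head G (\<psi> g e)"
      using Suc.IH assms by (simp_all add: arc_closed tail_act head_act)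
    then show ?thesis by auto
  qed (use Suc.IH in auto)
qed simp

text \<open>Arcs are included because, with loops and multiple edges, an automorphism may fix all
  vertices and still move the realization.\<close>

definition fixers :: "'a \<Rightarrow> nat \<Rightarrow> 'g set" where
  "fixers u n = {g \<in> carrier \<Gamma>. (\<forall>v\<in>vball u n. \<phi> g v = v) \<and>
     (\<forall>e\<in>arcs G. tail G e \<in> vball u n \<longrightarrow> \<psi> g e = e)}"

lemma fixers_mono: "m \<le> n \<Longrightarrow> fixers u n \<subseteq> fixers u m"
  using vball_mono[of m n u] unfolding fixers_def by blast

text \<open>A point within \<open>n\<close> of \<open>u\<close> is a vertex of the ball or lies on
  an edge with an end in it; thus the arc or its reverse starts in the ball and is fixed.\<close>

lemma fixers_act:
  assumes con: "connected G" and u: "u \<in> verts G" and g: "g \<in> fixers u n"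
    and x: "x \<in> realization G arev" and r: "path_metric G arev (Inl u) x \<le> n"
  shows "act g x = x"
proof -
  have gc: "g \<in> carrier \<Gamma>" using g by (simp add: fixers_def)
  show ?thesis
    using x
  proof (cases rule: realization_cases)
    case (v v)
    then have "v \<in> vball u n"
      using vertex_far[OF con u v(1)] r vdist_vball[OF con u v(1), of n] by simp
    then show ?thesis using g v by (simp add: act_vert fixers_def)
  next
    case (e e t)
    have "min (t + vdist u (tail G e)) (1 - t + vdist u (head G e)) \<le> n"
      using edge_point_far[OF con u e(1,2)] r e(3) by simp
    then have "vdist u (tail G e) \<le> n \<or> vdist u (head G e) \<le> n"
      using e(2) by (auto simp: min_def split: if_splits)
    then have "tail G e \<in> vball u n \<or> tail G (arev e) \<in> vball u n"
      using e(1) vdist_vball[OF con u] by simp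
    then have "\<psi> g e = e"
    proof
      assume "tail G (arev e) \<in> vball u n"
      then have "\<psi> g (arev e) = arev e" using g e(1) by (simp add: fixers_def)
      then have "arev (\<psi> g e) = arev e" using arev_act[OF gc e(1)] by simp
      then show ?thesis by (simp add: arev_eq_iff)
    qed (use g e(1) in \<open>simp add: fixers_def\<close>)
    then show ?thesis using act_edge_point[OF gc e(1,2)] e(3) by simp
  qed
qed

text \<open>In the compact-open topology every neighbourhood of the identity contains the images of
  \<open>fixers u n\<close> for large \<open>n\<close>, since compact sets are bounded. Discreteness
  gives a neighbourhood meeting the image of the group only in the identity.\<close>

lemma fixers_in_kernel:
  assumes con: "connected G" and u: "u \<in> verts G"
    and proper: "Metric_space.proper_action (realization G arev) (path_metric G arev) \<Gamma> act"
  shows "\<exists>n. fixers u n \<subseteq>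
    kernel \<Gamma> (Metric_space.isometry_group (realization G arev) (path_metric G arev)) act"
proof -
  interpret Metric_space "realization G arev" "path_metric G arev"
    by (rule Metric_space_realization[OF con])
  interpret group \<Gamma> using edge.group_hom by (simp add: group_hom_def)
  interpret hom: group_hom \<Gamma> isometry_group act
    using hom_realization_action[OF con] group_isometry_group
    by (simp add: group_hom_def group_hom_axioms_def is_group)
  let ?one = "act \<one>\<^bsub>\<Gamma>\<^esub>"
  have iso: "act g \<in> carrier isometry_group" if "g \<in> carrier \<Gamma>" for g
    using that by (rule hom.hom_closed)
  \<comment> \<open>Proved by induction on the generation of the topology; finite intersections are
    the reason for \<open>fixers_mono\<close>.\<close>
  have nbhd: "?one \<in> U \<Longrightarrow> \<exists>n. \<forall>g\<in>fixers u n. act g \<in> U"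
    if "openin isometry_topology U" for U
  proof -
    have "generate_topology_on {{f \<in> carrier isometry_group. f ` K \<subseteq> U} | K U. compactin mtopology K \<and> openin mtopology U} U"
      using that unfolding isometry_topology_def openin_topology_generated_by_iff .
    then show "?one \<in> U \<Longrightarrow> ?thesis"
    proof (induction rule: generate_topology_on.induct)
      case (Int a b)
      then obtain m n where "\<forall>g\<in>fixers u m. act g \<in> a" "\<forall>g\<in>fixers u n. act g \<in> b" by blast
      then show ?case using fixers_mono[of m "max m n" u] fixers_mono[of n "max m n" u]
        by (intro exI[of _ "max m n"]) auto
    next
      case (UN K)
      then show ?case by blast
    next
      case (Basis s)
      then obtain K V where KV: "s = {f \<in> carrier isometry_group. f ` K \<subseteq> V}" "compactin mtopology K"
        by blast
      have KM: "K \<subseteq> realization G arev" using compactin_subset_topspace[OF KV(2)] by simp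
      obtain B where B: "\<And>x. x \<in> K \<Longrightarrow> path_metric G arev (Inl u) x \<le> B"
      proof -
        obtain y B where yB: "K \<subseteq> mcball y B"
          using compactin_imp_mbounded[OF KV(2)] unfolding mbounded_def by blast
        have "path_metric G arev (Inl u) x \<le> path_metric G arev (Inl u) y + B" if "x \<in> K" for x
          using yB that triangle[of "Inl u" y x] vertex_point_in[OF u] by force
        then show ?thesis by (rule that)
      qed
      define n where "n = nat \<lceil>B\<rceil>"
      have "act g \<in> s" if g: "g \<in> fixers u n" for g
      proof -
        have "act g x = ?one x" if "x \<in> K" for x
        proof -
          have "path_metric G arev (Inl u) x \<le> n" using B[OF that] unfolding n_def by linarith
          then show ?thesis using fixers_act[OF con u g, of x] act_one[of x] KM that by auto
        qed
        then have "act g ` K = ?one ` K" by (rule image_cong[OF refl])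
        then show ?thesis using Basis.prems g iso[of g] unfolding KV(1) fixers_def by simp
      qed
      then show ?case by blast
    qed simp
  qed
  have "openin (subtopology isometry_topology (act ` carrier \<Gamma>)) {?one}"
  proof -
    have "?one \<in> act ` carrier \<Gamma>" by blast
    then show ?thesis using proper unfolding proper_action_def by (simp del: hom.hom_one)
  qed
  then obtain U where U: "openin isometry_topology U" "{?one} = U \<inter> act ` carrier \<Gamma>"
    unfolding openin_subtopology by blast
  then obtain n where n: "\<forall>g\<in>fixers u n. act g \<in> U" using nbhd[OF U(1)] by blast
  have "g \<in> kernel \<Gamma> isometry_group act" if g: "g \<in> fixers u n" for g
  proof -
    have "g \<in> carrier \<Gamma>" using g by (simp add: fixers_def)
    then have "act g = ?one" using U(2) n g by blast
    also have "?one = \<one>\<^bsub>isometry_group\<^esub>" by (rule hom.hom_one)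
    finally show ?thesis using \<open>g \<in> carrier \<Gamma>\<close> by (simp add: kernel_def)
  qed
  then show ?thesis by blast
qed

text \<open>An element of bounded displacement maps a fixed finite ball with its arcs into a larger
  finite ball, so only finitely many restrictions \<open>\<Phi> g\<close> occur. Two elements with
  the same restriction differ by an element of \<open>fixers u n\<close>, hence of the finite
  kernel.\<close>

lemma finite_orbit_ball_graph:
  assumes con: "connected G" and val: "bounded_valency G" and u: "u \<in> verts G"
    and proper: "Metric_space.proper_action (realization G arev) (path_metric G arev) \<Gamma> act"
  shows "finite {g \<in> carrier \<Gamma>. path_metric G arev (Inl u) (act g (Inl u)) \<le> r}" (is "finite ?S")
proof -
  interpret Metric_space "realization G arev" "path_metric G arev"
    by (rule Metric_space_realization[OF con])
  interpret group \<Gamma> using edge.group_hom by (simp add: group_hom_def)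
  obtain n where n: "fixers u n \<subseteq> kernel \<Gamma> isometry_group act"
    using fixers_in_kernel[OF con u proper] by blast
  have fin_ker: "finite (kernel \<Gamma> isometry_group act)" using proper unfolding proper_action_def by blast
  define R where "R = nat \<lfloor>r\<rfloor>"
  define A where "A k = {e \<in> arcs G. tail G e \<in> vball u k}" for k
  have fin: "finite (vball u k)" "finite (A k)" for k
    using finite_vball[OF val u] finite_arcs_from[OF val _ vball_subset[OF u]] by (auto simp: A_def)
  define \<Phi> where "\<Phi> g = (restrict (\<phi> g) (vball u n), restrict (\<psi> g) (A n))" for g
  have move: "\<phi> g v \<in> vball u (R + n)" if "g \<in> ?S" "v \<in> vball u n" for g v
  proof -
    have g: "g \<in> carrier \<Gamma>" "path_metric G arev (Inl u) (Inl (\<phi> g u)) \<le> r"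
      using that(1) u by (simp_all add: act_vert)
    have gu: "\<phi> g u \<in> verts G" using g(1) u by (rule vert_closed)
    have "vdist u (\<phi> g u) \<le> R" using vertex_far[OF con u gu] g(2) by (simp add: R_def le_nat_floor)
    then have "\<phi> g u \<in> vball u R" using vdist_vball[OF con u gu] by simp
    then show ?thesis using vball_equivariant[OF g(1) u that(2)] by (rule vball_trans)
  qed
  have "\<Phi> ` ?S \<subseteq> (vball u n \<rightarrow>\<^sub>E vball u (R + n)) \<times> (A n \<rightarrow>\<^sub>E A (R + n))"
  proof
    fix z assume "z \<in> \<Phi> ` ?S"
    then obtain g where g: "g \<in> ?S" "z = \<Phi> g" by blast
    have "\<psi> g e \<in> A (R + n)" if "e \<in> A n" for e
      using move[OF g(1), of "tail G e"] that g(1) by (simp add: A_def arc_closed tail_act)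
    then show "z \<in> (vball u n \<rightarrow>\<^sub>E vball u (R + n)) \<times> (A n \<rightarrow>\<^sub>E A (R + n))"
      using move[OF g(1)] unfolding g(2) \<Phi>_def by (auto simp: restrict_PiE_iff)
  qed
  then have "finite (\<Phi> ` ?S)"
    by (rule finite_subset) (intro finite_cartesian_product finite_PiE fin)
  moreover have "finite {g \<in> ?S. \<Phi> g = \<Phi> h}" if h: "h \<in> ?S" for h
  proof -
    have hc: "h \<in> carrier \<Gamma>" using h by simp
    have "{g \<in> ?S. \<Phi> g = \<Phi> h} \<subseteq> (\<lambda>k. h \<otimes>\<^bsub>\<Gamma>\<^esub> k) ` kernel \<Gamma> isometry_group act"
    proof
      fix g assume "g \<in> {g \<in> ?S. \<Phi> g = \<Phi> h}"
      then have gc: "g \<in> carrier \<Gamma>" and eq: "\<Phi> g = \<Phi> h" by simp_all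
      have "restrict (\<phi> g) (vball u n) = restrict (\<phi> h) (vball u n)"
        "restrict (\<psi> g) (A n) = restrict (\<psi> h) (A n)" using eq by (simp_all add: \<Phi>_def)
      then have eqs: "\<And>v. v \<in> vball u n \<Longrightarrow> \<phi> g v = \<phi> h v" "\<And>e. e \<in> A n \<Longrightarrow> \<psi> g e = \<psi> h e"
        by (metis restrict_apply')+
      have "inv\<^bsub>\<Gamma>\<^esub> h \<otimes>\<^bsub>\<Gamma>\<^esub> g \<in> fixers u n"
        unfolding fixers_def
      proof (intro CollectI conjI ballI impI)
        show "inv\<^bsub>\<Gamma>\<^esub> h \<otimes>\<^bsub>\<Gamma>\<^esub> g \<in> carrier \<Gamma>" using hc gc by simp
      next
        fix v assume v: "v \<in> vball u n"
        then have vv: "v \<in> verts G" using vball_subset[OF u] by blast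
        have "\<phi> (inv\<^bsub>\<Gamma>\<^esub> h \<otimes>\<^bsub>\<Gamma>\<^esub> g) v = \<phi> (inv\<^bsub>\<Gamma>\<^esub> h) (\<phi> h v)"
          using vert.composition_rule[OF vv, of "inv\<^bsub>\<Gamma>\<^esub> h" g] hc gc eqs(1)[OF v] by simp
        also have "\<dots> = v" by (rule vert.orbit_sym_aux[OF hc vv refl])
        finally show "\<phi> (inv\<^bsub>\<Gamma>\<^esub> h \<otimes>\<^bsub>\<Gamma>\<^esub> g) v = v" .
      next
        fix e assume e: "e \<in> arcs G" "tail G e \<in> vball u n"
        have "\<psi> (inv\<^bsub>\<Gamma>\<^esub> h \<otimes>\<^bsub>\<Gamma>\<^esub> g) e = \<psi> (inv\<^bsub>\<Gamma>\<^esub> h) (\<psi> h e)"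
          using edge.composition_rule[OF e(1), of "inv\<^bsub>\<Gamma>\<^esub> h" g] hc gc eqs(2)[of e] e by (simp add: A_def)
        also have "\<dots> = e" by (rule edge.orbit_sym_aux[OF hc e(1) refl])
        finally show "\<psi> (inv\<^bsub>\<Gamma>\<^esub> h \<otimes>\<^bsub>\<Gamma>\<^esub> g) e = e" .
      qed
      then have "inv\<^bsub>\<Gamma>\<^esub> h \<otimes>\<^bsub>\<Gamma>\<^esub> g \<in> kernel \<Gamma> isometry_group act" using n by blast
      moreover have "g = h \<otimes>\<^bsub>\<Gamma>\<^esub> (inv\<^bsub>\<Gamma>\<^esub> h \<otimes>\<^bsub>\<Gamma>\<^esub> g)" using hc gc by (simp add: m_assoc[symmetric])
      ultimately show "g \<in> (\<lambda>k. h \<otimes>\<^bsub>\<Gamma>\<^esub> k) ` kernel \<Gamma> isometry_group act" by blast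
    qed
    then show ?thesis using fin_ker by (rule finite_subset[OF _ finite_imageI])
  qed
  then have "finite (\<Union>z\<in>\<Phi> ` ?S. {g \<in> ?S. \<Phi> g = z})" using \<open>finite (\<Phi> ` ?S)\<close> by (intro finite_UN_I) auto
  moreover have "?S = (\<Union>z\<in>\<Phi> ` ?S. {g \<in> ?S. \<Phi> g = z})" by auto
  ultimately show ?thesis by simp
qed

end

section \<open>Sequential compactness at infinity\<close>

text \<open>By \<open>interpolate\<close>, each late point lies behind a vertex of the finite ball
  of radius \<open>k\<close>. By the pigeonhole principle infinitely many share this vertex, and
  \<open>hyp\<close> bounds their mutual products below by \<open>k - \<delta>\<close>. A diagonal
  subsequence serves all \<open>k\<close>.\<close>

lemma (in bidirected_digraph) convergent_subsequence:
  assumes con: "connected G" and val: "bounded_valency G" and u: "u \<in> verts G"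
    and hyp: "\<And>w x y z. w \<in> realization G arev \<Longrightarrow> x \<in> realization G arev \<Longrightarrow>
      y \<in> realization G arev \<Longrightarrow> z \<in> realization G arev \<Longrightarrow>
      min (Metric_space.gromov_product (path_metric G arev) w x y)
        (Metric_space.gromov_product (path_metric G arev) w y z) - \<delta> \<le>
      Metric_space.gromov_product (path_metric G arev) w x z"
    and v: "range v \<subseteq> verts G" "\<And>n. real n \<le> path_metric G arev (Inl u) (Inl (v n))"
  shows "\<exists>\<sigma>. strict_mono \<sigma> \<and>
    (\<lambda>n. Inl (v (\<sigma> n))) \<in> Metric_space.gromov_sequences (realization G arev) (path_metric G arev)"
proof -
  interpret Metric_space "realization G arev" "path_metric G arev"
    by (rule Metric_space_realization[OF con])
  let ?g = "\<lambda>x y. gromov_product (Inl u) (Inl x) (Inl y)"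
  define P where "P k \<sigma> \<longleftrightarrow> (\<exists>N. \<forall>i\<ge>N. \<forall>j\<ge>N. real k - \<delta> \<le> ?g (v (\<sigma> i)) (v (\<sigma> j)))"
    for k and \<sigma> :: "nat \<Rightarrow> nat"
  have vv: "v n \<in> verts G" for n using v(1) by auto
  interpret subseqs P
  proof
    fix k and \<sigma> :: "nat \<Rightarrow> nat" assume \<sigma>: "strict_mono \<sigma>"
    have "\<exists>w\<in>vball u k. real k \<le> ?g w (v (\<sigma> i))" if "k \<le> i" for i
    proof (rule interpolate[OF con u vv])
      have "k \<le> \<sigma> i" using that seq_suble[OF \<sigma>, of i] by simp
      then show "real k \<le> path_metric G arev (Inl u) (Inl (v (\<sigma> i)))"
        using v(2)[of "\<sigma> i"] by linarith
    qed
    then obtain w where w: "\<And>i. k \<le> i \<Longrightarrow> w i \<in> vball u k" "\<And>i. k \<le> i \<Longrightarrow> real k \<le> ?g (w i) (v (\<sigma> i))"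
      by metis
    have "finite (w ` {k..})" using w(1) by (intro finite_subset[OF _ finite_vball[OF val u, of k]]) auto
    then obtain i0 where i0: "i0 \<in> {k..}" "infinite {i \<in> {k..}. w i = w i0}"
      using pigeonhole_infinite[of "{k..}" w] infinite_Ici by blast
    obtain r :: "nat \<Rightarrow> nat" where r: "strict_mono r" "\<forall>n. r n \<in> {i \<in> {k..}. w i = w i0}"
      using infinite_enumerate[OF i0(2)] by (elim exE conjE)
    have "real k - \<delta> \<le> ?g (v (\<sigma> (r i))) (v (\<sigma> (r j)))" for i j
    proof -
      have w0: "w i0 \<in> verts G" using w(1)[of i0] i0(1) vball_subset[OF u] by auto
      have "real k \<le> ?g (w i0) (v (\<sigma> (r n)))" for n
        using w(2)[of "r n"] r(2) by simp
      then have "real k \<le> ?g (v (\<sigma> (r i))) (w i0)" "real k \<le> ?g (w i0) (v (\<sigma> (r j)))"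
        by (simp_all add: gromov_product_swap[of "Inl u" _ "Inl (w i0)"])
      then show ?thesis
        using hyp[of "Inl u" "Inl (v (\<sigma> (r i)))" "Inl (w i0)" "Inl (v (\<sigma> (r j)))"] u vv w0 vertex_point_in
        by (simp add: min_def split: if_splits)
    qed
    then show "\<exists>r'. strict_mono r' \<and> P k (\<sigma> \<circ> r')"
      unfolding P_def using r(1) by (intro exI[of _ r]) simp
  qed
  \<comment> \<open>Stage \<open>k\<close> controls the diagonal sequence from index
    \<open>Suc k\<close> on; \<open>P\<close> passes to subsequences.\<close>
  have P_diag: "P k (diagseq \<circ> (+) (Suc k))" for k
  proof (rule diagseq_holds)
    fix r s :: "nat \<Rightarrow> nat" and n assume r: "strict_mono r" and "P n s"
    then obtain N where N: "\<And>i j. i \<ge> N \<Longrightarrow> j \<ge> N \<Longrightarrow> real n - \<delta> \<le> ?g (v (s i)) (v (s j))"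
      unfolding P_def by blast
    have "real n - \<delta> \<le> ?g (v ((s \<circ> r) i)) (v ((s \<circ> r) j))" if "i \<ge> N" "j \<ge> N" for i j
      using N[of "r i" "r j"] that seq_suble[OF r, of i] seq_suble[OF r, of j] by simp
    then show "P n (s \<circ> r)" unfolding P_def by blast
  qed
  have "diverging_products (Inl u) (\<lambda>n. Inl (v (diagseq n))) (\<lambda>n. Inl (v (diagseq n)))"
    unfolding diverging_products_def
  proof
    fix C
    obtain k :: nat where k: "C + \<delta> \<le> real k" using real_arch_simple by blast
    obtain N where N: "\<And>i j. i \<ge> N \<Longrightarrow> j \<ge> N \<Longrightarrow>
        real k - \<delta> \<le> ?g (v (diagseq (Suc k + i))) (v (diagseq (Suc k + j)))"
      using P_diag[of k] unfolding P_def comp_def by blast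
    have "C \<le> ?g (v (diagseq i)) (v (diagseq j))" if "i \<ge> Suc k + N" "j \<ge> Suc k + N" for i j
    proof -
      have "N \<le> i - Suc k" "N \<le> j - Suc k" using that by auto
      from N[OF this] show ?thesis using that k by simp
    qed
    then show "\<exists>N. \<forall>i\<ge>N. \<forall>j\<ge>N. C \<le> ?g (v (diagseq i)) (v (diagseq j))" by blast
  qed
  then have "(\<lambda>n. Inl (v (diagseq n))) \<in> gromov_sequences"
    using gromov_sequences_iff[OF vertex_point_in[OF u]] vv vertex_point_in by auto
  then show ?thesis using subseq_diagseq by blast
qed

theorem theorem3:
  fixes \<Gamma> :: "'g monoid"
    and G :: "('a, 'b) pre_digraph"
    and arev :: "'b \<Rightarrow> 'b"
    and \<phi> :: "'g \<Rightarrow> 'a \<Rightarrow> 'a"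
    and \<psi> :: "'g \<Rightarrow> 'b \<Rightarrow> 'b"
  defines "M \<equiv> realization G arev"
    and "d \<equiv> path_metric G arev"
    and "\<alpha> \<equiv> realization_action G arev \<phi> \<psi>"
  assumes "group \<Gamma>" and "countable (carrier \<Gamma>)"
    and "bidirected_digraph G arev" and "Digraph_Component.connected G"
    and "bounded_valency G"
    and "Metric_space.hyperbolic M d"
    and "graph_action \<Gamma> G arev \<phi> \<psi>"
    and "Metric_space.proper_action M d \<Gamma> \<alpha>"
    and "Metric_space.nonelementary_action M d \<Gamma> \<alpha>"
  shows "(\<forall>p\<ge>1. nontrivial (bounded_cohomology 2 \<Gamma> (ell TYPE(real) p \<Gamma>)) \<and>
                nontrivial (bounded_cohomology 2 \<Gamma> (ell TYPE(complex) p \<Gamma>))) \<and>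
         \<Gamma> \<in> class_Creg TYPE(real) \<and> \<Gamma> \<in> class_Creg TYPE(complex)"
proof -
  interpret group \<Gamma> by fact
  interpret graph_action \<Gamma> G arev \<phi> \<psi> by fact
  note con = \<open>connected G\<close>
  interpret Metric_space M d unfolding M_def d_def by (rule Metric_space_realization[OF con])
  have nonel: "\<not> elementary (\<alpha> ` carrier \<Gamma>)"
    using assms(12) unfolding nonelementary_action_def .
  have "strongly_connected G"
    using con by (simp add: symmetric_connected_imp_strongly_connected sym_arcs)
  \<comment> \<open>\<open>strongly_connected\<close> includes non-emptiness, which supplies the
    base vertex.\<close>
  then obtain u where u: "u \<in> verts G" by (auto simp: strongly_connected_def)
  obtain \<delta> where "\<And>w x y z. w \<in> M \<Longrightarrow> x \<in> M \<Longrightarrow> y \<in> M \<Longrightarrow> z \<in> M \<Longrightarrow>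
      gromov_product w x z \<ge> min (gromov_product w x y) (gromov_product w y z) - \<delta>"
    using assms(9) unfolding hyperbolic_def by blast
  note hyp = this
  have isom: "\<alpha> g \<in> carrier isometry_group" if "g \<in> carrier \<Gamma>" for g
    using hom_realization_action[OF con] that unfolding M_def d_def \<alpha>_def by (rule hom_in_carrier)
  have conv: "\<exists>\<sigma>. strict_mono \<sigma> \<and> (\<lambda>n. \<alpha> (f (\<sigma> n)) (Inl u)) \<in> gromov_sequences"
    if f: "range f \<subseteq> carrier \<Gamma>" "\<And>n. real n \<le> d (Inl u) (\<alpha> (f n) (Inl u))" for f
  proof -
    have eq: "\<alpha> (f n) (Inl u) = Inl (\<phi> (f n) u)" for n unfolding \<alpha>_def by (rule act_vert[OF u])
    have "range (\<lambda>n. \<phi> (f n) u) \<subseteq> verts G" using f(1) vert_closed[OF _ u] by auto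
    then show ?thesis
      using convergent_subsequence[OF con assms(8) u hyp[unfolded M_def d_def], of "\<lambda>n. \<phi> (f n) u"] f(2)
      unfolding eq M_def d_def by blast
  qed
  interpret isometric_action \<Gamma> M d \<alpha> "Inl u" \<delta>
  proof
    fix g h x y assume g: "g \<in> carrier \<Gamma>"
    show "\<alpha> g x \<in> M" if "x \<in> M" using act_closed[OF g] that unfolding \<alpha>_def M_def .
    show "\<alpha> (g \<otimes>\<^bsub>\<Gamma>\<^esub> h) x = \<alpha> g (\<alpha> h x)" if "h \<in> carrier \<Gamma>" "x \<in> M"
      using act_mult[OF g that(1)] that(2) unfolding \<alpha>_def M_def .
    show "d (\<alpha> g x) (\<alpha> g y) = d x y" if "x \<in> M" "y \<in> M"
      using isom[OF g] that by (simp add: isometry_group_carrier)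
  next
    show "\<alpha> \<one>\<^bsub>\<Gamma>\<^esub> x = x" if "x \<in> M" for x using act_one that unfolding \<alpha>_def M_def .
    show "Inl u \<in> M" unfolding M_def by (rule vertex_point_in[OF u])
    show "finite {g \<in> carrier \<Gamma>. d (Inl u) (\<alpha> g (Inl u)) \<le> r}" for r
      using finite_orbit_ball_graph[OF con assms(8) u assms(11)[unfolded M_def d_def \<alpha>_def]]
      unfolding d_def \<alpha>_def .
  qed (use hyp conv in blast)+
  obtain s T where sT: "alternating_free \<Gamma> orbit_dist \<delta> s T"
    using exists_alternating_free[OF nonel] by (elim exE)
  note nontrivial = alternating_free.nontrivial_ell_cohomology[OF sT]
  show ?thesis
    using nontrivial[where K = "TYPE(real)"] nontrivial[where K = "TYPE(complex)"] assms(4,5)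
    by (auto simp: class_Creg_def)
qed

end
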